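(* Let $(X,d,\mu,\mathcal E,\mathcal F)$ be a sub-Gaussian Dirichlet space with parameters $d_H,d_W$ such that $(X,d,\mu)$ is a fractional metric space of dimension $d_H$, and suppose that $1\le d_H<d_W$. Then $X$ satisfies the weak Bakry-Émery condition $wBE(\kappa)$ with $\kappa=d_W-d_H$; that is, there exists a constant $C>0$ such that for every $t>0$, every $g\in L^\infty(X,\mu)$ and all $x,y\in X$, $$|P_tg(x)-P_tg(y)|\le C\,\frac{d(x,y)^{d_W-d_H}}{t^{(d_W-d_H)/d_W}}\,\|g\|_{L^\infty(X,\mu)}.$$
   Context: A sub-Gaussian Dirichlet space $(X,d,\mu,\mathcal E,\mathcal F)$ with parameters $d_H,d_W$ means: $(X,d,\mu)$ is a locally compact metric measure space, $\mu$ is a Radon measure with support $X$, $(\mathcal E,\mathcal F)$ is a Dirichlet form on $L^2(X,\mu)$, and (i) every ball $B(x,r)=\{y: d(x,y)<r\}$, $x\in X$, $0<r<\infty$, has compact closure; (ii) $\mu$ is Ahlfors $d_H$-regular: there are $c_1,c_2,d_H\in(0,\infty)$ with $c_1r^{d_H}\le\mu(B(x,r))\le c_2r^{d_H}$ for all $x\in X$, $r\in[0,\infty)$; (iii) $\mathcal E$ is regular and strongly local (i.e. $\mathcal E(u,v)=0$ for $u,v\in\mathcal F$ with compact supports such that $u$ is constant in a neighborhood of the support of $v$); (iv) the heat semigroup $\{P_t\}$ of $(\mathcal E,\mathcal F)$ has a continuous heat kernel $p_t(x,y)$ (so $P_tg(x)=\int_Xp_t(x,y)g(y)\,d\mu(y)$)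 satisfying, for some $c_3,c_4,c_5,c_6\in(0,\infty)$ and $d_W\in(2,\infty)$, $$c_5t^{-d_H/d_W}\exp\Big(-c_6\Big(\tfrac{d(x,y)^{d_W}}{t}\Big)^{\frac1{d_W-1}}\Big)\le p_t(x,y)\le c_3t^{-d_H/d_W}\exp\Big(-c_4\Big(\tfrac{d(x,y)^{d_W}}{t}\Big)^{\frac1{d_W-1}}\Big)$$ for $\mu\times\mu$-a.e. $(x,y)$ and all $t>0$. In this setting $P_t1=1$. A complete metric measure space $(X,d,\mu)$ is a fractional metric space of dimension $d_H$ if it is Ahlfors $d_H$-regular and has the midpoint property: for all $x,y\in X$ there is $z\in X$ with $d(x,z)=d(z,y)=\frac12d(x,y)$ (equivalently, $X$ is geodesic). For $0<\kappa<d_W$, $X$ satisfies $wBE(\kappa)$ if there is $C>0$ such that $|P_tg(x)-P_tg(y)|\le C\frac{d(x,y)^\kappa}{t^{\kappa/d_W}}\|g\|_{L^\infty(X,\mu)}$ for all $t>0$, $g\in L^\infty(X,\mu)$, $x,y\in X$. *)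

theory Defs
  imports "HOL-Analysis.Analysis" "HOL-Probability.Essential_Supremum"
begin

text \<open>
  The underlying space is the whole of a type of class \<^class>\<open>metric_space\<close>, carrying a Borel
  measure.  Elements of \<open>L\<^sup>2\<close> and \<open>L\<^sup>\<infinity>\<close> are represented by real Borel functions; all operations
  on \<open>L\<^sup>2\<close> are required to respect almost-everywhere equality.
\<close>

section \<open>Metric measure spaces\<close>

definition radon_measure :: "'a::metric_space measure \<Rightarrow> bool" where
  "radon_measure M \<longleftrightarrow>
     sets M = sets (borel :: 'a measure) \<and>
     (\<forall>K. compact K \<longrightarrow> emeasure M K < \<infinity>) \<and>
     (\<forall>A\<in>sets M. emeasure M A = (INF U\<in>{U. open U \<and> A \<subseteq> U}. emeasure M U)) \<and>
     (\<forall>U. open U \<longrightarrow> emeasure M U = (SUP K\<in>{K. compact K \<and> K \<subseteq> U}. emeasure M K))"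

definition measure_support :: "'a::metric_space measure \<Rightarrow> 'a set" where
  "measure_support M = {x. \<forall>U. open U \<and> x \<in> U \<longrightarrow> emeasure M U > 0}"

definition ahlfors_regular :: "'a::metric_space measure \<Rightarrow> real \<Rightarrow> bool" where
  "ahlfors_regular M dH \<longleftrightarrow>
     0 < dH \<and>
     (\<exists>c1>0. \<exists>c2>0. \<forall>x. \<forall>r\<ge>0.
        ennreal (c1 * r powr dH) \<le> emeasure M (ball x r) \<and>
        emeasure M (ball x r) \<le> ennreal (c2 * r powr dH))"

definition midpoint_property :: "'a::metric_space itself \<Rightarrow> bool" where
  "midpoint_property _ \<longleftrightarrow>
     (\<forall>x y :: 'a. \<exists>z. dist x z = dist x y / 2 \<and> dist z y = dist x y / 2)"

definition fractional_metric_space :: "'a::metric_space measure \<Rightarrow> real \<Rightarrow> bool" where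
  "fractional_metric_space M dH \<longleftrightarrow>
     sets M = sets (borel :: 'a measure) \<and>
     complete (UNIV :: 'a set) \<and> ahlfors_regular M dH \<and> midpoint_property TYPE('a)"

section \<open>Function spaces\<close>

definition L2_fun :: "'a measure \<Rightarrow> ('a \<Rightarrow> real) set" where
  "L2_fun M = {u \<in> borel_measurable M. integrable M (\<lambda>x. (u x)\<^sup>2)}"

definition L2_inner :: "'a measure \<Rightarrow> ('a \<Rightarrow> real) \<Rightarrow> ('a \<Rightarrow> real) \<Rightarrow> real" where
  "L2_inner M u v = (LINT x|M. u x * v x)"

definition L2_norm :: "'a measure \<Rightarrow> ('a \<Rightarrow> real) \<Rightarrow> real" where
  "L2_norm M u = sqrt (L2_inner M u u)"

definition Linf_fun :: "'a measure \<Rightarrow> ('a \<Rightarrow> real) set" where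
  "Linf_fun M = {g \<in> borel_measurable M. esssup M (\<lambda>x. ereal \<bar>g x\<bar>) < \<infinity>}"

definition Linf_norm :: "'a measure \<Rightarrow> ('a \<Rightarrow> real) \<Rightarrow> real" where
  "Linf_norm M g = real_of_ereal (esssup M (\<lambda>x. ereal \<bar>g x\<bar>))"

text \<open>Support of an almost-everywhere class: the complement of the largest open set on which
  \<open>u\<close> vanishes almost everywhere.\<close>

definition ess_support :: "'a::metric_space measure \<Rightarrow> ('a \<Rightarrow> real) \<Rightarrow> 'a set" where
  "ess_support M u = - \<Union>{U. open U \<and> (AE x in M. x \<in> U \<longrightarrow> u x = 0)}"

definition Cc :: "('a::metric_space \<Rightarrow> real) set" where
  "Cc = {u. continuous_on UNIV u \<and> compact (closure {x. u x \<noteq> 0})}"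

section \<open>Dirichlet forms\<close>

definition form1 ::
  "'a measure \<Rightarrow> (('a \<Rightarrow> real) \<Rightarrow> ('a \<Rightarrow> real) \<Rightarrow> real) \<Rightarrow> ('a \<Rightarrow> real) \<Rightarrow> ('a \<Rightarrow> real) \<Rightarrow> real" where
  "form1 M E u v = E u v + L2_inner M u v"

locale dirichlet_form =
  fixes M :: "'a measure"
    and E :: "('a \<Rightarrow> real) \<Rightarrow> ('a \<Rightarrow> real) \<Rightarrow> real"
    and F :: "('a \<Rightarrow> real) set"
  assumes F_L2: "F \<subseteq> L2_fun M"
    and F_zero: "(\<lambda>_. 0) \<in> F"
    and F_add: "\<lbrakk>u \<in> F; v \<in> F\<rbrakk> \<Longrightarrow> (\<lambda>x. u x + v x) \<in> F"
    and F_scale: "u \<in> F \<Longrightarrow> (\<lambda>x. a * u x) \<in> F"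
    and F_AE: "\<lbrakk>u \<in> F; v \<in> borel_measurable M; AE x in M. u x = v x\<rbrakk> \<Longrightarrow> v \<in> F"
    and F_dense: "\<lbrakk>f \<in> L2_fun M; e > 0\<rbrakk> \<Longrightarrow> \<exists>u\<in>F. L2_norm M (\<lambda>x. f x - u x) < e"
    and E_AE: "\<lbrakk>u \<in> F; v \<in> F; w \<in> F; AE x in M. u x = v x\<rbrakk> \<Longrightarrow> E u w = E v w"
    and E_sym: "\<lbrakk>u \<in> F; v \<in> F\<rbrakk> \<Longrightarrow> E u v = E v u"
    and E_add: "\<lbrakk>u \<in> F; v \<in> F; w \<in> F\<rbrakk> \<Longrightarrow> E (\<lambda>x. u x + v x) w = E u w + E v w"
    and E_scale: "\<lbrakk>u \<in> F; w \<in> F\<rbrakk> \<Longrightarrow> E (\<lambda>x. a * u x) w = a * E u w"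
    and E_nonneg: "u \<in> F \<Longrightarrow> E u u \<ge> 0"
    and E_closed:
      "\<lbrakk>\<And>n::nat. us n \<in> F;
        \<And>e. e > 0 \<Longrightarrow> \<exists>N. \<forall>m\<ge>N. \<forall>n\<ge>N.
          form1 M E (\<lambda>x. us m x - us n x) (\<lambda>x. us m x - us n x) < e\<rbrakk>
       \<Longrightarrow> \<exists>w\<in>F. (\<lambda>n. form1 M E (\<lambda>x. us n x - w x) (\<lambda>x. us n x - w x)) \<longlonglongrightarrow> 0"
    and E_markov:
      "u \<in> F \<Longrightarrow> (\<lambda>x. min (max (u x) 0) 1) \<in> F \<and>
         E (\<lambda>x. min (max (u x) 0) 1) (\<lambda>x. min (max (u x) 0) 1) \<le> E u u"

definition regular_form ::
  "'a::metric_space measure \<Rightarrow> (('a \<Rightarrow> real) \<Rightarrow> ('a \<Rightarrow> real) \<Rightarrow> real) \<Rightarrow> ('a \<Rightarrow> real) set \<Rightarrow> bool" where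
  "regular_form M E F \<longleftrightarrow>
     (\<forall>u\<in>F. \<forall>e>0. \<exists>v \<in> F \<inter> Cc. form1 M E (\<lambda>x. u x - v x) (\<lambda>x. u x - v x) < e) \<and>
     (\<forall>f\<in>Cc. \<forall>e>0. \<exists>v \<in> F \<inter> Cc. \<forall>x. \<bar>f x - v x\<bar> < e)"

definition strongly_local_form ::
  "'a::metric_space measure \<Rightarrow> (('a \<Rightarrow> real) \<Rightarrow> ('a \<Rightarrow> real) \<Rightarrow> real) \<Rightarrow> ('a \<Rightarrow> real) set \<Rightarrow> bool" where
  "strongly_local_form M E F \<longleftrightarrow>
     (\<forall>u\<in>F. \<forall>v\<in>F.
        compact (ess_support M u) \<and> compact (ess_support M v) \<and>
        (\<exists>U c. open U \<and> ess_support M v \<subseteq> U \<and> (AE x in M. x \<in> U \<longrightarrow> u x = c))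
        \<longrightarrow> E u v = 0)"

section \<open>The heat semigroup and its kernel\<close>

locale l2_contraction_semigroup =
  fixes M :: "'a measure"
    and P :: "real \<Rightarrow> ('a \<Rightarrow> real) \<Rightarrow> 'a \<Rightarrow> real"
  assumes P_L2: "\<lbrakk>t > 0; u \<in> L2_fun M\<rbrakk> \<Longrightarrow> P t u \<in> L2_fun M"
    and P_AE: "\<lbrakk>t > 0; u \<in> L2_fun M; v \<in> L2_fun M; AE x in M. u x = v x\<rbrakk>
          \<Longrightarrow> AE x in M. P t u x = P t v x"
    and P_linear: "\<lbrakk>t > 0; u \<in> L2_fun M; v \<in> L2_fun M\<rbrakk>
          \<Longrightarrow> AE x in M. P t (\<lambda>y. a * u y + b * v y) x = a * P t u x + b * P t v x"
    and P_sym: "\<lbrakk>t > 0; u \<in> L2_fun M; v \<in> L2_fun M\<rbrakk>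
          \<Longrightarrow> L2_inner M (P t u) v = L2_inner M u (P t v)"
    and P_contraction: "\<lbrakk>t > 0; u \<in> L2_fun M\<rbrakk> \<Longrightarrow> L2_norm M (P t u) \<le> L2_norm M u"
    and P_semigroup: "\<lbrakk>s > 0; t > 0; u \<in> L2_fun M\<rbrakk>
          \<Longrightarrow> AE x in M. P (s + t) u x = P s (P t u) x"
    and P_continuous: "u \<in> L2_fun M
          \<Longrightarrow> ((\<lambda>t. L2_norm M (\<lambda>x. P t u x - u x)) \<longlongrightarrow> 0) (at_right 0)"

text \<open>Both generators are given by their graphs: \<open>u\<close> is in the domain and is mapped to \<open>f\<close>.\<close>

definition semigroup_generator ::
  "'a measure \<Rightarrow> (real \<Rightarrow> ('a \<Rightarrow> real) \<Rightarrow> 'a \<Rightarrow> real) \<Rightarrow> ('a \<Rightarrow> real) \<Rightarrow> ('a \<Rightarrow> real) \<Rightarrow> bool" where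
  "semigroup_generator M P u f \<longleftrightarrow>
     u \<in> L2_fun M \<and> f \<in> L2_fun M \<and>
     ((\<lambda>t. L2_norm M (\<lambda>x. (P t u x - u x) / t - f x)) \<longlongrightarrow> 0) (at_right 0)"

definition form_generator ::
  "'a measure \<Rightarrow> (('a \<Rightarrow> real) \<Rightarrow> ('a \<Rightarrow> real) \<Rightarrow> real) \<Rightarrow> ('a \<Rightarrow> real) set \<Rightarrow>
     ('a \<Rightarrow> real) \<Rightarrow> ('a \<Rightarrow> real) \<Rightarrow> bool" where
  "form_generator M E F u f \<longleftrightarrow>
     u \<in> F \<and> f \<in> L2_fun M \<and> (\<forall>v\<in>F. E u v = - L2_inner M f v)"

definition heat_semigroup ::
  "'a measure \<Rightarrow> (('a \<Rightarrow> real) \<Rightarrow> ('a \<Rightarrow> real) \<Rightarrow> real) \<Rightarrow> ('a \<Rightarrow> real) set \<Rightarrow>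
     (real \<Rightarrow> ('a \<Rightarrow> real) \<Rightarrow> 'a \<Rightarrow> real) \<Rightarrow> bool" where
  "heat_semigroup M E F P \<longleftrightarrow>
     l2_contraction_semigroup M P \<and>
     (\<forall>u f. semigroup_generator M P u f \<longleftrightarrow> form_generator M E F u f)"

definition kernel_op :: "'a measure \<Rightarrow> (real \<Rightarrow> 'a \<Rightarrow> 'a \<Rightarrow> real) \<Rightarrow> real \<Rightarrow> ('a \<Rightarrow> real) \<Rightarrow> 'a \<Rightarrow> real" where
  "kernel_op M p t g x = (LINT y|M. p t x y * g y)"

definition continuous_heat_kernel ::
  "'a::metric_space measure \<Rightarrow> (real \<Rightarrow> ('a \<Rightarrow> real) \<Rightarrow> 'a \<Rightarrow> real) \<Rightarrow>
     (real \<Rightarrow> 'a \<Rightarrow> 'a \<Rightarrow> real) \<Rightarrow> bool" where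
  "continuous_heat_kernel M P p \<longleftrightarrow>
     (\<forall>t>0. continuous_on UNIV (\<lambda>(x, y). p t x y)) \<and>
     (\<forall>t>0. \<forall>g\<in>L2_fun M.
        AE x in M. integrable M (\<lambda>y. p t x y * g y) \<and> P t g x = kernel_op M p t g x)"

definition sub_gaussian :: "real \<Rightarrow> real \<Rightarrow> real \<Rightarrow> real \<Rightarrow> real \<Rightarrow> real \<Rightarrow> real" where
  "sub_gaussian dH dW c c' t r =
     c * t powr (- dH / dW) * exp (- c' * (r powr dW / t) powr (1 / (dW - 1)))"

definition sub_gaussian_estimates ::
  "'a::metric_space measure \<Rightarrow> (real \<Rightarrow> 'a \<Rightarrow> 'a \<Rightarrow> real) \<Rightarrow> real \<Rightarrow> real \<Rightarrow> bool" where
  "sub_gaussian_estimates M p dH dW \<longleftrightarrow>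
     (\<exists>c3>0. \<exists>c4>0. \<exists>c5>0. \<exists>c6>0. \<forall>t>0. AE (x, y) in M \<Otimes>\<^sub>M M.
        sub_gaussian dH dW c5 c6 t (dist x y) \<le> p t x y \<and>
        p t x y \<le> sub_gaussian dH dW c3 c4 t (dist x y))"

locale sub_gaussian_dirichlet_space = dirichlet_form M E F
  for M :: "'a::metric_space measure"
    and E :: "('a \<Rightarrow> real) \<Rightarrow> ('a \<Rightarrow> real) \<Rightarrow> real"
    and F :: "('a \<Rightarrow> real) set" +
  fixes P :: "real \<Rightarrow> ('a \<Rightarrow> real) \<Rightarrow> 'a \<Rightarrow> real"
    and p :: "real \<Rightarrow> 'a \<Rightarrow> 'a \<Rightarrow> real"
    and dH dW :: real
  assumes locally_compact: "locally compact (UNIV :: 'a set)"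
    and radon: "radon_measure M"
    and full_support: "measure_support M = UNIV"
    and compact_balls: "\<And>(x::'a) r. 0 < r \<Longrightarrow> compact (closure (ball x r))"
    and ahlfors: "ahlfors_regular M dH"
    and regular: "regular_form M E F"
    and strongly_local: "strongly_local_form M E F"
    and dW_gt_2: "2 < dW"
    and heat_semigroup: "heat_semigroup M E F P"
    and heat_kernel: "continuous_heat_kernel M P p"
    and estimates: "sub_gaussian_estimates M p dH dW"

text \<open>
  On \<open>L\<^sup>\<infinity>\<close> the heat semigroup acts through its continuous kernel, which defines it at every point.
\<close>

definition weak_bakry_emery ::
  "'a::metric_space measure \<Rightarrow> (real \<Rightarrow> 'a \<Rightarrow> 'a \<Rightarrow> real) \<Rightarrow> real \<Rightarrow> real \<Rightarrow> bool" where
  "weak_bakry_emery M p dW \<kappa> \<longleftrightarrow>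
     0 < \<kappa> \<and> \<kappa> < dW \<and>
     (\<exists>C>0. \<forall>t>0. \<forall>g\<in>Linf_fun M. \<forall>x y.
        \<bar>kernel_op M p t g x - kernel_op M p t g y\<bar>
          \<le> C * (dist x y powr \<kappa> / t powr (\<kappa> / dW)) * Linf_norm M g)"

end

theory Submission
  imports Defs "HOL-Probability.Distributions"
begin

text \<open>
  Integrate the kernel in time to the resolvent kernel \<open>u\<^sub>l(x,y) = \<integral> e\<^sup>-\<^sup>l\<^sup>s p\<^sub>s(x,y) ds\<close>, which is finite on
  the diagonal because \<open>dH < dW\<close>.  The jump energy \<open>\<integral>\<integral> u\<^sub>m(x,y) (f(x) - f(y))\<^sup>2\<close> of
  \<open>f = u\<^sub>l(x,\<sqdot>) - u\<^sub>l(y,\<sqdot>)\<close> is controlled by \<open>R = u\<^sub>l(x,x) + u\<^sub>l(y,y) - 2 u\<^sub>l(x,y) = f(x) - f(y)\<close>, and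
  the near-diagonal lower bound on \<open>u\<^sub>m\<close> turns this into a Morrey estimate \<open>R \<le> C (R d\<^sup>\<kappa>)\<^sup>1\<^sup>/\<^sup>2\<close>, hence
  \<open>R \<le> C d\<^sup>\<kappa>\<close> with \<open>\<kappa> = dW - dH\<close>.  The maximum principle gives
  \<open>u\<^sub>l(x,z) - u\<^sub>l(y,z) \<le> u\<^sub>l(x,z) R / u\<^sub>l(x,x)\<close>, and integrating in \<open>z\<close> bounds the \<open>L\<^sup>1\<close> distance of
  \<open>u\<^sub>l(x,\<sqdot>)\<close> and \<open>u\<^sub>l(y,\<sqdot>)\<close> with the full exponent \<open>\<kappa>\<close>.  Finally \<open>P\<^sub>t g = U\<^sub>l (l - L) P\<^sub>t g\<close> with
  \<open>l = 1/t\<close>, where \<open>\<parallel>L P\<^sub>t g\<parallel>\<^sub>\<infinity> \<le> C \<parallel>g\<parallel>\<^sub>\<infinity> / t\<close>: on the diagonal the kernel is completely monotone in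
  time, and interpolating the resulting second-difference bound with the decay of the kernel
  gives integrable control of the first difference.  The Dirichlet form enters only through
  \<open>l U\<^sub>l 1 \<le> 1\<close>, which is read off from the Markov property on the domain of the generator.
\<close>

section \<open>Ahlfors regular spaces\<close>

text \<open>The obstacle is to reach the exponent dW - dH and not merely some positive one, with no
  Poincare or cutoff inequality for the local form at hand. The jump energy replaces that form: at m
  = rho^(-dW) the kernel u_m is bounded below on pairs of points at distance of order rho, and with
  the lower bound on ball volumes this acts as a Poincare inequality at scale rho, while the energy
  of f is computed exactly from resolvent identities. The oscillation so obtained is of order
  R^(1/2) rho^((dW-dH)/2); since the oscillation of f between x and y is R itself, cancelling
  R^(1/2) doubles the exponent. The passage to L1 must not take a second square root: the maximum
  principle gives a bound linear in R whose factor u_l(x,z) also supplies integrability in z. The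
  maximum principle in turn needs l U_l 1 \<le> 1 with the constant exactly 1, which the kernel
  upper bound cannot give.\<close>

lemma powr_mult_exp_bound:
  fixes c m y :: real
  assumes "0 < c" "0 < m" "0 < y"
  shows "y powr m \<le> (m / c) powr m * exp (c * y)"
proof -
  \<comment> \<open>The maximum of y^m e^(-cy) is at y = m / c, where this tangent bound is an
    equality; the resulting gain e^(-m) is discarded.\<close>
  have "ln (c * y / m) \<le> c * y / m - 1"
    using assms by (intro ln_le_minus_one) auto
  then have "m * ln (c * y / m) \<le> c * y - m"
    using assms by (simp add: field_simps)
  moreover have "ln (c * y / m) = ln y - ln (m / c)"
    using assms by (simp add: ln_div ln_mult)
  ultimately have "m * ln y \<le> m * ln (m / c) + c * y"
    using assms by (simp add: algebra_simps)
  then have "exp (m * ln y) \<le> exp (m * ln (m / c) + c * y)"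
    by simp
  then show ?thesis
    using assms by (simp add: powr_def exp_add)
qed

text \<open>Since q > 1, \<xi>^q is at least \<xi> - 1, so the decay is at least exponential and
  beats every power. Passing from \<xi> - 1 to 1 + \<xi> costs the factor e^(2c).\<close>

lemma sub_gaussian_le_polynomial:
  fixes c q m \<xi> :: real
  assumes "0 < c" "1 < q" "0 < m" "0 \<le> \<xi>"
  shows "exp (- c * \<xi> powr q) \<le> exp (2 * c) * (m / c) powr m * (1 + \<xi>) powr (- m)"
proof -
  have "\<xi> - 1 \<le> \<xi> powr q"
  proof (cases "1 \<le> \<xi>")
    case True
    then have "\<xi> powr 1 \<le> \<xi> powr q"
      using assms by (intro powr_mono) auto
    then show ?thesis using True by simp
  next
    case False
    then show ?thesis
      by (meson diff_le_0_iff_le linorder_le_cases order_trans powr_ge_zero)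
  qed
  then have "- c * \<xi> powr q \<le> 2 * c - c * (1 + \<xi>)"
    using mult_left_mono[of "\<xi> - 1" "\<xi> powr q" c] assms by (simp add: algebra_simps)
  then have "exp (- c * \<xi> powr q) \<le> exp (2 * c) / exp (c * (1 + \<xi>))"
    by (metis exp_diff exp_le_cancel_iff)
  also have "\<dots> \<le> exp (2 * c) * ((m / c) powr m * (1 + \<xi>) powr (- m))"
  proof -
    have "(1 + \<xi>) powr m \<le> (m / c) powr m * exp (c * (1 + \<xi>))"
      using assms by (intro powr_mult_exp_bound) auto
    then have "1 / exp (c * (1 + \<xi>)) \<le> (m / c) powr m * (1 + \<xi>) powr (- m)"
      using assms by (simp add: powr_minus field_simps)
    then show ?thesis
      by (metis exp_ge_zero mult.right_neutral mult_left_mono times_divide_eq_right)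
  qed
  finally show ?thesis by (simp add: mult.assoc)
qed

section \<open>Integrability, separability and almost everywhere arguments on balls\<close>

lemma integrable_mult_bounded:
  fixes f g :: "'b \<Rightarrow> real"
  assumes "integrable M f" "g \<in> borel_measurable M" "\<And>y. \<bar>g y\<bar> \<le> B"
  shows "integrable M (\<lambda>y. f y * g y)"
proof (rule Bochner_Integration.integrable_bound)
  show "integrable M (\<lambda>y. f y * B)"
    using assms by auto
  show "(\<lambda>y. f y * g y) \<in> borel_measurable M"
    using assms by measurable
  have "\<bar>g y\<bar> \<le> \<bar>B\<bar>" for y
    using assms(3)[of y] by linarith
  then show "AE y in M. norm (f y * g y) \<le> norm (f y * B)"
    by (auto simp: abs_mult intro!: mult_left_mono)
qed

text \<open>Closures of balls are totally bounded; finite nets of mesh 1/(m+1) for radii n+1, over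
  all n and m, form the set \<open>D\<close>. It stands in for second countability in
  \<open>caratheodory_measurable\<close>.\<close>

lemma separable_of_proper:
  assumes "\<And>(x::'a::metric_space) r. 0 < r \<Longrightarrow> compact (closure (ball x r))"
  shows "\<exists>D::'a set. countable D \<and> (\<forall>x. \<forall>e>0. \<exists>d\<in>D. dist x d < e)"
proof -
  fix x0 :: 'a
  have "\<exists>k. finite k \<and> closure (ball x0 (Suc n)) \<subseteq> (\<Union>x\<in>k. ball x (1 / Suc m))" for n m :: nat
    using assms[of "real (Suc n)" x0] unfolding compact_eq_totally_bounded
    by (metis divide_pos_pos of_nat_0_less_iff zero_less_Suc zero_less_one)
  then obtain k where k: "\<And>n m. finite (k n m)"
      "\<And>n m. closure (ball x0 (Suc n)) \<subseteq> (\<Union>x\<in>k n m. ball x (1 / Suc m))"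
    by metis
  show ?thesis
  proof (intro exI conjI allI impI)
    show "countable (\<Union>n m. k n m)"
      using k(1) by (intro countable_UN) (auto intro: countable_finite)
    fix x :: 'a and e :: real
    assume "e > 0"
    then obtain m where m: "1 / real (Suc m) < e"
      using nat_approx_posE by blast
    obtain n where "dist x0 x < real n"
      using reals_Archimedean2 by blast
    then have "x \<in> closure (ball x0 (Suc n))"
      by (intro subsetD[OF closure_subset]) (simp add: less_Suc_eq)
    then obtain d where "d \<in> k n m" "x \<in> ball d (1 / Suc m)"
      using k(2) by blast
    then show "\<exists>d\<in>(\<Union>n m. k n m). dist x d < e"
      using m by (intro bexI[of _ d]) (auto simp: dist_commute)
  qed
qed

locale ahlfors_space =
  fixes M :: "'a::metric_space measure" and dH c1 c2 :: real
  assumes sets_M [measurable_cong]: "sets M = sets (borel :: 'a measure)"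
    and dH_pos: "0 < dH" and c1_pos: "0 < c1" and c2_pos: "0 < c2"
    and ball_lower: "0 < r \<Longrightarrow> ennreal (c1 * r powr dH) \<le> emeasure M (ball x r)"
    and ball_upper: "0 < r \<Longrightarrow> emeasure M (ball x r) \<le> ennreal (c2 * r powr dH)"
    and separable: "\<exists>D::'a set. countable D \<and> (\<forall>x. \<forall>e>0. \<exists>d\<in>D. dist x d < e)"
begin

lemma space_M [simp]: "space M = UNIV"
  using sets_eq_imp_space_eq[OF sets_M] by simp

lemma ball_meas [measurable, simp]: "ball x r \<in> sets M"
  by (simp add: sets_M)

lemma ball_finite: "emeasure M (ball x r) < \<infinity>"
proof (cases "0 < r")
  case True
  then show ?thesis
    using ball_upper[OF True, of x] by (metis ennreal_less_top infinity_ennreal_def order_le_less_trans)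
next
  case False
  then have "ball x r = {}" by simp
  then show ?thesis by (simp only: emeasure_empty) simp
qed

lemma measure_ball_lower: "0 < r \<Longrightarrow> c1 * r powr dH \<le> measure M (ball x r)"
  using ball_lower[of r x] ball_finite[of x r]
  by (subst (asm) emeasure_eq_ennreal_measure) auto

lemma measure_ball_pos: "0 < r \<Longrightarrow> 0 < measure M (ball x r)"
  using measure_ball_lower[of r x] c1_pos
  by (smt (verit) mult_pos_pos powr_gt_zero)

lemma integrable_indicator_ball: "integrable M (indicator (ball x r) :: 'a \<Rightarrow> real)"
  using ball_finite[of x r] by (intro integrable_real_indicator) auto

sublocale sigma_finite_measure M
proof
  fix x0 :: 'a
  show "\<exists>A. countable A \<and> A \<subseteq> sets M \<and> \<Union>A = space M \<and> (\<forall>a\<in>A. emeasure M a \<noteq> \<infinity>)"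
  proof (intro exI[of _ "range (\<lambda>n. ball x0 (real n))"] conjI)
    show "\<Union> (range (\<lambda>n. ball x0 (real n))) = space M"
      using reals_Archimedean2 by (auto)
    show "\<forall>a\<in>range (\<lambda>n. ball x0 (real n)). emeasure M a \<noteq> \<infinity>"
      using ball_finite by (auto simp: less_top[symmetric])
  qed (auto)
qed

lemma continuous_measurable: "continuous_on UNIV f \<Longrightarrow> f \<in> borel_measurable M"
  by (simp add: borel_measurable_continuous_onI measurable_cong_sets[OF sets_M refl])

text \<open>A negative value would persist on a ball by continuity, and balls have positive measure.
  This turns almost everywhere information about the semigroup into pointwise statements about its
  kernel.\<close>

lemma AE_nonneg_continuous:
  fixes f :: "'a \<Rightarrow> real"
  assumes f: "continuous_on UNIV f" and "AE x in M. 0 \<le> f x"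
  shows "0 \<le> f x"
proof (rule ccontr)
  assume neg: "\<not> 0 \<le> f x"
  have "open {x. f x < 0}"
    using f by (simp add: open_Collect_less)
  then obtain e where e: "e > 0" "ball x e \<subseteq> {x. f x < 0}"
    using neg by (metis (no_types, lifting) mem_Collect_eq not_le open_contains_ball)
  have "AE y in M. y \<notin> ball x e"
    using assms(2) e(2) by (auto elim!: eventually_mono)
  then have "emeasure M (ball x e) = 0"
    by (simp add: AE_iff_null_sets[symmetric] null_setsD1 del: mem_ball)
  then show False
    using measure_ball_pos[OF e(1), of x] by (simp add: measure_def)
qed

lemma AE_eq_continuous:
  fixes f g :: "'a \<Rightarrow> real"
  assumes "continuous_on UNIV f" "continuous_on UNIV g" "AE x in M. f x = g x"
  shows "f x = g x"
proof (rule antisym)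
  have "0 \<le> g x - f x"
    using assms by (intro AE_nonneg_continuous continuous_intros) (auto elim: eventually_mono)
  then show "f x \<le> g x" by simp
  have "0 \<le> f x - g x"
    using assms by (intro AE_nonneg_continuous continuous_intros) (auto elim: eventually_mono)
  then show "g x \<le> f x" by simp
qed

lemma continuous_integrable_on_ball:
  fixes f :: "'a \<Rightarrow> real"
  assumes "f \<in> borel_measurable M" "\<And>y. \<bar>f y\<bar> \<le> B"
  shows "integrable M (\<lambda>y. f y * indicator (ball x r) y)"
proof (rule Bochner_Integration.integrable_bound[where f = "\<lambda>y. B * indicator (ball x r) y"])
  show "integrable M (\<lambda>y. B * indicator (ball x r) y :: real)"
    using integrable_indicator_ball by auto
  show "(\<lambda>y. f y * indicator (ball x r) y) \<in> borel_measurable M"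
    using assms(1) by measurable
  have "\<bar>f y\<bar> \<le> \<bar>B\<bar>" for y
    using assms(2)[of y] by linarith
  then show "AE y in M. norm (f y * indicator (ball x r) y) \<le> norm (B * indicator (ball x r) y)"
    by (auto simp: indicator_def)
qed

text \<open>A gap at \<open>x\<close> keeps its sign on a small ball, so the integrals over that
  ball differ. Kernels are known only through their action on functions, hence identities between
  them are tested on balls; the bound \<open>B\<close> ensures integrability there.\<close>

lemma eq_of_ball_integrals:
  fixes f g :: "'a \<Rightarrow> real"
  assumes f: "continuous_on UNIV f" and g: "continuous_on UNIV g"
    and bounded: "\<And>y. \<bar>f y\<bar> \<le> B" "\<And>y. \<bar>g y\<bar> \<le> B"
    and eq: "\<And>z r. 0 < r \<Longrightarrow> (LINT y|M. f y * indicator (ball z r) y) = (LINT y|M. g y * indicator (ball z r) y)"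
  shows "f x = g x"
proof -
  have *: False if F: "continuous_on UNIV F" and G: "continuous_on UNIV G"
      and lt: "F x < G x" and b: "\<And>y. \<bar>F y\<bar> \<le> B" "\<And>y. \<bar>G y\<bar> \<le> B"
      and eq: "\<And>z r. 0 < r \<Longrightarrow> (LINT y|M. F y * indicator (ball z r) y) = (LINT y|M. G y * indicator (ball z r) y)"
    for F G :: "'a \<Rightarrow> real"
  proof -
    define d where "d = (G x - F x) / 2"
    have "open {y. d < G y - F y}"
      using F G by (intro open_Collect_less continuous_intros) auto
    moreover have "x \<in> {y. d < G y - F y}"
      using lt by (simp add: d_def field_simps)
    ultimately obtain e where e: "e > 0" "ball x e \<subseteq> {y. d < G y - F y}"
      by (meson open_contains_ball)
    have iF: "integrable M (\<lambda>y. F y * indicator (ball x e) y)"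
      by (rule continuous_integrable_on_ball[OF continuous_measurable[OF F] b(1)])
    have iG: "integrable M (\<lambda>y. G y * indicator (ball x e) y)"
      by (rule continuous_integrable_on_ball[OF continuous_measurable[OF G] b(2)])
    have "d * measure M (ball x e) = (LINT y|M. d * indicator (ball x e) y)"
      by simp
    also have "\<dots> \<le> (LINT y|M. G y * indicator (ball x e) y - F y * indicator (ball x e) y)"
    proof (rule integral_mono)
      show "integrable M (\<lambda>y. d * indicator (ball x e) y)"
        using integrable_indicator_ball by auto
      show "integrable M (\<lambda>y. G y * indicator (ball x e) y - F y * indicator (ball x e) y)"
        using iF iG by (rule Bochner_Integration.integrable_diff[rotated])
    qed (use e in \<open>auto simp: indicator_def\<close>)
    also have "\<dots> = 0"
      using iF iG eq[OF e(1)] by simp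
    finally show False
      using lt measure_ball_pos[OF e(1), of x] unfolding d_def
      by (simp add: mult_le_0_iff)
  qed
  show ?thesis
  proof (rule linorder_cases[of "f x" "g x"])
    assume "f x < g x"
    from *[OF f g this bounded] eq show ?thesis by blast
  next
    assume "g x < f x"
    from *[OF g f this bounded(2,1)] eq show ?thesis by metis
  qed
qed

text \<open>The type is not assumed to be second countable, so the Borel sets of the product may
  exceed the product \<open>\<sigma>\<close>-algebra; countably many nearest-point approximations repair this.\<close>

lemma caratheodory_measurable:
  fixes f :: "'b \<Rightarrow> 'a \<Rightarrow> real"
  assumes meas: "\<And>y. (\<lambda>s. f s y) \<in> borel_measurable N"
    and cont: "\<And>s. s \<in> space N \<Longrightarrow> continuous_on UNIV (f s)"
  shows "(\<lambda>(s, y). f s y) \<in> borel_measurable (N \<Otimes>\<^sub>M M)"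
proof -
  obtain D :: "'a set" where D: "countable D" "\<And>x e. e > 0 \<Longrightarrow> \<exists>d\<in>D. dist x d < e"
    using separable by auto
  then have "D \<noteq> {}"
    by (metis empty_iff zero_less_one)
  define h where "h = from_nat_into D"
  have h: "\<exists>k. dist x (h k) < e" if "e > 0" for x e
    using D that \<open>D \<noteq> {}\<close> unfolding h_def
    by (metis from_nat_into_surj)
  \<comment> \<open>The least index within 1/(n+1): its level sets are Boolean combinations of
    balls, hence measurable, and it takes countably many values.\<close>
  define q where "q n x = (LEAST k. dist x (h k) < 1 / Suc n)" for n :: nat and x :: 'a
  have q: "dist x (h (q n x)) < 1 / Suc n" for n x
    unfolding q_def by (rule LeastI_ex) (rule h, simp)
  have q_meas [measurable]: "q n \<in> measurable M (count_space UNIV)" for n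
    unfolding q_def
  proof (rule measurable_Least)
    fix k
    have "{x. dist x (h k) < 1 / Suc n} = ball (h k) (1 / Suc n)"
      by (auto simp: dist_commute)
    then show "Measurable.pred M (\<lambda>x. dist x (h k) < 1 / real (Suc n))"
      by (simp add: pred_def)
  qed
  show ?thesis
  proof (rule borel_measurable_LIMSEQ_real)
    fix n
    show "(\<lambda>(s, y). f s (h (q n y))) \<in> borel_measurable (N \<Otimes>\<^sub>M M)"
      unfolding case_prod_beta
      by (rule measurable_compose_countable[where f = "\<lambda>k x. f (fst x) (h k)"])
        (auto intro: measurable_compose[OF measurable_fst meas] measurable_compose[OF measurable_snd q_meas])
  next
    fix x assume "x \<in> space (N \<Otimes>\<^sub>M M)"
    then obtain s y where x: "x = (s, y)" "s \<in> space N"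
      by (auto simp: space_pair_measure)
    have "(\<lambda>n. h (q n y)) \<longlonglongrightarrow> y"
    proof (rule metric_LIMSEQ_I)
      fix e :: real assume "e > 0"
      then obtain m where m: "1 / real (Suc m) < e"
        using nat_approx_posE by blast
      have "dist (h (q n y)) y < e" if "n \<ge> m" for n
      proof -
        have "1 / real (Suc n) \<le> 1 / real (Suc m)"
          using that by (simp add: field_simps)
        then show ?thesis using q[of y n] m by (simp add: dist_commute)
      qed
      then show "\<exists>no. \<forall>n\<ge>no. dist (h (q n y)) y < e" by blast
    qed
    then have "(\<lambda>n. f s (h (q n y))) \<longlonglongrightarrow> f s y"
      using cont[OF x(2)] by (metis (no_types) UNIV_I continuous_on_eq_continuous_at isCont_tendsto_compose open_UNIV)
    then show "(\<lambda>n. case x of (s, y) \<Rightarrow> f s (h (q n y))) \<longlonglongrightarrow> (case x of (s, y) \<Rightarrow> f s y)"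
      by (simp add: x)
  qed
qed

text \<open>Only the polynomial decay encoded by this weight is used of the sub-Gaussian upper bound; the
  kernel is dominated by its square so that a square root of the decay can be spent.\<close>

definition wt :: "real \<Rightarrow> 'a \<Rightarrow> 'a \<Rightarrow> real" where
  "wt r x y = (1 + dist x y / r) powr (- (dH + 1))"

section \<open>Integrals of the decay weight\<close>

lemma wt_nonneg: "0 \<le> wt r x y"
  by (simp add: wt_def)

lemma wt_le_1: "0 < r \<Longrightarrow> wt r x y \<le> 1"
  unfolding wt_def using dH_pos powr_mono2'[of "-(dH+1)" 1 "1 + dist x y / r"] by simp

text \<open>Of the power dH + 1 only one is spent, which is allowed because the base is at least
  1.\<close>

lemma wt_far: "0 < r \<Longrightarrow> 0 < \<rho> \<Longrightarrow> \<rho> \<le> dist x y \<Longrightarrow> wt r x y \<le> r / \<rho>"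
proof -
  assume a: "0 < r" "0 < \<rho>" "\<rho> \<le> dist x y"
  have "wt r x y \<le> (1 + dist x y / r) powr (- 1)"
    unfolding wt_def using dH_pos a by (intro powr_mono) auto
  also have "\<dots> = r / (r + dist x y)"
    using a by (simp add: powr_minus field_simps add_pos_nonneg)
  also have "\<dots> \<le> r / \<rho>"
    using a by (intro divide_left_mono mult_pos_pos) (auto)
  finally show ?thesis .
qed

lemma wt_continuous: "0 < r \<Longrightarrow> continuous_on UNIV (wt r x)"
  unfolding wt_def
  by (intro continuous_intros) (auto simp: add_nonneg_eq_0_iff)

lemma wt_measurable [measurable]: "0 < r \<Longrightarrow> wt r x \<in> borel_measurable M"
  by (intro continuous_measurable wt_continuous)

text \<open>Moving the centre by at most one scale changes the base by at most a factor 2. The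
  weight at one centre thus becomes a common majorant for all nearby centres.\<close>

lemma wt_shift:
  assumes "0 < r" "dist x x' \<le> r"
  shows "wt r x' y \<le> 2 powr (dH + 1) * wt r x y"
proof -
  have "1 + dist x y / r \<le> 2 * (1 + dist x' y / r)"
  proof -
    have "dist x y / r \<le> (dist x x' + dist x' y) / r"
      using assms dist_triangle[of x y x'] by (intro divide_right_mono) auto
    moreover have "dist x x' / r \<le> 1" "0 \<le> dist x' y / r"
      using assms by auto
    ultimately show ?thesis by (simp add: add_divide_distrib)
  qed
  then have "(1 + dist x y / r) powr (dH + 1) \<le> (2 * (1 + dist x' y / r)) powr (dH + 1)"
    using dH_pos assms by (intro powr_mono2) auto
  also have "\<dots> = 2 powr (dH + 1) * (1 + dist x' y / r) powr (dH + 1)"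
    using assms by (subst powr_mult) auto
  finally have le: "(1 + dist x y / r) powr (dH + 1) \<le> 2 powr (dH + 1) * (1 + dist x' y / r) powr (dH + 1)" .
  have "0 < (1 + dist x y / r) powr (dH + 1)" "0 < (1 + dist x' y / r) powr (dH + 1)"
    using assms by (simp_all add: add_nonneg_eq_0_iff)
  then show ?thesis
    unfolding wt_def powr_minus using le by (simp add: field_simps)
qed

text \<open>Dyadic shells: on the \<open>k\<close>-th shell the weight is at most 2^(-k(dH+1)) and
  the enclosing ball has volume of order (2^(k+1) r)^dH, so the power beyond dH leaves the summable
  factor 2^(-k).\<close>

lemma nn_integral_wt:
  assumes "0 < r"
  shows "(\<integral>\<^sup>+y. ennreal (wt r x y) \<partial>M) \<le> ennreal (c2 * 2 powr (dH + 1) * r powr dH)"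
proof -
  define a where "a k = (2 powr (dH + 1)) powr (- real k)" for k :: nat
  have a_alt: "a k = (2 ^ k) powr (- (dH + 1))" for k
    by (simp add: a_def powr_powr powr_realpow[symmetric] algebra_simps)
  have le: "ennreal (wt r x y) \<le> (\<Sum>k. ennreal (a k * indicator (ball x (2 ^ Suc k * r)) y))" for y
  proof -
    have "\<exists>k. wt r x y \<le> a k \<and> y \<in> ball x (2 ^ Suc k * r)"
    proof (cases "dist x y / r < 1")
      case True
      then show ?thesis
        using assms wt_le_1[OF assms, of x y] by (intro exI[of _ 0]) (auto simp: a_def field_simps)
    next
      case False
      \<comment> \<open>The least power of 2 above the ratio is not 2^0, so its predecessor marks
        the shell.\<close>
      obtain k where k: "2 ^ k \<le> dist x y / r" "dist x y / r < 2 ^ Suc k"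
      proof -
        obtain n where "dist x y / r < 2 ^ n"
          using real_arch_pow[of 2 "dist x y / r"] by auto
        then have ex: "\<exists>n. dist x y / r < 2 ^ n" by blast
        define n where "n = (LEAST n. dist x y / r < 2 ^ n)"
        have n: "dist x y / r < 2 ^ n" unfolding n_def by (rule LeastI_ex[OF ex])
        then have "n \<noteq> 0" using False by (auto intro: ccontr)
        then obtain k where "n = Suc k" using not0_implies_Suc by blast
        moreover have "\<not> dist x y / r < 2 ^ k"
          using \<open>n = Suc k\<close> unfolding n_def by (metis lessI not_less_Least)
        ultimately show ?thesis using n that[of k] by (simp add: not_less)
      qed
      have "wt r x y \<le> (2 ^ k) powr (- (dH + 1))"
        unfolding wt_def using k dH_pos by (intro powr_mono2') auto
      then show ?thesis
        using k assms by (intro exI[of _ k]) (auto simp: a_alt field_simps)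
    qed
    then obtain k where k: "wt r x y \<le> a k" "y \<in> ball x (2 ^ Suc k * r)" by blast
    have "ennreal (wt r x y) \<le> ennreal (a k * indicator (ball x (2 ^ Suc k * r)) y)"
      using k by (intro ennreal_leI) (auto simp: indicator_def)
    also have "\<dots> = (\<Sum>j\<in>{k}. ennreal (a j * indicator (ball x (2 ^ Suc j * r)) y))"
      by simp
    also have "\<dots> \<le> (\<Sum>j. ennreal (a j * indicator (ball x (2 ^ Suc j * r)) y))"
      by (intro sum_le_suminf) auto
    finally show ?thesis .
  qed
  have trm: "ennreal (a k) * emeasure M (ball x (2 ^ Suc k * r)) \<le> ennreal (c2 * 2 powr dH * r powr dH * (1/2) ^ k)" for k
  proof -
    have "ennreal (a k) * emeasure M (ball x (2 ^ Suc k * r)) \<le> ennreal (a k) * ennreal (c2 * (2 ^ Suc k * r) powr dH)"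
      using assms by (intro mult_left_mono ball_upper) auto
    also have "\<dots> = ennreal (a k * (c2 * (2 ^ Suc k * r) powr dH))"
      using c2_pos by (subst ennreal_mult) (auto simp: a_def)
    also have "a k * (c2 * (2 ^ Suc k * r) powr dH) = c2 * 2 powr dH * r powr dH * (1/2) ^ k"
    proof -
      have "(2 ^ k) powr (- (dH + 1)) * (2 ^ k) powr dH = ((2::real) ^ k) powr (-1)"
        by (simp add: powr_add[symmetric])
      then have "(2 ^ k) powr (- (dH + 1)) * (2 ^ k) powr dH = ((1/2)::real) ^ k"
        by (simp add: powr_minus power_divide divide_simps)
      then show ?thesis
        unfolding a_alt using assms by (simp add: powr_mult mult.assoc mult.left_commute)
          (simp add: mult.commute)
    qed
    finally show ?thesis .
  qed
  have "(\<integral>\<^sup>+y. ennreal (wt r x y) \<partial>M) \<le> (\<integral>\<^sup>+y. (\<Sum>k. ennreal (a k * indicator (ball x (2 ^ Suc k * r)) y)) \<partial>M)"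
    by (intro nn_integral_mono le)
  also have "\<dots> = (\<Sum>k. \<integral>\<^sup>+y. ennreal (a k * indicator (ball x (2 ^ Suc k * r)) y) \<partial>M)"
    by (intro nn_integral_suminf) measurable
  also have "\<dots> = (\<Sum>k. ennreal (a k) * emeasure M (ball x (2 ^ Suc k * r)))"
    by (intro suminf_cong)
      (simp add: ennreal_mult' a_def nn_integral_cmult ennreal_indicator)
  also have "\<dots> \<le> (\<Sum>k. ennreal (c2 * 2 powr dH * r powr dH * (1/2) ^ k))"
    by (intro suminf_le trm) auto
  also have "\<dots> = ennreal (\<Sum>k. c2 * 2 powr dH * r powr dH * (1/2) ^ k)"
    using c2_pos by (intro suminf_ennreal2 summable_mult summable_geometric) auto
  also have "(\<Sum>k. c2 * 2 powr dH * r powr dH * (1/2::real) ^ k) = c2 * 2 powr (dH + 1) * r powr dH"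
    by (subst suminf_mult) (auto simp: suminf_geometric powr_add)
  finally show ?thesis .
qed

definition K_wt :: real where "K_wt = c2 * 2 powr (dH + 1)"

lemma K_wt_pos: "0 < K_wt"
  using c2_pos by (simp add: K_wt_def)

lemma integrable_wt: "0 < r \<Longrightarrow> integrable M (wt r x)"
  using nn_integral_wt[of r x] wt_nonneg
  by (intro integrableI_nonneg wt_measurable AE_I2 le_less_trans[OF nn_integral_wt]) auto

lemma integral_wt:
  assumes "0 < r"
  shows "(LINT y|M. wt r x y) \<le> K_wt * r powr dH"
proof -
  have "ennreal (LINT y|M. wt r x y) \<le> ennreal (K_wt * r powr dH)"
    using nn_integral_wt[OF assms, of x] nn_integral_eq_integral[OF integrable_wt[OF assms], of x] wt_nonneg
    by (simp add: K_wt_def)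
  then show ?thesis
    using K_wt_pos by (subst (asm) ennreal_le_iff) auto
qed

end

section \<open>Resolvent kernels\<close>

text \<open>The facts about the time integral of e^(-ls) p_s(x,y) that the spatial estimate uses.
  The length belonging to \<open>l\<close> is l^(-1/dW); the factor 4 in \<open>u_lower\<close>
  leaves room for pairs taken from two balls whose radii and distance of centres are at most that
  length.\<close>

locale resolvent_kernel = ahlfors_space M dH c1 c2
  for M :: "'a::metric_space measure" and dH c1 c2 :: real +
  fixes u :: "real \<Rightarrow> 'a \<Rightarrow> 'a \<Rightarrow> real" and dW a A :: real
  assumes dH_less_dW: "dH < dW" and a_pos: "0 < a" and A_pos: "0 < A"
    and u_cont: "0 < l \<Longrightarrow> continuous_on UNIV (u l x)"
    and u_sym: "0 < l \<Longrightarrow> u l x y = u l y x"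
    and u_nonneg: "0 < l \<Longrightarrow> 0 \<le> u l x y"
    and u_integrable: "0 < l \<Longrightarrow> integrable M (u l x)"
    and u_mass: "0 < l \<Longrightarrow> l * (LINT y|M. u l x y) \<le> 1"
    and u_resolvent: "0 < l \<Longrightarrow> l < m \<Longrightarrow> (LINT z|M. u l x z * u m z y) = (u l x y - u m x y) / (m - l)"
    and u_upper: "0 < l \<Longrightarrow> u l x y \<le> A * l powr (- (dW - dH) / dW)"
    and u_lower: "0 < l \<Longrightarrow> dist x y \<le> 4 * l powr (- 1 / dW) \<Longrightarrow> a * l powr (- (dW - dH) / dW) \<le> u l x y"
    and u_concentration:
      "0 < r \<Longrightarrow> ((\<lambda>l. l * (LINT y|M. u l x y * indicator {y. r \<le> dist x y} y)) \<longlongrightarrow> 0) at_top"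
    and u_posdef: "0 < l \<Longrightarrow> 2 * u l x y \<le> u l x x + u l y y"
begin

section \<open>Resolvent operators and their jump energy\<close>

definition U :: "real \<Rightarrow> ('a \<Rightarrow> real) \<Rightarrow> 'a \<Rightarrow> real" where
  "U l f x = (LINT y|M. u l x y * f y)"

text \<open>In the reproducing kernel picture this is the squared distance between the potentials of
  \<open>x\<close> and \<open>y\<close>, hence an effective resistance.\<close>

definition resistance :: "real \<Rightarrow> 'a \<Rightarrow> 'a \<Rightarrow> real" where
  "resistance l x y = u l x x + u l y y - 2 * u l x y"

text \<open>A density in \<open>x\<close>: l^2 / 2 times its integral, plus a killing term, is the
  approximating form l <f - l U_l f, f>.\<close>

definition jump_energy :: "real \<Rightarrow> ('a \<Rightarrow> real) \<Rightarrow> 'a \<Rightarrow> real" where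
  "jump_energy l f x = (LINT y|M. u l x y * (f x - f y)\<^sup>2)"

lemma dW_pos: "0 < dW"
  using dH_pos dH_less_dW by simp

lemma u_measurable [measurable]: "0 < l \<Longrightarrow> u l x \<in> borel_measurable M"
  by (intro continuous_measurable u_cont)

lemma u_measurable2:
  assumes "0 < l"
  shows "(\<lambda>(x, y). u l x y) \<in> borel_measurable (M \<Otimes>\<^sub>M M)"
proof (rule caratheodory_measurable)
  show "(\<lambda>s. u l s y) \<in> borel_measurable M" for y
    using u_measurable[OF assms, of y] unfolding u_sym[OF assms, of _ y] .
qed (use u_cont assms in auto)

lemma u_mult_integrable:
  assumes l: "0 < l" and f [measurable]: "f \<in> borel_measurable M" and "\<And>y. \<bar>f y\<bar> \<le> B"
  shows "integrable M (\<lambda>y. u l x y * f y)"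
proof (rule Bochner_Integration.integrable_bound)
  show "integrable M (\<lambda>y. u l x y * B)"
    using u_integrable[OF l] by auto
  show "(\<lambda>y. u l x y * f y) \<in> borel_measurable M"
    using l by measurable
  have "\<bar>f y\<bar> \<le> \<bar>B\<bar>" for y
    using assms(3)[of y] by linarith
  then show "AE y in M. norm (u l x y * f y) \<le> norm (u l x y * B)"
    by (auto simp: abs_mult intro!: mult_left_mono)
qed

lemma U_measurable [measurable]:
  assumes l: "0 < l" and f [measurable]: "f \<in> borel_measurable M"
  shows "U l f \<in> borel_measurable M"
proof -
  have "(\<lambda>(x, y). u l x y * f y) \<in> borel_measurable (M \<Otimes>\<^sub>M M)"
    using u_measurable2[OF l] by (simp add: case_prod_beta)
  then show ?thesis
    unfolding U_def by (rule borel_measurable_lebesgue_integral)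
qed

lemma U_mono:
  assumes l: "0 < l" and "f \<in> borel_measurable M" "g \<in> borel_measurable M"
    and "\<And>y. \<bar>f y\<bar> \<le> B" "\<And>y. \<bar>g y\<bar> \<le> B'" "\<And>y. f y \<le> g y"
  shows "U l f x \<le> U l g x"
  unfolding U_def
  using assms u_nonneg[OF l]
  by (intro integral_mono u_mult_integrable[OF l assms(2,4)] u_mult_integrable[OF l assms(3,5)] mult_left_mono) auto

lemma U_const: "U l (\<lambda>_. K) x = K * U l (\<lambda>_. 1) x"
  by (simp add: U_def mult.commute)

lemma U_one_le: "0 < l \<Longrightarrow> U l (\<lambda>_. 1) x \<le> 1 / l"
  using u_mass[of l x] by (simp add: U_def field_simps)

lemma U_bound:
  assumes l: "0 < l" and f: "f \<in> borel_measurable M" "\<And>y. \<bar>f y\<bar> \<le> B"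
  shows "\<bar>U l f x\<bar> \<le> B / l"
proof -
  have B: "0 \<le> B"
    using f(2) by (meson abs_ge_zero order_trans)
  have fB: "- B \<le> f y" "f y \<le> B" for y
    using f(2)[of y] by auto
  have "U l f x \<le> U l (\<lambda>_. B) x"
    using B fB by (intro U_mono[where B = B and B' = B] l f) auto
  moreover have "U l (\<lambda>_. - B) x \<le> U l f x"
    using B fB by (intro U_mono[where B = B and B' = B] l f) auto
  moreover have "B * U l (\<lambda>_. 1) x \<le> B * (1 / l)"
    using U_one_le[OF l] B by (intro mult_left_mono)
  ultimately show ?thesis
    using U_const[of l B x] U_const[of l "- B" x] by (simp add: abs_le_iff)
qed

text \<open>Symmetry of \<open>u\<close> and Fubini, pairing an integrable function with a bounded
  one; absolute integrability comes from the bound B / l on \<open>U l\<close> of the absolute value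
  of \<open>g\<close>.\<close>

lemma U_dual:
  assumes l: "0 < l" and f: "integrable M f" and g [measurable]: "g \<in> borel_measurable M"
    and B: "\<And>y. \<bar>g y\<bar> \<le> B"
  shows "integrable M (\<lambda>x. U l f x * g x)"
    and "(LINT x|M. U l f x * g x) = (LINT y|M. f y * U l g y)"
proof -
  interpret pair_sigma_finite M M ..
  have f' [measurable]: "f \<in> borel_measurable M"
    using f by auto
  define H where "H = (\<lambda>(y, x). f y * (u l y x * g x))"
  have u2 [measurable]: "(\<lambda>(x, y). u l x y) \<in> borel_measurable (M \<Otimes>\<^sub>M M)"
    by (rule u_measurable2[OF l])
  have Hm: "H \<in> borel_measurable (M \<Otimes>\<^sub>M M)"
    unfolding H_def by (simp add: case_prod_beta')
  have H: "integrable (M \<Otimes>\<^sub>M M) H"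
  proof (rule Fubini_integrable[OF Hm])
    have "(LINT x|M. norm (H (y, x))) = \<bar>f y\<bar> * U l (\<lambda>x. \<bar>g x\<bar>) y" for y
      using u_nonneg[OF l] by (simp add: H_def U_def abs_mult)
    moreover have "integrable M (\<lambda>y. \<bar>f y\<bar> * U l (\<lambda>x. \<bar>g x\<bar>) y)"
      using f l B by (intro integrable_mult_bounded[where B = "B / l"] U_bound) auto
    ultimately show "integrable M (\<lambda>y. LINT x|M. norm (H (y, x)))"
      by simp
    show "AE y in M. integrable M (\<lambda>x. H (y, x))"
      using u_mult_integrable[OF l g B] by (simp add: H_def)
  qed
  have inner: "(LINT y|M. H (y, x)) = U l f x * g x" for x
  proof -
    have "(LINT y|M. H (y, x)) = (LINT y|M. (u l x y * f y) * g x)"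
      using u_sym[OF l] by (intro Bochner_Integration.integral_cong) (auto simp: H_def)
    then show ?thesis by (simp add: U_def)
  qed
  show "(LINT x|M. U l f x * g x) = (LINT y|M. f y * U l g y)"
    using Fubini_integral[of "\<lambda>y x. H (y, x)"] H inner by (simp add: H_def U_def)
  show "integrable M (\<lambda>x. U l f x * g x)"
    using integrable_snd[of "\<lambda>y x. H (y, x)"] H inner by simp
qed

text \<open>Expanding the square gives two diagonal terms with equal integrals, by
  \<open>U_dual\<close> against the constant 1, and a cross term. Bounding \<open>U l\<close> of 1
  by 1 / l drops the killing term.\<close>

lemma jump_energy_integral:
  assumes l: "0 < l" and f: "integrable M f" and B: "\<And>y. \<bar>f y\<bar> \<le> B"
  shows "integrable M (jump_energy l f)"
    and "(LINT x|M. jump_energy l f x) \<le> 2 * (LINT x|M. (f x)\<^sup>2) / l - 2 * (LINT x|M. f x * U l f x)"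
proof -
  have fm [measurable]: "f \<in> borel_measurable M"
    using f by auto
  have f2: "integrable M (\<lambda>x. (f x)\<^sup>2)"
    using integrable_mult_bounded[OF f fm B] by (simp add: power2_eq_square)
  have f2B: "\<bar>(f y)\<^sup>2\<bar> \<le> B\<^sup>2" for y
    using B[of y] by (simp add: abs_le_square_iff[symmetric])
  have i1: "integrable M (\<lambda>x. (f x)\<^sup>2 * U l (\<lambda>_. 1) x)"
    using l f2 by (intro integrable_mult_bounded[where B = "1 / l"] U_bound) auto
  have i2: "integrable M (\<lambda>x. f x * U l f x)"
    using l f by (intro integrable_mult_bounded[where B = "B / l"] U_bound) (auto intro: B)
  have i3: "integrable M (U l (\<lambda>y. (f y)\<^sup>2))"
    using U_dual(1)[OF l f2, of "\<lambda>_. 1" 1] by simp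
  have eq: "jump_energy l f x = (f x)\<^sup>2 * U l (\<lambda>_. 1) x - 2 * (f x * U l f x) + U l (\<lambda>y. (f y)\<^sup>2) x" for x
  proof -
    have "jump_energy l f x = (LINT y|M. (f x)\<^sup>2 * (u l x y * 1) - 2 * f x * (u l x y * f y) + u l x y * (f y)\<^sup>2)"
      unfolding jump_energy_def
      by (intro Bochner_Integration.integral_cong) (auto simp: power2_eq_square algebra_simps)
    also have "\<dots> = (f x)\<^sup>2 * U l (\<lambda>_. 1) x - 2 * f x * U l f x + U l (\<lambda>y. (f y)\<^sup>2) x"
      unfolding U_def
      using u_integrable[OF l] u_mult_integrable[OF l fm B] u_mult_integrable[OF l _ f2B]
      by (subst Bochner_Integration.integral_add Bochner_Integration.integral_diff; simp)+
    finally show ?thesis by simp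
  qed
  show "integrable M (jump_energy l f)"
    unfolding eq[abs_def] using i1 i2 i3 by (intro Bochner_Integration.integrable_add Bochner_Integration.integrable_diff) auto
  have "(LINT x|M. jump_energy l f x) =
      (LINT x|M. (f x)\<^sup>2 * U l (\<lambda>_. 1) x) - 2 * (LINT x|M. f x * U l f x) + (LINT x|M. U l (\<lambda>y. (f y)\<^sup>2) x)"
    unfolding eq using i1 i2 i3 by simp
  also have "(LINT x|M. U l (\<lambda>y. (f y)\<^sup>2) x) = (LINT x|M. (f x)\<^sup>2 * U l (\<lambda>_. 1) x)"
    using U_dual(2)[OF l f2, of "\<lambda>_. 1" 1] by simp
  also have "(LINT x|M. (f x)\<^sup>2 * U l (\<lambda>_. 1) x) \<le> (LINT x|M. (f x)\<^sup>2 * (1 / l))"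
    using i1 f2 U_one_le[OF l] by (intro integral_mono) (auto intro!: mult_left_mono simp del: times_divide_eq_right)
  finally show "(LINT x|M. jump_energy l f x) \<le> 2 * (LINT x|M. (f x)\<^sup>2) / l - 2 * (LINT x|M. f x * U l f x)"
    using \<open>(LINT x|M. (f x)\<^sup>2 * U l (\<lambda>_. 1) x) \<le> (LINT x|M. (f x)\<^sup>2 * (1 / l))\<close> by simp
qed

lemma jump_energy_nonneg: "0 < l \<Longrightarrow> 0 \<le> jump_energy l f x"
  unfolding jump_energy_def using u_nonneg by simp

text \<open>Contractivity of l U_l as a quadratic form, obtained without spectral theory because the
  jump energy is nonnegative.\<close>

lemma U_quadratic_le:
  assumes l: "0 < l" and f: "integrable M f" and B: "\<And>y. \<bar>f y\<bar> \<le> B"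
  shows "(LINT x|M. f x * U l f x) \<le> (LINT x|M. (f x)\<^sup>2) / l"
proof -
  have "0 \<le> (LINT x|M. jump_energy l f x)"
    using jump_energy_nonneg[OF l] by simp
  then show ?thesis
    using jump_energy_integral(2)[OF assms] by simp
qed

text \<open>The case of l U_l \<phi> converging to \<phi> at a zero of \<phi>. Near \<open>z\<close>
  the function is small and the total mass is at most 1; away from \<open>z\<close> it is bounded
  and the mass tends to 0.\<close>

lemma U_tendsto_zero:
  assumes \<phi>: "continuous_on UNIV \<phi>" and B: "\<And>y. \<bar>\<phi> y\<bar> \<le> B" and z: "\<phi> z = 0"
  shows "((\<lambda>l. l * U l \<phi> z) \<longlongrightarrow> 0) at_top"
proof (rule tendstoI)
  fix e :: real assume e: "e > 0"
  have [measurable]: "\<phi> \<in> borel_measurable M"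
    by (intro continuous_measurable \<phi>)
  have B0: "0 \<le> B"
    using B by (meson abs_ge_zero order_trans)
  obtain r where r: "r > 0" "\<And>y. dist y z < r \<Longrightarrow> \<bar>\<phi> y\<bar> < e / 3"
    using \<phi> z e unfolding continuous_on_iff dist_real_def
    by (metis UNIV_I diff_zero divide_pos_pos zero_less_numeral)
  let ?F = "{y. r \<le> dist z y}"
  have F [measurable]: "?F \<in> sets M"
    by (auto simp: sets_M intro!: borel_closed closed_Collect_le continuous_intros)
  \<comment> \<open>The denominator B + 1 covers B = 0; near and far parts together contribute at
    most 2e/3.\<close>
  have "\<forall>\<^sub>F l in at_top. l * (LINT y|M. u l z y * indicator ?F y) < e / (3 * (B + 1))"
    using u_concentration[OF r(1), of z] e B0 by (intro order_tendstoD) auto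
  then show "\<forall>\<^sub>F l in at_top. dist (l * U l \<phi> z) 0 < e"
    using eventually_gt_at_top[of 0]
  proof eventually_elim
    fix l :: real
    assume far: "l * (LINT y|M. u l z y * indicator ?F y) < e / (3 * (B + 1))" and l: "0 < l"
    have "\<bar>U l \<phi> z\<bar> \<le> (LINT y|M. \<bar>u l z y * \<phi> y\<bar>)"
      unfolding U_def by (rule integral_abs_bound)
    also have "\<dots> \<le> (LINT y|M. e / 3 * u l z y + B * (u l z y * indicator ?F y))"
    proof (rule integral_mono)
      show "integrable M (\<lambda>y. \<bar>u l z y * \<phi> y\<bar>)"
        using u_mult_integrable[OF l _ B, where x = z] by auto
      show "integrable M (\<lambda>y. e / 3 * u l z y + B * (u l z y * indicator ?F y))"
        using l u_integrable[OF l]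
        by (intro Bochner_Integration.integrable_add integrable_mult_right u_mult_integrable[where B = 1]
            borel_measurable_indicator F) (auto simp: indicator_def)
      fix y
      show "\<bar>u l z y * \<phi> y\<bar> \<le> e / 3 * u l z y + B * (u l z y * indicator ?F y)"
      proof (cases "y \<in> ?F")
        case True
        then have "u l z y * \<bar>\<phi> y\<bar> \<le> u l z y * B" "0 \<le> e / 3 * u l z y"
          using e u_nonneg[OF l] B by (auto intro!: mult_left_mono)
        then show ?thesis
          using True u_nonneg[OF l, of z y] by (simp add: abs_mult mult.commute)
      next
        case False
        then have "u l z y * \<bar>\<phi> y\<bar> \<le> u l z y * (e / 3)"
          using r(2)[of y] u_nonneg[OF l] by (intro mult_left_mono) (auto simp: dist_commute)
        then show ?thesis
          using False u_nonneg[OF l, of z y] by (simp add: abs_mult mult.commute)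
      qed
    qed
    also have "\<dots> = e / 3 * U l (\<lambda>_. 1) z + B * (LINT y|M. u l z y * indicator ?F y)"
      using l u_integrable[OF l] u_mult_integrable[OF l, of "indicator ?F" 1 z]
      by (subst Bochner_Integration.integral_add) (auto simp: U_def indicator_def)
    finally have "l * \<bar>U l \<phi> z\<bar> \<le> l * (e / 3 * U l (\<lambda>_. 1) z + B * (LINT y|M. u l z y * indicator ?F y))"
      using l by (intro mult_left_mono) auto
    also have "\<dots> = e / 3 * (l * U l (\<lambda>_. 1) z) + B * (l * (LINT y|M. u l z y * indicator ?F y))"
      by (simp add: algebra_simps)
    also have "\<dots> \<le> e / 3 * 1 + B * (e / (3 * (B + 1)))"
      using U_one_le[OF l, of z] l e B0 far by (intro add_mono mult_left_mono) (auto simp: field_simps)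
    also have "B * (e / (3 * (B + 1))) \<le> e / 3"
      using B0 e by (simp add: field_simps)
    finally show "dist (l * U l \<phi> z) 0 < e"
      using e l by (simp add: abs_mult)
  qed
qed

section \<open>The maximum principle and its consequences for potentials\<close>

lemma u_bounded: "0 < l \<Longrightarrow> \<bar>u l x y\<bar> \<le> A * l powr (- (dW - dH) / dW)"
  using u_upper u_nonneg by (simp add: abs_of_nonneg)

text \<open>The resolvent identity read as follows: subtracting m - l times its image under
  \<open>U m\<close> turns a potential of level \<open>l\<close> into one of level \<open>m\<close>.
  The maximum principle uses general weights, the Morrey estimate s = t = 1, and t = 0 gives a
  single potential.\<close>

lemma potential_difference:
  fixes s t :: real
  assumes l: "0 < l" and m: "l < m"
  shows "U m (\<lambda>y. s * u l p y - t * u l q y) x = (s * (u l p x - u m p x) - t * (u l q x - u m q x)) / (m - l)"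
proof -
  have m0: "0 < m" using l m by simp
  have i: "integrable M (\<lambda>y. u m x y * u l p y)" for p
    by (rule u_mult_integrable[OF m0 u_measurable[OF l] u_bounded[OF l]])
  have e: "(LINT y|M. u m x y * u l p y) = (u l p x - u m p x) / (m - l)" for p
    using u_resolvent[OF l m, of p x] u_sym[OF m0] by (simp add: mult.commute)
  have "U m (\<lambda>y. s * u l p y - t * u l q y) x =
      (LINT y|M. s * (u m x y * u l p y) - t * (u m x y * u l q y))"
    unfolding U_def by (intro Bochner_Integration.integral_cong) (auto simp: algebra_simps)
  also have "\<dots> = s * ((u l p x - u m p x) / (m - l)) - t * ((u l q x - u m q x) / (m - l))"
    using i by (simp add: e)
  finally show ?thesis by (simp add: diff_divide_distrib right_diff_distrib)
qed

text \<open>The maximum principle is tested on the excess \<open>n\<close> of \<open>v\<close> over \<open>K\<close>: the resolvent identity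
  turns the energy of \<open>v\<close> against \<open>n\<close> into point evaluations of \<open>n\<close>, the only one with a
  favourable sign being at \<open>p\<close>, where \<open>n\<close> vanishes.\<close>

lemma maximum_principle:
  fixes s t K :: real
  assumes l: "0 < l" and s: "0 \<le> s" and t: "0 \<le> t" and K: "0 \<le> K"
    and vp: "s * u l p p - t * u l q p \<le> K"
  shows "s * u l p x - t * u l q x \<le> K"
proof -
  define v where "v x = s * u l p x - t * u l q x" for x
  define n where "n x = max (v x - K) 0" for x
  define B where "B = s * (A * l powr (- (dW - dH) / dW)) + t * (A * l powr (- (dW - dH) / dW))"
  have v_cont: "continuous_on UNIV v"
    unfolding v_def using u_cont[OF l] by (intro continuous_intros)
  have n_cont: "continuous_on UNIV n"
    unfolding n_def using v_cont by (intro continuous_intros)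
  have vm [measurable]: "v \<in> borel_measurable M" and nm [measurable]: "n \<in> borel_measurable M"
    by (auto intro: continuous_measurable v_cont n_cont)
  have n_nonneg: "0 \<le> n x" for x by (simp add: n_def)
  \<comment> \<open>Domination by a single potential, from K \<ge> 0 and t \<ge> 0; it makes the
    excess integrable.\<close>
  have n_le: "n x \<le> s * u l p x" for x
    using K mult_nonneg_nonneg[OF s u_nonneg[OF l, of p x]] mult_nonneg_nonneg[OF t u_nonneg[OF l, of q x]]
    by (simp add: n_def v_def)
  have vB: "\<bar>v y\<bar> \<le> B" for y
  proof -
    have "\<bar>v y\<bar> \<le> s * \<bar>u l p y\<bar> + t * \<bar>u l q y\<bar>"
      unfolding v_def using s t by (intro order_trans[OF abs_triangle_ineq4]) (simp add: abs_mult)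
    also have "\<dots> \<le> B"
      unfolding B_def using s t u_bounded[OF l] by (intro add_mono mult_left_mono) auto
    finally show ?thesis .
  qed
  have nB: "\<bar>n y\<bar> \<le> B" for y
    using vB[of y] K n_nonneg[of y] by (auto simp: n_def)
  have n_int: "integrable M n"
  proof (rule Bochner_Integration.integrable_bound)
    show "integrable M (\<lambda>x. s * u l p x)" using u_integrable[OF l] by auto
    show "AE x in M. norm (n x) \<le> norm (s * u l p x)"
      using n_nonneg n_le by (auto intro!: AE_I2 order_trans[OF n_le])
  qed simp
  have n2_int: "integrable M (\<lambda>x. (n x)\<^sup>2)"
    using integrable_mult_bounded[OF n_int nm nB] by (simp add: power2_eq_square)
  \<comment> \<open>The level \<open>m\<close> is auxiliary: at finite \<open>m\<close> the
    evaluation at \<open>p\<close> appears smeared as m U_m n(p), which tends to n(p) = 0.\<close>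
  have key: "l * (LINT x|M. (n x)\<^sup>2) \<le> s * (m * U m n p)" if m: "l < m" for m
  proof -
    have m0: "0 < m" using l m by simp
    define b where "b = m - l"
    have b: "0 < b" using m by (simp add: b_def)
    have diff: "v x - b * U m v x = s * u m p x - t * u m q x" for x
      using potential_difference[OF l m, of s p t q x] b
      unfolding v_def[symmetric, abs_def] b_def[symmetric] by (simp add: v_def[of x] field_simps)
    have pt: "(n x)\<^sup>2 - b * (n x * U m n x) \<le> (s * u m p x - t * u m q x) * n x" for x
    proof (cases "n x = 0")
      case False
      then have nx: "0 < n x" "v x = K + n x" using n_nonneg[of x] by (auto simp: n_def max_def split: if_splits)
      have "U m v x \<le> U m (\<lambda>y. K + n y) x"
      proof (rule U_mono[OF m0])
        show "\<bar>K + n y\<bar> \<le> K + B" for y using K nB[of y] n_nonneg[of y] by auto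
        show "v y \<le> K + n y" for y by (simp add: n_def)
      qed (auto intro: vB)
      also have "\<dots> = K * U m (\<lambda>_. 1) x + U m n x"
      proof -
        have "U m (\<lambda>y. K + n y) x = (LINT y|M. K * u m x y + u m x y * n y)"
          unfolding U_def by (intro Bochner_Integration.integral_cong) (auto simp: algebra_simps)
        then show ?thesis
          using u_integrable[OF m0] u_mult_integrable[OF m0 nm nB] by (simp add: U_def)
      qed
      also have "\<dots> \<le> K * (1 / m) + U m n x"
        using U_one_le[OF m0] K by (intro add_mono mult_left_mono) auto
      finally have "b * U m v x \<le> b * (K / m + U m n x)"
        using b by (intro mult_left_mono) auto
      also have "\<dots> \<le> K + b * U m n x"
        using K l m0 unfolding b_def by (simp add: field_simps)
      finally have "n x - b * U m n x \<le> v x - b * U m v x"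
        unfolding nx(2) by simp
      then have "(n x - b * U m n x) * n x \<le> (s * u m p x - t * u m q x) * n x"
        using nx(1) unfolding diff by (intro mult_right_mono) auto
      then show ?thesis by (simp add: power2_eq_square algebra_simps)
    qed simp
    have iU: "integrable M (\<lambda>x. n x * U m n x)"
      using m0 n_int by (intro integrable_mult_bounded[where B = "B / m"] U_bound) (auto intro: nB)
    have iu: "integrable M (\<lambda>x. u m p x * n x)" for p
      by (rule u_mult_integrable[OF m0 nm nB])
    \<comment> \<open>\<open>U_quadratic_le\<close> leaves the fraction 1 - b / m = l / m of the
      squared norm; multiplying by \<open>m\<close> then makes the left side independent of
      \<open>m\<close>.\<close>
    have "(LINT x|M. (n x)\<^sup>2) - b * ((LINT x|M. (n x)\<^sup>2) / m) \<le> (LINT x|M. (n x)\<^sup>2) - b * (LINT x|M. n x * U m n x)"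
      using U_quadratic_le[OF m0 n_int nB] b by (intro diff_mono mult_left_mono) auto
    also have "\<dots> = (LINT x|M. (n x)\<^sup>2 - b * (n x * U m n x))"
      using n2_int iU by simp
    also have "\<dots> \<le> (LINT x|M. (s * u m p x - t * u m q x) * n x)"
      using n2_int iU iu[of p] iu[of q] by (intro integral_mono pt) (auto simp: left_diff_distrib mult.assoc)
    also have "\<dots> = s * U m n p - t * U m n q"
      using iu[of p] iu[of q] by (simp add: U_def left_diff_distrib mult.assoc)
    also have "\<dots> \<le> s * U m n p"
      using t n_nonneg u_nonneg[OF m0] by (auto simp: U_def intro!: mult_nonneg_nonneg integral_nonneg_AE)
    finally have "m * ((LINT x|M. (n x)\<^sup>2) - b * ((LINT x|M. (n x)\<^sup>2) / m)) \<le> m * (s * U m n p)"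
      using m0 by (intro mult_left_mono) auto
    moreover have "m * ((LINT x|M. (n x)\<^sup>2) - b * ((LINT x|M. (n x)\<^sup>2) / m)) = l * (LINT x|M. (n x)\<^sup>2)"
      using m0 by (simp add: b_def field_simps)
    ultimately show ?thesis by (simp add: algebra_simps)
  qed
  have "((\<lambda>m. m * U m n p) \<longlongrightarrow> 0) at_top"
    using vp by (intro U_tendsto_zero[OF n_cont nB]) (simp add: n_def v_def)
  then have "((\<lambda>m. s * (m * U m n p)) \<longlongrightarrow> s * 0) at_top"
    by (intro tendsto_intros)
  then have "l * (LINT x|M. (n x)\<^sup>2) \<le> s * 0"
    by (rule tendsto_lowerbound[OF _ eventually_mono[OF eventually_gt_at_top[of l] key]]) auto
  then have "(LINT x|M. (n x)\<^sup>2) \<le> 0"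
    using l by (simp add: mult_le_0_iff)
  then have "(LINT x|M. (n x)\<^sup>2) = 0"
    by (intro antisym) auto
  then have "AE x in M. (n x)\<^sup>2 = 0"
    by (subst (asm) integral_nonneg_eq_0_iff_AE[OF n2_int]) auto
  then have "n x = 0"
    by (intro AE_eq_continuous[OF n_cont]) auto
  then show ?thesis by (simp add: n_def v_def max_def split: if_splits)
qed

lemma u_le_diagonal: "0 < l \<Longrightarrow> u l x y \<le> u l x x"
  using maximum_principle[of l 1 0 "u l x x" x x y] u_nonneg[of l x x] by simp

lemma u_diagonal_lower: "0 < l \<Longrightarrow> a * l powr (- (dW - dH) / dW) \<le> u l x x"
  by (rule u_lower) auto

lemma u_diagonal_pos: "0 < l \<Longrightarrow> 0 < u l x x"
  using u_diagonal_lower[of l x] a_pos by (smt (verit) mult_pos_pos powr_gt_zero)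

text \<open>Analytic form of the strong Markov property at the hitting time of \<open>z\<close>.\<close>

lemma u_hitting: "0 < l \<Longrightarrow> u l z y * u l z x \<le> u l z z * u l y x"
proof -
  assume l: "0 < l"
  \<comment> \<open>With this weight the combination vanishes at \<open>z\<close>, so the maximum
    principle applies with K = 0.\<close>
  define s where "s = u l z y / u l z z"
  have pos: "0 < u l z z" by (rule u_diagonal_pos[OF l])
  have "s * u l z x - 1 * u l y x \<le> 0"
  proof (rule maximum_principle[OF l])
    show "0 \<le> s" using pos u_nonneg[OF l] by (simp add: s_def)
    show "s * u l z z - 1 * u l y z \<le> 0"
      using pos u_sym[OF l, of y z] by (simp add: s_def)
  qed auto
  then show ?thesis using pos by (simp add: s_def field_simps)
qed

lemma resistance_nonneg: "0 < l \<Longrightarrow> 0 \<le> resistance l x y"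
  using u_posdef by (simp add: resistance_def)

text \<open>\<open>u_hitting\<close> at the point \<open>x\<close> gives the factor u_l(x,x) -
  u_l(x,y). The other half u_l(y,y) - u_l(x,y) of the resistance is nonnegative by
  \<open>u_le_diagonal\<close>, and \<open>u_diagonal_lower\<close> makes the denominator
  uniform.\<close>

lemma u_difference_le:
  assumes l: "0 < l"
  shows "u l x z - u l y z \<le> u l x z * (resistance l x y / (a * l powr (- (dW - dH) / dW)))"
proof -
  let ?D = "a * l powr (- (dW - dH) / dW)"
  have D: "0 < ?D" using l a_pos by simp
  have pos: "0 < u l x x" by (rule u_diagonal_pos[OF l])
  have "(u l x z - u l y z) * u l x x \<le> u l x z * (u l x x - u l x y)"
    using u_hitting[OF l, of x y z] by (simp add: algebra_simps)
  also have "\<dots> \<le> u l x z * resistance l x y"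
    using u_le_diagonal[OF l, of y x] u_nonneg[OF l] u_sym[OF l, of x y]
    by (intro mult_left_mono) (auto simp: resistance_def)
  finally have "u l x z - u l y z \<le> u l x z * resistance l x y / u l x x"
    using pos by (simp add: field_simps)
  also have "\<dots> \<le> u l x z * resistance l x y / ?D"
    using u_diagonal_lower[OF l, of x] u_nonneg[OF l] resistance_nonneg[OF l]
    by (intro divide_left_mono mult_nonneg_nonneg mult_pos_pos[OF pos D])
  finally show ?thesis by simp
qed

text \<open>The one-sided bound is used in both orders, the resistance being symmetric. The mass 1 /
  l of a potential divided by the diagonal scale l^(-(dW-dH)/dW) produces l^(-dH/dW).\<close>

lemma u_L1_difference:
  assumes l: "0 < l"
  shows "(LINT z|M. \<bar>u l x z - u l y z\<bar>) \<le> 2 * resistance l x y / (a * l powr (dH / dW))"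
proof -
  let ?R = "resistance l x y / (a * l powr (- (dW - dH) / dW))"
  have R: "0 \<le> ?R" using a_pos resistance_nonneg[OF l] by simp
  have sym: "resistance l y x = resistance l x y"
    using u_sym[OF l, of x y] by (simp add: resistance_def)
  have pt: "\<bar>u l x z - u l y z\<bar> \<le> (u l x z + u l y z) * ?R" for z
    using u_difference_le[OF l, of x z y] u_difference_le[OF l, of y z x] R
      mult_nonneg_nonneg[OF u_nonneg[OF l, of x z] R] mult_nonneg_nonneg[OF u_nonneg[OF l, of y z] R]
    unfolding sym by (simp only: distrib_right abs_le_iff) linarith
  have "(LINT z|M. \<bar>u l x z - u l y z\<bar>) \<le> (LINT z|M. (u l x z + u l y z) * ?R)"
    using u_integrable[OF l] by (intro integral_mono pt) auto
  also have "\<dots> = (U l (\<lambda>_. 1) x + U l (\<lambda>_. 1) y) * ?R"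
    using u_integrable[OF l] by (simp add: U_def)
  also have "\<dots> \<le> (1 / l + 1 / l) * ?R"
    using U_one_le[OF l] R by (intro mult_right_mono add_mono) auto
  also have "\<dots> = 2 * resistance l x y / (a * (l powr (- (dW - dH) / dW) * l powr 1))"
    using l by (simp add: field_simps)
  also have "l powr (- (dW - dH) / dW) * l powr 1 = l powr (dH / dW)"
    using dW_pos by (simp only: powr_add[symmetric]) (simp add: field_simps)
  finally show ?thesis .
qed

section \<open>The Morrey estimate for the resistance\<close>

lemma resistance_bound_trivial: "0 < l \<Longrightarrow> resistance l x y \<le> 2 * A * l powr (- (dW - dH) / dW)"
  using u_upper[of l x x] u_upper[of l y y] u_nonneg[of l x y] by (simp add: resistance_def)

text \<open>Since f - (m - l) U_m f is the difference of the level \<open>m\<close> potentials,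
  pairing it with \<open>f\<close> takes four resolvent identities and gives exactly (R_l - R_m) /
  (m - l). Dropping R_m \<ge> 0 leaves a bound linear in R_l.\<close>

lemma potential_jump_energy:
  fixes x y :: 'a
  assumes l: "0 < l" and m: "l < m"
  defines "f \<equiv> \<lambda>w. u l x w - u l y w"
  shows "integrable M (jump_energy m f)"
    and "(LINT w|M. jump_energy m f w) \<le> 2 * resistance l x y / (m - l)\<^sup>2"
proof -
  let ?C = "A * l powr (- (dW - dH) / dW)"
  have m0: "0 < m" and b: "0 < m - l" using l m by auto
  have f_int: "integrable M f" unfolding f_def using u_integrable[OF l] by auto
  have fm: "f \<in> borel_measurable M" using f_int by auto
  have fB: "\<bar>f w\<bar> \<le> 2 * ?C" for w
    unfolding f_def using u_bounded[OF l, of x w] u_bounded[OF l, of y w] by linarith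
  show "integrable M (jump_energy m f)"
    by (rule jump_energy_integral(1)[OF m0 f_int fB])
  have f2: "integrable M (\<lambda>w. (f w)\<^sup>2)"
    using integrable_mult_bounded[OF f_int fm fB] by (simp add: power2_eq_square)
  have fU: "integrable M (\<lambda>w. f w * U m f w)"
    using m0 f_int fm fB by (intro integrable_mult_bounded[where B = "2 * ?C / m"] U_bound) auto
  have pot: "f w - (m - l) * U m f w = u m x w - u m y w" for w
    using potential_difference[OF l m, of 1 x 1 y w] b unfolding f_def by (simp add: field_simps)
  have prod_int: "integrable M (\<lambda>z. u l p z * u m z q)" for p q
    using u_mult_integrable[OF m0 u_measurable[OF l] u_bounded[OF l], of q p] u_sym[OF m0, of q]
    by (simp add: mult.commute)
  have "(LINT w|M. (f w)\<^sup>2) - (m - l) * (LINT w|M. f w * U m f w)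
      = (LINT w|M. f w * (f w - (m - l) * U m f w))"
  proof -
    have "(LINT w|M. f w * (f w - (m - l) * U m f w)) = (LINT w|M. (f w)\<^sup>2 - (m - l) * (f w * U m f w))"
      by (intro Bochner_Integration.integral_cong) (auto simp: power2_eq_square algebra_simps)
    then show ?thesis using f2 fU by simp
  qed
  also have "\<dots> = (LINT w|M. (u l x w * u m w x - u l x w * u m w y) - (u l y w * u m w x - u l y w * u m w y))"
    unfolding pot using u_sym[OF m0]
    by (intro Bochner_Integration.integral_cong) (auto simp: f_def algebra_simps)
  also have "\<dots> = ((u l x x - u m x x) / (m - l) - (u l x y - u m x y) / (m - l))
      - ((u l y x - u m y x) / (m - l) - (u l y y - u m y y) / (m - l))"
    using prod_int by (simp add: u_resolvent[OF l m])
  also have "\<dots> = (resistance l x y - resistance m x y) / (m - l)"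
    using u_sym[OF l, of y x] u_sym[OF m0, of y x] by (simp add: resistance_def diff_divide_distrib add_divide_distrib)
  also have "\<dots> \<le> resistance l x y / (m - l)"
    using b resistance_nonneg[OF m0] by (intro divide_right_mono) auto
  finally have main: "(LINT w|M. (f w)\<^sup>2) - (m - l) * (LINT w|M. f w * U m f w) \<le> resistance l x y / (m - l)" .
  have "(LINT w|M. jump_energy m f w) \<le> 2 * (LINT w|M. (f w)\<^sup>2) / m - 2 * (LINT w|M. f w * U m f w)"
    by (rule jump_energy_integral(2)[OF m0 f_int fB])
  \<comment> \<open>Enlarging 1 / m to 1 / (m - l) lets both terms share the prefactor 2 / (m -
    l).\<close>
  also have "\<dots> \<le> 2 * (LINT w|M. (f w)\<^sup>2) / (m - l) - 2 * (LINT w|M. f w * U m f w)"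
    using l b by (intro diff_right_mono divide_left_mono mult_pos_pos) auto
  also have "\<dots> = 2 / (m - l) * ((LINT w|M. (f w)\<^sup>2) - (m - l) * (LINT w|M. f w * U m f w))"
    using b by (simp add: field_simps)
  also have "\<dots> \<le> 2 / (m - l) * (resistance l x y / (m - l))"
    using b main by (intro mult_left_mono) auto
  also have "\<dots> = 2 * resistance l x y / (m - l)\<^sup>2"
    by (simp add: power2_eq_square)
  finally show "(LINT w|M. jump_energy m f w) \<le> 2 * resistance l x y / (m - l)\<^sup>2" .
qed

definition avg :: "('a \<Rightarrow> real) \<Rightarrow> 'a \<Rightarrow> real \<Rightarrow> real" where
  "avg f x r = (LINT y|M. f y * indicator (ball x r) y) / measure M (ball x r)"

text \<open>The tangent line of t -> (c - t)^2 at the mean \<open>k\<close> lies below the parabola,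
  and its linear part integrates to zero over the ball.\<close>

lemma avg_jensen:
  assumes r: "0 < r" and f [measurable]: "f \<in> borel_measurable M" and B: "\<And>y. \<bar>f y\<bar> \<le> B"
  shows "(c - avg f x r)\<^sup>2 * measure M (ball x r) \<le> (LINT y|M. (c - f y)\<^sup>2 * indicator (ball x r) y)"
proof -
  define k where "k = avg f x r"
  have mu: "0 < measure M (ball x r)" by (rule measure_ball_pos[OF r])
  have i: "integrable M (\<lambda>y. f y * indicator (ball x r) y)"
    by (rule continuous_integrable_on_ball[OF f B])
  have sqB: "\<bar>(c - f y)\<^sup>2\<bar> \<le> (\<bar>c\<bar> + B)\<^sup>2" for y
  proof -
    have "\<bar>c - f y\<bar> \<le> \<bar>c\<bar> + B" using B[of y] by linarith
    then have "\<bar>c - f y\<bar>\<^sup>2 \<le> (\<bar>c\<bar> + B)\<^sup>2" by (intro power_mono) auto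
    then show ?thesis by simp
  qed
  have i2: "integrable M (\<lambda>y. (c - f y)\<^sup>2 * indicator (ball x r) y)"
    by (rule continuous_integrable_on_ball[OF _ sqB]) measurable
  have i0: "integrable M (\<lambda>y. C * indicator (ball x r) y :: real)" for C
    using integrable_indicator_ball by auto
  have "(c - k)\<^sup>2 * measure M (ball x r) =
      (LINT y|M. ((c - k)\<^sup>2 + 2 * (c - k) * k) * indicator (ball x r) y - 2 * (c - k) * (f y * indicator (ball x r) y))"
  proof -
    have "(LINT y|M. f y * indicator (ball x r) y) = k * measure M (ball x r)"
      using mu by (simp add: k_def avg_def)
    then have "(LINT y|M. C * indicator (ball x r) y - D * (f y * indicator (ball x r) y))
        = C * measure M (ball x r) - D * (k * measure M (ball x r))" for C D :: real
      using i i0[of C] by (subst Bochner_Integration.integral_diff) auto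
    then show ?thesis by (simp only:) (simp add: algebra_simps)
  qed
  also have "\<dots> \<le> (LINT y|M. (c - f y)\<^sup>2 * indicator (ball x r) y)"
  proof (rule integral_mono)
    show "integrable M (\<lambda>y. ((c - k)\<^sup>2 + 2 * (c - k) * k) * indicator (ball x r) y - 2 * (c - k) * (f y * indicator (ball x r) y))"
      by (rule Bochner_Integration.integrable_diff[OF i0 integrable_mult_right[OF i]])
    fix y
    have "0 \<le> (f y - k)\<^sup>2" by simp
    then have "(c - k)\<^sup>2 + 2 * (c - k) * k - 2 * (c - k) * f y \<le> (c - f y)\<^sup>2"
      by (simp add: power2_eq_square algebra_simps)
    then show "((c - k)\<^sup>2 + 2 * (c - k) * k) * indicator (ball x r) y - 2 * (c - k) * (f y * indicator (ball x r) y)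
        \<le> (c - f y)\<^sup>2 * indicator (ball x r) y"
      by (auto simp: indicator_def)
  qed (rule i2)
  finally show ?thesis by (simp add: k_def)
qed

text \<open>Jensen is applied in each variable, and on pairs from the two balls the kernel is at
  least the constant of \<open>u_lower\<close>. This plays the role of a Poincare
  inequality.\<close>

lemma avg_difference:
  assumes m: "0 < m" and r: "0 < r1" "0 < r2" and f: "integrable M f" and B: "\<And>y. \<bar>f y\<bar> \<le> B"
    and near: "\<And>p q. p \<in> ball x1 r1 \<Longrightarrow> q \<in> ball x2 r2 \<Longrightarrow> dist p q \<le> 4 * m powr (- 1 / dW)"
  shows "(avg f x1 r1 - avg f x2 r2)\<^sup>2 * (measure M (ball x1 r1) * measure M (ball x2 r2)) * (a * m powr (- (dW - dH) / dW))
    \<le> (LINT w|M. jump_energy m f w)"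
proof -
  have fm [measurable]: "f \<in> borel_measurable M" using f by auto
  let ?D = "a * m powr (- (dW - dH) / dW)"
  let ?k = "avg f x2 r2" and ?m1 = "measure M (ball x1 r1)" and ?m2 = "measure M (ball x2 r2)"
  have D: "0 < ?D" using m a_pos by simp
  have sqB: "\<bar>(c - f y)\<^sup>2\<bar> \<le> (\<bar>c\<bar> + B)\<^sup>2" for c y
  proof -
    have "\<bar>c - f y\<bar> \<le> \<bar>c\<bar> + B" using B[of y] by linarith
    then have "\<bar>c - f y\<bar>\<^sup>2 \<le> (\<bar>c\<bar> + B)\<^sup>2" by (intro power_mono) auto
    then show ?thesis by simp
  qed
  have pt: "(?k - f p)\<^sup>2 * indicator (ball x1 r1) p * (?m2 * ?D) \<le> jump_energy m f p" for p
  proof (cases "p \<in> ball x1 r1")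
    case True
    have "(f p - ?k)\<^sup>2 * ?m2 * ?D \<le> (LINT q|M. (f p - f q)\<^sup>2 * indicator (ball x2 r2) q) * ?D"
      using D by (intro mult_right_mono avg_jensen[OF r(2) fm B]) auto
    also have "\<dots> = (LINT q|M. (f p - f q)\<^sup>2 * indicator (ball x2 r2) q * ?D)"
      by simp
    also have "\<dots> \<le> (LINT q|M. u m p q * (f p - f q)\<^sup>2)"
    proof (rule integral_mono)
      show "integrable M (\<lambda>q. (f p - f q)\<^sup>2 * indicator (ball x2 r2) q * ?D)"
        by (intro integrable_mult_left continuous_integrable_on_ball[OF _ sqB]) measurable
      show "integrable M (\<lambda>q. u m p q * (f p - f q)\<^sup>2)"
        by (intro u_mult_integrable[OF m _ sqB]) measurable
      fix q
      show "(f p - f q)\<^sup>2 * indicator (ball x2 r2) q * ?D \<le> u m p q * (f p - f q)\<^sup>2"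
      proof (cases "q \<in> ball x2 r2")
        case q: True
        then have "?D \<le> u m p q"
          using near[OF True] by (intro u_lower[OF m])
        then show ?thesis
          using q by (simp add: mult.commute mult_right_mono)
      next
        case False
        then show ?thesis using u_nonneg[OF m] by simp
      qed
    qed
    finally show ?thesis
      using True by (simp add: jump_energy_def power2_commute mult.assoc)
  next
    case False
    then show ?thesis using jump_energy_nonneg[OF m] by simp
  qed
  have "(avg f x1 r1 - ?k)\<^sup>2 * ?m1 * (?m2 * ?D) \<le> (LINT p|M. (?k - f p)\<^sup>2 * indicator (ball x1 r1) p) * (?m2 * ?D)"
    using D by (subst power2_commute) (intro mult_right_mono avg_jensen[OF r(1) fm B], auto)
  also have "\<dots> = (LINT p|M. (?k - f p)\<^sup>2 * indicator (ball x1 r1) p * (?m2 * ?D))"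
    by simp
  also have "\<dots> \<le> (LINT p|M. jump_energy m f p)"
    by (intro integral_mono integrable_mult_left continuous_integrable_on_ball[OF _ sqB] pt
        jump_energy_integral(1)[OF m f B]) measurable
  finally show ?thesis by (simp add: mult.assoc mult.left_commute)
qed

text \<open>8 = 2 * 4, with 2 from the energy bound and 4 from m - l \<ge> m / 2; 4^dH comes from
  two balls of radius at least rho / 2, the square of \<open>c1\<close> from their volumes and
  \<open>a\<close> from the kernel.\<close>

definition K_avg :: real where "K_avg = 8 * 4 powr dH / (a * c1\<^sup>2)"

lemma K_avg_pos: "0 < K_avg"
  using a_pos c1_pos by (simp add: K_avg_def)

text \<open>The level m = rho^(-dW) has length scale rho, and 2l \<le> m gives m - l \<ge> m / 2.
  The squared gap times rho^(2 dH) rho^(dW-dH) is at most of order R rho^(2 dW), which leaves R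
  rho^(dW-dH).\<close>

lemma potential_avg_difference:
  fixes x y :: 'a
  assumes l: "0 < l" and \<rho>: "0 < \<rho>" "2 * l \<le> \<rho> powr (- dW)"
    and r: "\<rho> / 2 \<le> r1" "r1 \<le> \<rho>" "\<rho> / 2 \<le> r2" "r2 \<le> \<rho>" and d: "dist x1 x2 \<le> \<rho>"
  defines "f \<equiv> \<lambda>w. u l x w - u l y w"
  shows "\<bar>avg f x1 r1 - avg f x2 r2\<bar> \<le> sqrt (K_avg * resistance l x y) * \<rho> powr ((dW - dH) / 2)"
proof -
  define m where "m = \<rho> powr (- dW)"
  have m0: "0 < m" using \<rho> by (simp add: m_def)
  have lm: "2 * l \<le> m" using \<rho> by (simp add: m_def)
  then have lm': "l < m" using l by simp
  have m1: "m powr (- 1 / dW) = \<rho>"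
    unfolding m_def using \<rho> dW_pos by (simp add: powr_powr)
  have m2: "m powr (- (dW - dH) / dW) = \<rho> powr (dW - dH)"
    unfolding m_def using \<rho> dW_pos by (simp add: powr_powr)
  let ?C = "A * l powr (- (dW - dH) / dW)"
  let ?\<Gamma> = "resistance l x y"
  have f_int: "integrable M f" unfolding f_def using u_integrable[OF l] by auto
  have fB: "\<bar>f w\<bar> \<le> 2 * ?C" for w
    unfolding f_def using u_bounded[OF l, of x w] u_bounded[OF l, of y w] by linarith
  have ball: "c1 * (\<rho> / 2) powr dH \<le> measure M (ball z r)" if "\<rho> / 2 \<le> r" for z r
  proof -
    have "c1 * (\<rho> / 2) powr dH \<le> c1 * r powr dH"
      using that \<rho> c1_pos dH_pos by (intro mult_left_mono powr_mono2) auto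
    also have "\<dots> \<le> measure M (ball z r)"
      using that \<rho> by (intro measure_ball_lower) auto
    finally show ?thesis .
  qed
  let ?\<delta> = "(avg f x1 r1 - avg f x2 r2)\<^sup>2"
  have "?\<delta> * ((c1 * (\<rho> / 2) powr dH) * (c1 * (\<rho> / 2) powr dH)) * (a * \<rho> powr (dW - dH))
     \<le> ?\<delta> * (measure M (ball x1 r1) * measure M (ball x2 r2)) * (a * \<rho> powr (dW - dH))"
    using ball r a_pos c1_pos by (intro mult_right_mono mult_left_mono mult_mono) auto
  also have "\<dots> \<le> (LINT w|M. jump_energy m f w)"
  proof -
    \<comment> \<open>Two radii and one distance of centres give 3 rho, within the range 4 rho of
      \<open>u_lower\<close>.\<close>
    have "dist p q \<le> 4 * m powr (- 1 / dW)" if "p \<in> ball x1 r1" "q \<in> ball x2 r2" for p q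
    proof -
      have "dist p q \<le> dist p x1 + dist x1 x2 + dist x2 q"
        using dist_triangle[of p q x1] dist_triangle[of x1 q x2] by linarith
      then show ?thesis using that d r \<rho> unfolding m1 by (simp add: dist_commute)
    qed
    then show ?thesis
      using avg_difference[OF m0 _ _ f_int fB, of r1 r2 x1 x2] r \<rho> unfolding m2 by simp
  qed
  also have "\<dots> \<le> 2 * ?\<Gamma> / (m - l)\<^sup>2"
    unfolding f_def by (rule potential_jump_energy(2)[OF l lm'])
  also have "\<dots> \<le> 2 * ?\<Gamma> / (m / 2)\<^sup>2"
    using lm l m0 resistance_nonneg[OF l] lm' by (intro divide_left_mono power_mono mult_pos_pos) auto
  also have "\<dots> = 8 * ?\<Gamma> / (m * m)"
    by (simp add: power2_eq_square)
  also have "\<dots> = 8 * ?\<Gamma> * \<rho> powr (2 * dW)"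
    using \<rho> by (simp add: m_def powr_minus powr_add[symmetric] field_simps)
  finally have le: "?\<delta> * (c1\<^sup>2 * a * ((\<rho> / 2) powr dH * (\<rho> / 2) powr dH * \<rho> powr (dW - dH))) \<le> 8 * ?\<Gamma> * \<rho> powr (2 * dW)"
    by (simp add: power2_eq_square mult_ac)
  have "(\<rho> / 2) powr dH * (\<rho> / 2) powr dH * \<rho> powr (dW - dH) = \<rho> powr (dW + dH) / 4 powr dH"
  proof -
    have "(2::real) powr dH * 2 powr dH = 4 powr dH"
      by (simp add: powr_mult[symmetric])
    moreover have "\<rho> powr dH * \<rho> powr dH * \<rho> powr (dW - dH) = \<rho> powr (dW + dH)"
      by (simp add: powr_add[symmetric] add.commute)
    ultimately show ?thesis
      using \<rho> by (simp add: powr_divide)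
  qed
  note eq = this
  have "?\<delta> * (c1\<^sup>2 * a) * \<rho> powr (dW + dH) \<le> 8 * 4 powr dH * ?\<Gamma> * \<rho> powr (2 * dW)"
    using le unfolding eq by (simp add: field_simps)
  also have "\<rho> powr (2 * dW) = \<rho> powr (dW - dH) * \<rho> powr (dW + dH)"
    by (simp add: powr_add[symmetric])
  finally have "?\<delta> * (c1\<^sup>2 * a) \<le> 8 * 4 powr dH * ?\<Gamma> * \<rho> powr (dW - dH)"
    using \<rho> by (simp add: mult.assoc[symmetric])
  then have "?\<delta> \<le> K_avg * ?\<Gamma> * \<rho> powr (dW - dH)"
    using a_pos c1_pos by (simp add: K_avg_def field_simps)
  then have "sqrt ?\<delta> \<le> sqrt (K_avg * ?\<Gamma> * \<rho> powr (dW - dH))"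
    by (rule real_sqrt_le_mono)
  also have "\<dots> = sqrt (K_avg * ?\<Gamma>) * \<rho> powr ((dW - dH) / 2)"
  proof -
    have "sqrt (\<rho> powr (dW - dH)) = \<rho> powr ((dW - dH) / 2)"
      using \<rho> by (simp add: powr_half_sqrt[symmetric] powr_powr)
    then show ?thesis by (simp add: real_sqrt_mult)
  qed
  finally show ?thesis by simp
qed

text \<open>\<open>avg_jensen\<close> with c = f x reduces the claim to the squared oscillation on
  the ball, which continuity makes small.\<close>

lemma avg_tendsto:
  assumes f: "continuous_on UNIV f" and B: "\<And>y. \<bar>f y\<bar> \<le> B" and r: "\<And>n. 0 < r n" "r \<longlonglongrightarrow> 0"
  shows "(\<lambda>n. avg f x (r n)) \<longlonglongrightarrow> f x"
proof (rule LIMSEQ_I)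
  fix e :: real assume e: "0 < e"
  have fm [measurable]: "f \<in> borel_measurable M" by (intro continuous_measurable f)
  obtain d where d: "d > 0" "\<And>y. dist y x < d \<Longrightarrow> \<bar>f y - f x\<bar> < e / 2"
    using f e unfolding continuous_on_iff dist_real_def
    by (metis UNIV_I half_gt_zero)
  have "\<forall>\<^sub>F n in sequentially. r n < d"
    using r(2) d(1) by (rule order_tendstoD)
  then obtain N where N: "\<And>n. n \<ge> N \<Longrightarrow> r n < d"
    by (auto simp: eventually_sequentially)
  have "norm (avg f x (r n) - f x) < e" if n: "n \<ge> N" for n
  proof -
    let ?B = "ball x (r n)"
    have mu: "0 < measure M ?B" by (rule measure_ball_pos[OF r(1)])
    have "(f x - avg f x (r n))\<^sup>2 * measure M ?B \<le> (LINT y|M. (f x - f y)\<^sup>2 * indicator ?B y)"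
      by (rule avg_jensen[OF r(1) fm B])
    also have "\<dots> \<le> (LINT y|M. (e / 2)\<^sup>2 * indicator ?B y)"
    proof (rule integral_mono')
      show "integrable M (\<lambda>y. (e / 2)\<^sup>2 * indicator ?B y)"
        using integrable_indicator_ball by auto
      fix y
      show "(f x - f y)\<^sup>2 * indicator ?B y \<le> (e / 2)\<^sup>2 * indicator ?B y"
      proof (cases "y \<in> ?B")
        case True
        then have "\<bar>f y - f x\<bar> \<le> \<bar>e / 2\<bar>"
          using N[OF n] d(2)[of y] e by (auto simp: dist_commute)
        then have "(f y - f x)\<^sup>2 \<le> (e / 2)\<^sup>2" by (simp only: abs_le_square_iff)
        then show ?thesis using True by (simp add: power2_commute)
      qed simp
    qed auto
    also have "\<dots> = (e / 2)\<^sup>2 * measure M ?B"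
      by simp
    finally have "(f x - avg f x (r n))\<^sup>2 \<le> (e / 2)\<^sup>2"
      using mu by simp
    then have "\<bar>f x - avg f x (r n)\<bar> \<le> e / 2"
      using e by (simp add: abs_le_square_iff[symmetric])
    then have "\<bar>f x - avg f x (r n)\<bar> < e" using e by linarith
    then show ?thesis by (simp add: abs_minus_commute)
  qed
  then show "\<exists>no. \<forall>n\<ge>no. norm (avg f x (r n) - f x) < e" by blast
qed

text \<open>The factor by which rho^((dW-dH)/2) shrinks when rho is halved, hence the ratio of the
  geometric series over dyadic radii.\<close>

definition \<theta> :: real where "\<theta> = (1/2) powr ((dW - dH) / 2)"

lemma \<theta>_bounds: "0 < \<theta>" "\<theta> < 1"
  using dH_less_dW powr_less_mono2[of "(dW - dH) / 2" "1/2" 1] by (auto simp: \<theta>_def)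

text \<open>Telescoping over the radii rho / 2^n: each halving gains a factor
  \<open>\<theta>\<close>, and the averages converge to the point value.\<close>

lemma potential_avg_point:
  fixes x y z :: 'a
  assumes l: "0 < l" and \<rho>: "0 < \<rho>" "2 * l \<le> \<rho> powr (- dW)"
  defines "f \<equiv> \<lambda>w. u l x w - u l y w"
  shows "\<bar>avg f z \<rho> - f z\<bar> \<le> sqrt (K_avg * resistance l x y) * \<rho> powr ((dW - dH) / 2) / (1 - \<theta>)"
proof -
  let ?Q = "sqrt (K_avg * resistance l x y) * \<rho> powr ((dW - dH) / 2)"
  define r where "r n = \<rho> * (1/2) ^ n" for n :: nat
  have r0: "0 < r n" for n using \<rho> by (simp add: r_def)
  have Q0: "0 \<le> ?Q" using K_avg_pos resistance_nonneg[OF l] by simp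
  have step: "\<bar>avg f z (r n) - avg f z (r (Suc n))\<bar> \<le> ?Q * \<theta> ^ n" for n
  proof -
    \<comment> \<open>The condition on \<open>l\<close> only improves as the radius shrinks, so
      every dyadic step may use the estimate between averages.\<close>
    have "\<rho> powr (- dW) \<le> r n powr (- dW)"
      using \<rho> r0[of n] dW_pos by (intro powr_mono2') (auto simp: r_def mult_le_cancel_left1 power_le_one)
    then have "\<bar>avg f z (r n) - avg f z (r (Suc n))\<bar> \<le> sqrt (K_avg * resistance l x y) * r n powr ((dW - dH) / 2)"
      unfolding f_def using r0[of n] \<rho>
      by (intro potential_avg_difference[OF l]) (auto simp: r_def)
    also have "r n powr ((dW - dH) / 2) = \<rho> powr ((dW - dH) / 2) * \<theta> ^ n"
      using \<rho> by (simp add: r_def \<theta>_def powr_mult powr_realpow[symmetric] powr_powr mult.commute)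
    finally show ?thesis by (simp add: mult.assoc)
  qed
  have sum: "\<bar>avg f z \<rho> - avg f z (r n)\<bar> \<le> ?Q * (\<Sum>k<n. \<theta> ^ k)" for n
  proof (induction n)
    case 0
    then show ?case by (simp add: r_def)
  next
    case (Suc n)
    then show ?case using step[of n] by (simp add: algebra_simps)
  qed
  have geo: "?Q * (\<Sum>k<n. \<theta> ^ k) \<le> ?Q / (1 - \<theta>)" for n
  proof -
    have "(\<Sum>k<n. \<theta> ^ k) = (1 - \<theta> ^ n) / (1 - \<theta>)"
      using \<theta>_bounds by (subst sum_gp_strict) auto
    also have "\<dots> \<le> 1 / (1 - \<theta>)"
      using \<theta>_bounds by (intro divide_right_mono) auto
    finally have "?Q * (\<Sum>k<n. \<theta> ^ k) \<le> ?Q * (1 / (1 - \<theta>))"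
      using Q0 by (intro mult_left_mono)
    then show ?thesis by simp
  qed
  have "(\<lambda>n. avg f z (r n)) \<longlonglongrightarrow> f z"
  proof (rule avg_tendsto)
    show "continuous_on UNIV f"
      unfolding f_def by (intro continuous_intros u_cont[OF l])
    show "\<bar>f w\<bar> \<le> 2 * (A * l powr (- (dW - dH) / dW))" for w
      unfolding f_def using u_bounded[OF l, of x w] u_bounded[OF l, of y w] by linarith
    have "(\<lambda>n. \<rho> * (1/2) ^ n) \<longlonglongrightarrow> \<rho> * 0"
      by (intro tendsto_intros LIMSEQ_power_zero) auto
    then show "r \<longlonglongrightarrow> 0" by (simp add: r_def[abs_def])
  qed (rule r0)
  then have "(\<lambda>n. \<bar>avg f z \<rho> - avg f z (r n)\<bar>) \<longlonglongrightarrow> \<bar>avg f z \<rho> - f z\<bar>"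
    by (intro tendsto_intros)
  then show ?thesis
    by (rule LIMSEQ_le_const2) (use order_trans[OF sum geo] in blast)
qed

text \<open>Two passages from a point to an average and one between averages give the constant 2 /
  (1 - \<theta>) + 1. The resistance occurs on the left and under the square root on the right;
  squaring and cancelling it, when nonzero, doubles the exponent.\<close>

lemma resistance_bound_near:
  assumes l: "0 < l" and xy: "x \<noteq> y" and near: "2 * l \<le> dist x y powr (- dW)"
  shows "resistance l x y \<le> (2 / (1 - \<theta>) + 1)\<^sup>2 * K_avg * dist x y powr (dW - dH)"
proof -
  let ?\<rho> = "dist x y" and ?\<Gamma> = "resistance l x y"
  let ?Q = "sqrt (K_avg * ?\<Gamma>) * ?\<rho> powr ((dW - dH) / 2)"
  let ?S = "2 / (1 - \<theta>) + 1"
  define f where "f = (\<lambda>w. u l x w - u l y w)"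
  have \<rho>: "0 < ?\<rho>" using xy by simp
  have \<Gamma>0: "0 \<le> ?\<Gamma>" by (rule resistance_nonneg[OF l])
  have "\<bar>avg f x ?\<rho> - f x\<bar> \<le> ?Q / (1 - \<theta>)" "\<bar>avg f y ?\<rho> - f y\<bar> \<le> ?Q / (1 - \<theta>)"
    unfolding f_def by (rule potential_avg_point[OF l \<rho> near])+
  moreover have "\<bar>avg f x ?\<rho> - avg f y ?\<rho>\<bar> \<le> ?Q"
    unfolding f_def using \<rho> by (intro potential_avg_difference[OF l \<rho> near]) auto
  ultimately have "f x - f y \<le> 2 * (?Q / (1 - \<theta>)) + ?Q" by linarith
  also have "\<dots> = ?S * ?Q" by (simp add: distrib_right)
  also have "f x - f y = ?\<Gamma>"
    using u_sym[OF l, of y x] by (simp add: f_def resistance_def)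
  finally have le: "?\<Gamma> \<le> ?S * ?Q" .
  have "?\<Gamma> * ?\<Gamma> \<le> (?S * ?Q)\<^sup>2"
    using power_mono[OF le \<Gamma>0, of 2] by (simp add: power2_eq_square)
  also have "\<dots> = ?S\<^sup>2 * (K_avg * ?\<Gamma>) * (?\<rho> powr ((dW - dH) / 2))\<^sup>2"
    using K_avg_pos \<Gamma>0 by (simp add: power_mult_distrib)
  also have "(?\<rho> powr ((dW - dH) / 2))\<^sup>2 = ?\<rho> powr (dW - dH)"
    by (simp add: power2_eq_square powr_add[symmetric])
  finally have "?\<Gamma> * ?\<Gamma> \<le> (?S\<^sup>2 * K_avg * ?\<rho> powr (dW - dH)) * ?\<Gamma>"
    by (simp add: mult_ac)
  then show ?thesis
    using \<Gamma>0 K_avg_pos by (cases "?\<Gamma> = 0") (auto intro: mult_right_le_imp_le)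
qed

text \<open>Outside the range of \<open>resistance_bound_near\<close> the length of \<open>l\<close>
  is at most of order d(x,y), and the trivial bound already has the right size. Adding the two
  constants makes the estimate uniform in \<open>l\<close>.\<close>

lemma resistance_bound:
  "\<exists>C>0. \<forall>l>0. \<forall>x y. resistance l x y \<le> C * dist x y powr (dW - dH)"
proof (intro exI conjI allI impI)
  let ?C1 = "(2 / (1 - \<theta>) + 1)\<^sup>2 * K_avg" and ?C2 = "2 * A * 2 powr ((dW - dH) / dW)"
  show "0 < ?C1 + ?C2"
    using K_avg_pos A_pos by (intro add_nonneg_pos) auto
  fix l :: real and x y :: 'a
  assume l: "0 < l"
  let ?d = "dist x y powr (dW - dH)"
  have d0: "0 \<le> ?d" by simp
  have "resistance l x y \<le> ?C1 * ?d + ?C2 * ?d"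
  proof (cases "x = y")
    case True
    then show ?thesis by (simp add: resistance_def)
  next
    case xy: False
    show ?thesis
    proof (cases "2 * l \<le> dist x y powr (- dW)")
      case True
      then show ?thesis
        using resistance_bound_near[OF l xy] A_pos by (intro add_increasing2) auto
    next
      case False
      then have "l powr (- (dW - dH) / dW) \<le> (dist x y powr (- dW) / 2) powr (- (dW - dH) / dW)"
        using l xy dW_pos dH_less_dW by (intro powr_mono2') (auto simp: divide_nonpos_pos)
      also have "\<dots> = 2 powr ((dW - dH) / dW) * ?d"
      proof -
        have "(dist x y powr (- dW)) powr (- (dW - dH) / dW) = ?d"
          using dW_pos by (simp add: powr_powr)
        moreover have "2 powr (- (dW - dH) / dW) = 1 / (2::real) powr ((dW - dH) / dW)"
          by (simp only: minus_divide_left[symmetric] powr_minus_divide)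
        ultimately show ?thesis by (subst powr_divide) (simp_all del: powr_minus)
      qed
      finally have "resistance l x y \<le> 2 * A * (2 powr ((dW - dH) / dW) * ?d)"
        using A_pos by (intro order_trans[OF resistance_bound_trivial[OF l] mult_left_mono]) auto
      then show ?thesis
        using K_avg_pos by (intro add_increasing) (auto simp: mult.assoc)
    qed
  qed
  then show "resistance l x y \<le> (?C1 + ?C2) * ?d"
    by (simp add: distrib_right)
qed

theorem u_L1_hoelder:
  "\<exists>C>0. \<forall>l>0. \<forall>x y. (LINT z|M. \<bar>u l x z - u l y z\<bar>) \<le> C * dist x y powr (dW - dH) / l powr (dH / dW)"
proof -
  obtain C where C: "C > 0" "\<And>l x y. l > 0 \<Longrightarrow> resistance l x y \<le> C * dist x y powr (dW - dH)"
    using resistance_bound by blast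
  show ?thesis
  proof (intro exI[of _ "2 * C / a"] conjI allI impI)
    show "0 < 2 * C / a" using C a_pos by simp
    fix l :: real and x y :: 'a assume l: "0 < l"
    have "(LINT z|M. \<bar>u l x z - u l y z\<bar>) \<le> 2 * resistance l x y / (a * l powr (dH / dW))"
      by (rule u_L1_difference[OF l])
    also have "\<dots> \<le> 2 * (C * dist x y powr (dW - dH)) / (a * l powr (dH / dW))"
      using C(2)[OF l] a_pos by (intro divide_right_mono mult_left_mono) auto
    finally show "(LINT z|M. \<bar>u l x z - u l y z\<bar>) \<le> 2 * C / a * dist x y powr (dW - dH) / l powr (dH / dW)"
      by (simp add: mult.assoc)
  qed
qed

end

section \<open>Heat kernels\<close>

text \<open>The law of an exponential time of rate \<open>l\<close>. Time integrals against e^(-ls)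
  become expectations divided by \<open>l\<close>, and bounded measurable integrands are integrable
  at once.\<close>

definition expo :: "real \<Rightarrow> real measure" where
  "expo l = density lborel (\<lambda>s. ennreal (exponential_density l s))"

lemma sets_expo [simp, measurable_cong]: "sets (expo l) = sets borel"
  by (simp add: expo_def)

lemma space_expo [simp]: "space (expo l) = UNIV"
  by (simp add: expo_def)

lemma prob_space_expo: "0 < l \<Longrightarrow> prob_space (expo l)"
  unfolding expo_def by (rule prob_space_exponential_density)

lemma AE_expo_pos: "AE s in expo l. 0 < s"
proof -
  have "AE s in lborel. s \<noteq> (0::real)"
    by (rule AE_lborel_singleton)
  then show ?thesis
    unfolding expo_def
    by (subst AE_density) (auto simp: exponential_density_def elim!: eventually_mono)
qed

lemma nn_integral_expo:
  "f \<in> borel_measurable borel \<Longrightarrow>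
    (\<integral>\<^sup>+s. f s \<partial>expo l) = (\<integral>\<^sup>+s. ennreal (exponential_density l s) * f s \<partial>lborel)"
  unfolding expo_def by (subst nn_integral_density) auto

text \<open>Rescaling by \<open>l\<close> gives the Gamma integral; extended reals deliver
  integrability and value together. It is used at b = -dH/dW for the finite diagonal, b = 1/dW for
  concentration and b = 1 for the resolvent approximation.\<close>

lemma expo_moment:
  assumes l: "0 < l" and b: "- 1 < b"
  shows "integrable (expo l) (\<lambda>s. s powr b)"
    and "(LINT s|expo l. s powr b) = Gamma (1 + b) * l powr (- b)"
proof -
  have G: "0 < Gamma (1 + b)" using b by (intro Gamma_real_pos) auto
  have "ennreal (Gamma (1 + b)) = (\<integral>\<^sup>+t. ennreal (indicator {0..} t * t powr (1 + b - 1) / exp t) \<partial>lborel)"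
    using b by (intro Gamma_conv_nn_integral_real) auto
  also have "\<dots> = ennreal \<bar>l\<bar> * (\<integral>\<^sup>+s. ennreal (indicator {0..} (0 + l * s) * (0 + l * s) powr (1 + b - 1) / exp (0 + l * s)) \<partial>lborel)"
    using l by (intro nn_integral_real_affine) auto
  also have "\<dots> = (\<integral>\<^sup>+s. ennreal l * ennreal (indicator {0..} (0 + l * s) * (0 + l * s) powr (1 + b - 1) / exp (0 + l * s)) \<partial>lborel)"
    using l by (subst nn_integral_cmult) auto
  also have "\<dots> = (\<integral>\<^sup>+s. ennreal (exponential_density l s) * ennreal (l powr b * s powr b) \<partial>lborel)"
  proof (intro nn_integral_cong)
    fix s :: real
    show "ennreal l * ennreal (indicator {0..} (0 + l * s) * (0 + l * s) powr (1 + b - 1) / exp (0 + l * s))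
        = ennreal (exponential_density l s) * ennreal (l powr b * s powr b)"
      using l by (cases "0 \<le> s")
        (auto simp: exponential_density_def powr_mult ennreal_mult[symmetric] exp_minus field_simps
          indicator_def zero_le_mult_iff)
  qed
  also have "\<dots> = (\<integral>\<^sup>+s. ennreal (l powr b * s powr b) \<partial>expo l)"
    by (subst nn_integral_expo) auto
  also have "\<dots> = ennreal (l powr b) * (\<integral>\<^sup>+s. ennreal (s powr b) \<partial>expo l)"
    by (subst nn_integral_cmult[symmetric]) (auto simp: ennreal_mult)
  finally have eq: "ennreal (Gamma (1 + b)) = ennreal (l powr b) * (\<integral>\<^sup>+s. ennreal (s powr b) \<partial>expo l)" .
  have "ennreal (Gamma (1 + b) * l powr (- b)) = ennreal (l powr (- b)) * ennreal (Gamma (1 + b))"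
    using G by (simp add: ennreal_mult' mult.commute)
  also have "\<dots> = ennreal (l powr (- b) * l powr b) * (\<integral>\<^sup>+s. ennreal (s powr b) \<partial>expo l)"
    unfolding eq by (simp add: ennreal_mult' mult.assoc)
  also have "l powr (- b) * l powr b = 1"
    using l by (simp add: powr_add[symmetric])
  finally have nn: "(\<integral>\<^sup>+s. ennreal (s powr b) \<partial>expo l) = ennreal (Gamma (1 + b) * l powr (- b))"
    by simp
  show "integrable (expo l) (\<lambda>s. s powr b)"
    by (rule integrableI_nonneg) (auto simp: nn)
  show "(LINT s|expo l. s powr b) = Gamma (1 + b) * l powr (- b)"
    using G by (intro integral_eq_nn_integral[THEN trans]) (auto simp: nn)
qed

text \<open>The right side integrates against the density of a sum of independent exponential times
  of rates l < m. Its difference of exponentials is the source of the resolvent identity.\<close>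

lemma expo_convolution:
  fixes q :: "real \<Rightarrow> ennreal"
  assumes l: "0 < l" "l < m" and q [measurable]: "q \<in> borel_measurable borel"
  shows "(\<integral>\<^sup>+s. (\<integral>\<^sup>+t. q (s + t) \<partial>expo m) \<partial>expo l) =
    (\<integral>\<^sup>+r. q r * ennreal (indicator {0..} r * (l * m / (m - l) * (exp (- l * r) - exp (- m * r)))) \<partial>lborel)"
proof -
  note [measurable] = borel_measurable_erlang_density
  have m: "0 < m" using l by simp
  have inner: "(\<integral>\<^sup>+t. ennreal (exponential_density l (r - t)) * ennreal (exponential_density m t) \<partial>lborel)
      = ennreal (indicator {0..} r * (l * m / (m - l) * (exp (- l * r) - exp (- m * r))))" for r
  proof (cases "0 \<le> r")
    case True
    have "(\<integral>\<^sup>+t. ennreal (exponential_density l (r - t)) * ennreal (exponential_density m t) \<partial>lborel)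
        = (\<integral>\<^sup>+t. ennreal (l * m * exp (- l * r) * exp (- (m - l) * t)) * indicator {0..r} t \<partial>lborel)"
      using l m
      by (intro nn_integral_cong)
        (auto simp: exponential_density_def indicator_def ennreal_mult[symmetric] exp_add[symmetric] algebra_simps)
    also have "\<dots> = ennreal (- (l * m / (m - l)) * exp (- l * r) * exp (- (m - l) * r)
        - (- (l * m / (m - l)) * exp (- l * r) * exp (- (m - l) * 0)))"
    proof (rule nn_integral_FTC_Icc[where F = "\<lambda>t. - (l * m / (m - l)) * exp (- l * r) * exp (- (m - l) * t)"])
      fix t
      show "((\<lambda>t. - (l * m / (m - l)) * exp (- l * r) * exp (- (m - l) * t)) has_real_derivative
          l * m * exp (- l * r) * exp (- (m - l) * t)) (at t)"
      proof -
        define k c where "k = l * m / (m - l)" and "c = m - l"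
        have "((\<lambda>t. - k * exp (- l * r) * exp (- c * t)) has_real_derivative
            k * c * exp (- l * r) * exp (- c * t)) (at t)"
          by (auto intro!: derivative_eq_intros)
        moreover have "k * c = l * m" using l by (simp add: k_def c_def)
        ultimately show ?thesis by (simp only: k_def c_def)
      qed
    qed (use True l m in auto)
    also have "- (l * m / (m - l)) * exp (- l * r) * exp (- (m - l) * r)
        - (- (l * m / (m - l)) * exp (- l * r) * exp (- (m - l) * 0))
        = l * m / (m - l) * (exp (- l * r) - exp (- l * r) * exp (- (m - l) * r))"
      by (simp add: right_diff_distrib mult.assoc)
    also have "exp (- l * r) * exp (- (m - l) * r) = exp (- m * r)"
      by (simp add: exp_add[symmetric] algebra_simps)
    finally show ?thesis using True by simp
  next
    case False
    then have "(\<integral>\<^sup>+t. ennreal (exponential_density l (r - t)) * ennreal (exponential_density m t) \<partial>lborel)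
        = (\<integral>\<^sup>+t. 0 \<partial>(lborel :: real measure))"
      by (intro nn_integral_cong) (auto simp: exponential_density_def)
    then show ?thesis using False by simp
  qed
  have "(\<integral>\<^sup>+s. (\<integral>\<^sup>+t. q (s + t) \<partial>expo m) \<partial>expo l)
      = (\<integral>\<^sup>+s. (\<integral>\<^sup>+t. ennreal (exponential_density l s) * (ennreal (exponential_density m t) * q (s + t)) \<partial>lborel) \<partial>lborel)"
    by (simp add: nn_integral_expo nn_integral_cmult)
  also have "\<dots> = (\<integral>\<^sup>+t. (\<integral>\<^sup>+s. ennreal (exponential_density l s) * (ennreal (exponential_density m t) * q (s + t)) \<partial>lborel) \<partial>lborel)"
    by (rule lborel_pair.Fubini'[symmetric]) (simp add: case_prod_beta')
  also have "\<dots> = (\<integral>\<^sup>+t. (\<integral>\<^sup>+r. q r * (ennreal (exponential_density l (r - t)) * ennreal (exponential_density m t)) \<partial>lborel) \<partial>lborel)"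
  proof (rule nn_integral_cong)
    fix t :: real
    show "(\<integral>\<^sup>+s. ennreal (exponential_density l s) * (ennreal (exponential_density m t) * q (s + t)) \<partial>lborel)
        = (\<integral>\<^sup>+r. q r * (ennreal (exponential_density l (r - t)) * ennreal (exponential_density m t)) \<partial>lborel)"
      by (subst nn_integral_real_affine[where c = 1 and t = "- t"])
        (auto simp: mult_ac intro!: nn_integral_cong)
  qed
  also have "\<dots> = (\<integral>\<^sup>+r. (\<integral>\<^sup>+t. q r * (ennreal (exponential_density l (r - t)) * ennreal (exponential_density m t)) \<partial>lborel) \<partial>lborel)"
    by (rule lborel_pair.Fubini'[of "\<lambda>r t. q r * (ennreal (exponential_density l (r - t)) * ennreal (exponential_density m t))"])
      (simp add: case_prod_beta')
  also have "\<dots> = (\<integral>\<^sup>+r. q r * ennreal (indicator {0..} r * (l * m / (m - l) * (exp (- l * r) - exp (- m * r)))) \<partial>lborel)"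
    by (subst nn_integral_cmult) (auto simp: inner)
  finally show ?thesis .
qed

text \<open>The decrements are nonincreasing and telescope to at most g 0, so the last of n + 1 of
  them is at most their mean.\<close>

lemma antimono_differences_le:
  fixes g :: "nat \<Rightarrow> real"
  assumes "\<And>n. 0 \<le> g n" and "\<And>n. g (Suc n) - g (Suc (Suc n)) \<le> g n - g (Suc n)"
  shows "g n - g (Suc n) \<le> g 0 / real (Suc n)"
proof -
  have anti: "g n - g (Suc n) \<le> g k - g (Suc k)" if "k \<le> n" for k
    using that
  proof (induction rule: inc_induct)
    case (step j)
    then show ?case using assms(2)[of j] by linarith
  qed simp
  have "real (Suc n) * (g n - g (Suc n)) = (\<Sum>k\<le>n. g n - g (Suc n))"
    by simp
  also have "\<dots> \<le> (\<Sum>k\<le>n. g k - g (Suc k))"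
    using anti by (intro sum_mono) auto
  also have "\<dots> = g 0 - g (Suc n)"
    by (rule sum_telescope)
  also have "\<dots> \<le> g 0"
    using assms(1) by simp
  finally show ?thesis by (simp add: field_simps)
qed

text \<open>Discrete version of s^2 e''(s) \<le> C e(0) for completely monotone functions: the
  decrement bound is used on \<open>e\<close> and then on the decrements from index \<open>n\<close>
  on, whence the index 2n.\<close>

lemma second_difference_le:
  fixes e :: "nat \<Rightarrow> real"
  assumes nonneg: "\<And>n. 0 \<le> e n" and anti: "\<And>n. e (Suc n) \<le> e n"
    and convex: "\<And>n. 0 \<le> e n - 2 * e (Suc n) + e (Suc (Suc n))"
    and third: "\<And>n. e (Suc n) - 2 * e (Suc (Suc n)) + e (Suc (Suc (Suc n))) \<le> e n - 2 * e (Suc n) + e (Suc (Suc n))"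
  shows "e (2 * n) - 2 * e (Suc (2 * n)) + e (Suc (Suc (2 * n))) \<le> e 0 / (real (Suc n))\<^sup>2"
proof -
  have first: "e n - e (Suc n) \<le> e 0 / real (Suc n)" for n
    using convex by (intro antimono_differences_le nonneg) (smt (verit))
  define g where "g k = e (n + k) - e (Suc (n + k))" for k
  have "g n - g (Suc n) \<le> g 0 / real (Suc n)"
  proof (rule antimono_differences_le)
    show "0 \<le> g k" for k using anti by (simp add: g_def)
    show "g (Suc k) - g (Suc (Suc k)) \<le> g k - g (Suc k)" for k
      using third[of "n + k"] by (simp add: g_def)
  qed
  also have "\<dots> \<le> (e 0 / real (Suc n)) / real (Suc n)"
    using first[of n] by (intro divide_right_mono) (auto simp: g_def)
  also have "\<dots> = e 0 / (real (Suc n))\<^sup>2"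
    by (simp only: power2_eq_square divide_divide_eq_left)
  also have "g n - g (Suc n) = e (2 * n) - 2 * e (Suc (2 * n)) + e (Suc (Suc (2 * n)))"
    by (simp add: g_def mult_2[symmetric])
  finally show ?thesis .
qed

text \<open>Discrete form of the Landau--Kolmogorov inequality.\<close>

lemma first_difference_le:
  fixes f :: "nat \<Rightarrow> real"
  assumes second: "\<And>j. \<bar>f (Suc (Suc j)) - 2 * f (Suc j) + f j\<bar> \<le> A" and n: "0 < n"
    and f: "0 \<le> f 0" "f 0 \<le> \<epsilon>" "0 \<le> f n" "f n \<le> \<epsilon>"
  shows "\<bar>f 1 - f 0\<bar> \<le> \<epsilon> / real n + real n * A"
proof -
  define D where "D j = f (Suc j) - f j" for j
  have A: "0 \<le> A" using second[of 0] by (meson abs_ge_zero order_trans)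
  have step: "\<bar>D (Suc j) - D j\<bar> \<le> A" for j
    using second[of j] by (simp add: D_def algebra_simps)
  have D: "\<bar>D j - D 0\<bar> \<le> real j * A" for j
  proof (induction j)
    case (Suc j)
    then show ?case using step[of j] by (simp add: algebra_simps)
  qed simp
  \<comment> \<open>The mean slope over \<open>n\<close> steps is at most \<epsilon> / n in absolute
    value, and D 0 differs from it by at most n A.\<close>
  have "f n - f 0 = (\<Sum>j<n. D j)"
    by (simp add: D_def sum_lessThan_telescope)
  then have "real n * D 0 = (f n - f 0) - (\<Sum>j<n. D j - D 0)"
    by (simp add: sum_subtractf)
  moreover have "\<bar>\<Sum>j<n. D j - D 0\<bar> \<le> real n * (real n * A)"
  proof -
    have "\<bar>\<Sum>j<n. D j - D 0\<bar> \<le> (\<Sum>j<n. \<bar>D j - D 0\<bar>)"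
      by (rule sum_abs)
    also have "\<dots> \<le> (\<Sum>j<n. real n * A)"
    proof (rule sum_mono)
      fix j assume "j \<in> {..<n}"
      then have "real j * A \<le> real n * A" using A by (intro mult_right_mono) auto
      then show "\<bar>D j - D 0\<bar> \<le> real n * A" using D[of j] by linarith
    qed
    finally show ?thesis by simp
  qed
  moreover have "\<bar>f n - f 0\<bar> \<le> \<epsilon>" using f by linarith
  ultimately have "\<bar>real n * D 0\<bar> \<le> \<epsilon> + real n * (real n * A)" by linarith
  then have "real n * \<bar>D 0\<bar> \<le> \<epsilon> + real n * (real n * A)" by (simp add: abs_mult)
  then have "\<bar>D 0\<bar> \<le> (\<epsilon> + real n * (real n * A)) / real n"
    using n by (simp add: field_simps)
  then show ?thesis using n by (simp add: D_def add_divide_distrib)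
qed

text \<open>Only continuity and bounds are assumed at this stage: symmetry and the
  Chapman-Kolmogorov identity are still statements about L2 operators, and this locale provides the
  means to make them pointwise.\<close>

locale heat_kernel_bounds = ahlfors_space M dH c1 c2
  for M :: "'a::metric_space measure" and dH c1 c2 :: real +
  fixes p :: "real \<Rightarrow> 'a \<Rightarrow> 'a \<Rightarrow> real" and dW c3 :: real
  assumes dH_less_dW: "dH < dW" and c3_pos: "0 < c3"
    and p_zero: "s \<le> 0 \<Longrightarrow> p s x y = 0"
    and p_cont: "0 < s \<Longrightarrow> continuous_on UNIV (\<lambda>(x, y). p s x y)"
    and p_nonneg: "0 \<le> p s x y"
    and p_upper: "0 < s \<Longrightarrow> p s x y \<le> c3 * s powr (- dH / dW) * (wt (s powr (1 / dW)) x y)\<^sup>2"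
begin

section \<open>The heat operators as integral operators\<close>

lemma dW_pos: "0 < dW"
  using dH_pos dH_less_dW by simp

abbreviation "P \<equiv> kernel_op M p"

lemma p_zero_fun: "s \<le> 0 \<Longrightarrow> p s x = (\<lambda>_. 0)"
  using p_zero by blast

lemma p_cont_right: "continuous_on UNIV (p s x)"
proof (cases "0 < s")
  case True
  have "continuous_on UNIV (\<lambda>y. (\<lambda>(x, y). p s x y) (x, y))"
    by (rule continuous_on_compose2[OF p_cont[OF True]]) (auto intro!: continuous_intros)
  then show ?thesis by simp
next
  case False
  then show ?thesis by (simp add: p_zero_fun not_less)
qed

lemma p_cont_left: "continuous_on UNIV (\<lambda>x. p s x y)"
proof (cases "0 < s")
  case True
  have "continuous_on UNIV (\<lambda>x. (\<lambda>(x, y). p s x y) (x, y))"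
    by (rule continuous_on_compose2[OF p_cont[OF True]]) (auto intro!: continuous_intros)
  then show ?thesis by simp
next
  case False
  then show ?thesis by (simp add: p_zero not_less)
qed

lemma p_measurable [measurable]: "p s x \<in> borel_measurable M"
  by (intro continuous_measurable p_cont_right)

lemma p_measurable2 [measurable]: "(\<lambda>(x, y). p s x y) \<in> borel_measurable (M \<Otimes>\<^sub>M M)"
  by (rule caratheodory_measurable) (auto intro: continuous_measurable p_cont_left p_cont_right)

lemma p_upper_wt: "0 < s \<Longrightarrow> p s x y \<le> c3 * s powr (- dH / dW) * wt (s powr (1 / dW)) x y"
proof -
  assume s: "0 < s"
  have "(wt (s powr (1 / dW)) x y)\<^sup>2 \<le> wt (s powr (1 / dW)) x y"
    using wt_nonneg[of "s powr (1 / dW)" x y] wt_le_1[of "s powr (1 / dW)" x y] s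
    by (simp add: power2_eq_square mult_left_le)
  then have "c3 * s powr (- dH / dW) * (wt (s powr (1 / dW)) x y)\<^sup>2 \<le> c3 * s powr (- dH / dW) * wt (s powr (1 / dW)) x y"
    using c3_pos by (intro mult_left_mono) auto
  then show ?thesis using p_upper[OF s, of x y] by simp
qed

lemma p_upper_const: "p s x y \<le> c3 * s powr (- dH / dW)"
proof (cases "0 < s")
  case True
  have "c3 * s powr (- dH / dW) * wt (s powr (1 / dW)) x y \<le> c3 * s powr (- dH / dW) * 1"
    using wt_le_1[of "s powr (1 / dW)" x y] True c3_pos by (intro mult_left_mono) auto
  then show ?thesis using p_upper_wt[OF True, of x y] by simp
next
  case False
  then show ?thesis using c3_pos by (simp add: p_zero)
qed

lemma p_abs_upper: "\<bar>p s x y\<bar> \<le> c3 * s powr (- dH / dW)"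
  using p_upper_const p_nonneg by simp

definition K_p :: real where "K_p = c3 * K_wt"

lemma K_p_pos: "0 < K_p"
  using c3_pos K_wt_pos by (simp add: K_p_def)

lemma p_integrable: "integrable M (p s x)"
proof (cases "0 < s")
  case True
  show ?thesis
  proof (rule Bochner_Integration.integrable_bound)
    show "integrable M (\<lambda>y. c3 * s powr (- dH / dW) * wt (s powr (1 / dW)) x y)"
      using True by (intro integrable_mult_right integrable_wt) auto
    show "AE y in M. norm (p s x y) \<le> norm (c3 * s powr (- dH / dW) * wt (s powr (1 / dW)) x y)"
      using p_upper_wt[OF True] p_nonneg by (auto intro!: AE_I2 order_trans[OF p_upper_wt[OF True]])
  qed simp
next
  case False
  then show ?thesis by (simp add: p_zero_fun not_less)
qed

lemma scale_cancel: "0 < s \<Longrightarrow> s powr (- dH / dW) * (s powr (1 / dW)) powr dH = 1"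
  by (simp add: powr_powr powr_add[symmetric])

lemma p_mass: "(LINT y|M. p s x y) \<le> K_p"
proof (cases "0 < s")
  case True
  have "(LINT y|M. p s x y) \<le> (LINT y|M. c3 * s powr (- dH / dW) * wt (s powr (1 / dW)) x y)"
    using True by (intro integral_mono p_integrable integrable_mult_right integrable_wt p_upper_wt) auto
  also have "\<dots> = c3 * s powr (- dH / dW) * (LINT y|M. wt (s powr (1 / dW)) x y)"
    by simp
  also have "\<dots> \<le> c3 * s powr (- dH / dW) * (K_wt * (s powr (1 / dW)) powr dH)"
    using True c3_pos by (intro mult_left_mono integral_wt) auto
  also have "\<dots> = K_p * (s powr (- dH / dW) * (s powr (1 / dW)) powr dH)"
    by (simp add: K_p_def)
  finally show ?thesis
    by (simp only: scale_cancel[OF True] mult_1_right)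
next
  case False
  then show ?thesis using K_p_pos by (simp add: p_zero_fun not_less)
qed

lemma p_mult_integrable:
  assumes g [measurable]: "g \<in> borel_measurable M" and "\<And>y. \<bar>g y\<bar> \<le> B"
  shows "integrable M (\<lambda>y. p s x y * g y)"
proof (rule Bochner_Integration.integrable_bound)
  show "integrable M (\<lambda>y. p s x y * B)"
    using p_integrable by auto
  have "\<bar>g y\<bar> \<le> \<bar>B\<bar>" for y
    using assms(2)[of y] by linarith
  then show "AE y in M. norm (p s x y * g y) \<le> norm (p s x y * B)"
    by (auto simp: abs_mult intro!: mult_left_mono)
qed measurable

lemma P_abs_integral_le:
  assumes g: "g \<in> borel_measurable M" and B: "\<And>y. \<bar>g y\<bar> \<le> B"
  shows "(LINT y|M. \<bar>p s x y * g y\<bar>) \<le> K_p * B"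
proof -
  have B0: "0 \<le> B" using B by (meson abs_ge_zero order_trans)
  have "(LINT y|M. \<bar>p s x y * g y\<bar>) \<le> (LINT y|M. p s x y * B)"
  proof (rule integral_mono)
    show "integrable M (\<lambda>y. \<bar>p s x y * g y\<bar>)" using p_mult_integrable[OF g B] by auto
    show "integrable M (\<lambda>y. p s x y * B)" using p_integrable by auto
    show "\<bar>p s x y * g y\<bar> \<le> p s x y * B" for y
      using p_nonneg B by (simp add: abs_mult mult_left_mono)
  qed
  also have "\<dots> = (LINT y|M. p s x y) * B" by simp
  also have "\<dots> \<le> K_p * B" using p_mass B0 by (intro mult_right_mono)
  finally show ?thesis .
qed

lemma P_bound:
  assumes g: "g \<in> borel_measurable M" and B: "\<And>y. \<bar>g y\<bar> \<le> B"
  shows "\<bar>P s g x\<bar> \<le> K_p * B"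
  unfolding kernel_op_def using integral_abs_bound P_abs_integral_le[OF assms] by (rule order_trans)

text \<open>Dominated convergence: once the centre is within s^(1/dW) of its limit,
  \<open>wt_shift\<close> provides one integrable majorant.\<close>

lemma P_continuous:
  assumes g: "g \<in> borel_measurable M" and B: "\<And>y. \<bar>g y\<bar> \<le> B"
  shows "continuous_on UNIV (P s g)"
proof (cases "0 < s")
  case s: True
  define r where "r = s powr (1 / dW)"
  have r: "0 < r" using s by (simp add: r_def)
  have B0: "0 \<le> B" using B by (meson abs_ge_zero order_trans)
  define w where "w x y = c3 * s powr (- dH / dW) * (2 powr (dH + 1) * wt r x y) * B" for x y
  show ?thesis
  proof (rule continuous_on_sequentiallyI)
    fix v :: "nat \<Rightarrow> 'a" and x assume v: "v \<longlonglongrightarrow> x"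
    obtain N where N: "\<And>n. n \<ge> N \<Longrightarrow> dist (v n) x < r"
      using metric_LIMSEQ_D[OF v r] by blast
    have "(\<lambda>n. LINT y|M. p s (v (n + N)) y * g y) \<longlonglongrightarrow> (LINT y|M. p s x y * g y)"
    proof (rule integral_dominated_convergence)
      show "integrable M (w x)"
        unfolding w_def using integrable_wt[OF r] by (intro integrable_mult_left integrable_mult_right)
      show "(\<lambda>y. p s x y * g y) \<in> borel_measurable M" "\<And>n. (\<lambda>y. p s (v (n + N)) y * g y) \<in> borel_measurable M"
        using g by measurable
      have "(\<lambda>n. p s (v (n + N)) y) \<longlonglongrightarrow> p s x y" for y
        using p_cont_left[of s y]
        by (rule continuous_on_tendsto_compose[OF _ LIMSEQ_ignore_initial_segment[OF v]]) auto
      then show "AE y in M. (\<lambda>n. p s (v (n + N)) y * g y) \<longlonglongrightarrow> p s x y * g y"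
        by (intro AE_I2 tendsto_mult_right)
      show "AE y in M. norm (p s (v (n + N)) y * g y) \<le> w x y" for n
      proof (rule AE_I2)
        fix y
        have "wt r (v (n + N)) y \<le> 2 powr (dH + 1) * wt r x y"
          using N[of "n + N"] r by (intro wt_shift) (auto simp: dist_commute less_imp_le)
        then have "p s (v (n + N)) y \<le> c3 * s powr (- dH / dW) * (2 powr (dH + 1) * wt r x y)"
          using p_upper_wt[OF s, of "v (n + N)" y] c3_pos unfolding r_def
          by (elim order_trans) (intro mult_left_mono, auto)
        then have "p s (v (n + N)) y * \<bar>g y\<bar> \<le> w x y"
          unfolding w_def using B[of y] p_nonneg[of s "v (n + N)" y] by (intro mult_mono) auto
        then show "norm (p s (v (n + N)) y * g y) \<le> w x y"
          using p_nonneg by (simp add: abs_mult)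
      qed
    qed
    then show "(\<lambda>n. P s g (v n)) \<longlonglongrightarrow> P s g x"
      unfolding kernel_op_def by (rule LIMSEQ_offset)
  qed
next
  case False
  then show ?thesis by (simp add: kernel_op_def p_zero not_less)
qed

lemma P_measurable [measurable]:
  assumes [measurable]: "g \<in> borel_measurable M"
  shows "P s g \<in> borel_measurable M"
proof -
  have "(\<lambda>(x, y). p s x y * g y) \<in> borel_measurable (M \<Otimes>\<^sub>M M)"
    using p_measurable2[of s] by (simp add: case_prod_beta)
  then show ?thesis
    unfolding kernel_op_def by (rule borel_measurable_lebesgue_integral)
qed

lemma P_compose:
  assumes g [measurable]: "g \<in> borel_measurable M" and B: "\<And>y. \<bar>g y\<bar> \<le> B"
  shows "P s (P t g) x = (LINT y|M. (LINT z|M. p s x z * p t z y) * g y)"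
proof -
  interpret pair_sigma_finite M M ..
  define H where "H = (\<lambda>(z, y). p s x z * (p t z y * g y))"
  have Hm: "H \<in> borel_measurable (M \<Otimes>\<^sub>M M)"
    unfolding H_def using p_measurable2[of t] by (simp add: case_prod_beta')
  have gabs: "(\<lambda>y. \<bar>g y\<bar>) \<in> borel_measurable M" "\<And>y. \<bar>\<bar>g y\<bar>\<bar> \<le> B" using B by auto
  have H: "integrable (M \<Otimes>\<^sub>M M) H"
  proof (rule Fubini_integrable[OF Hm])
    have "(LINT y|M. norm (H (z, y))) = p s x z * P t (\<lambda>y. \<bar>g y\<bar>) z" for z
      using p_nonneg by (simp add: H_def kernel_op_def abs_mult)
    then show "integrable M (\<lambda>z. LINT y|M. norm (H (z, y)))"
      using p_mult_integrable[OF P_measurable[OF gabs(1)] P_bound[OF gabs], of s x t] by simp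
    show "AE z in M. integrable M (\<lambda>y. H (z, y))"
      using p_mult_integrable[OF g B] by (simp add: H_def)
  qed
  have "P s (P t g) x = (LINT z|M. LINT y|M. H (z, y))"
    by (simp add: H_def kernel_op_def)
  also have "\<dots> = (LINT y|M. LINT z|M. H (z, y))"
    by (rule Fubini_integral[symmetric]) (simp add: H)
  also have "\<dots> = (LINT y|M. (LINT z|M. p s x z * p t z y) * g y)"
    by (simp add: H_def mult.assoc[symmetric])
  finally show ?thesis .
qed

text \<open>The variables are freed one at a time. Operator symmetry on two balls and continuity in
  \<open>x\<close> first give \<open>swap\<close>, where one ball has become a point; varying the
  remaining ball frees the second variable.\<close>

lemma p_sym_of_balls:
  assumes t: "0 < t"
    and balls: "\<And>a r b q. (LINT x|M. P t (indicator (ball a r)) x * indicator (ball b q) x)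
      = (LINT x|M. indicator (ball a r) x * P t (indicator (ball b q)) x)"
  shows "p t x y = p t y x"
proof -
  interpret pair_sigma_finite M M ..
  let ?C = "c3 * t powr (- dH / dW)"
  have ind: "indicator (ball a r) \<in> borel_measurable M" "\<And>y. \<bar>indicator (ball a r) y\<bar> \<le> (1::real)" for a r
    by (auto simp: indicator_def simp del: mem_ball)
  have C0: "0 \<le> ?C" using c3_pos by simp
  have swap: "P t (indicator (ball a r)) x = (LINT y|M. p t y x * indicator (ball a r) y)" for a r x
  proof (rule eq_of_ball_integrals[where f = "P t (indicator (ball a r))" and x = x
        and g = "\<lambda>x. LINT y|M. p t y x * indicator (ball a r) y"
        and B = "max (K_p * 1) (c3 * t powr (- dH / dW) * measure M (ball a r))"])
    let ?h = "\<lambda>x. LINT y|M. p t y x * indicator (ball a r) y"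
    let ?m = "?C * measure M (ball a r)"
    show "continuous_on UNIV (P t (indicator (ball a r)))"
      by (rule P_continuous[OF ind])
    show "continuous_on UNIV ?h"
    proof (rule continuous_on_sequentiallyI)
      fix v :: "nat \<Rightarrow> 'a" and x assume v: "v \<longlonglongrightarrow> x"
      show "(\<lambda>n. ?h (v n)) \<longlonglongrightarrow> ?h x"
      proof (rule integral_dominated_convergence)
        show "integrable M (\<lambda>y. ?C * indicator (ball a r) y)"
          using integrable_indicator_ball by (intro integrable_mult_right)
        show "(\<lambda>y. p t y x * indicator (ball a r) y) \<in> borel_measurable M"
          "\<And>n. (\<lambda>y. p t y (v n) * indicator (ball a r) y) \<in> borel_measurable M"
          by (intro borel_measurable_times continuous_measurable p_cont_left ind)+
        show "AE y in M. (\<lambda>n. p t y (v n) * indicator (ball a r) y) \<longlonglongrightarrow> p t y x * indicator (ball a r) y"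
          by (intro AE_I2 tendsto_mult_right continuous_on_tendsto_compose[OF p_cont_right v]) auto
        show "AE y in M. norm (p t y (v n) * indicator (ball a r) y) \<le> ?C * indicator (ball a r) y" for n
          using p_abs_upper by (auto simp: abs_mult intro!: AE_I2 mult_right_mono)
      qed
    qed
    show "\<bar>P t (indicator (ball a r)) x\<bar> \<le> max (K_p * 1) ?m" for x
      using P_bound[OF ind, of t a r x] by simp
    show "\<bar>?h x\<bar> \<le> max (K_p * 1) ?m" for x
    proof -
      have "\<bar>?h x\<bar> \<le> (LINT y|M. \<bar>p t y x * indicator (ball a r) y\<bar>)"
        by (rule integral_abs_bound)
      also have "\<dots> \<le> (LINT y|M. ?C * indicator (ball a r) y)"
      proof (rule integral_mono)
        show "integrable M (\<lambda>y. \<bar>p t y x * indicator (ball a r) y\<bar>)"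
          by (intro integrable_abs continuous_integrable_on_ball[OF _ p_abs_upper] continuous_measurable p_cont_left)
        show "integrable M (\<lambda>y. ?C * indicator (ball a r) y)"
          using integrable_indicator_ball by (intro integrable_mult_right)
        show "\<bar>p t y x * indicator (ball a r) y\<bar> \<le> ?C * indicator (ball a r) y" for y
          using p_abs_upper by (auto simp: abs_mult intro!: mult_right_mono)
      qed
      finally show ?thesis by simp
    qed
    fix b :: 'a and q :: real assume "0 < q"
    define H where "H = (\<lambda>(y, x). p t y x * (indicator (ball b q) x * indicator (ball a r) y))"
    have Hm: "H \<in> borel_measurable (M \<Otimes>\<^sub>M M)"
      unfolding H_def using p_measurable2[of t] by (simp add: case_prod_beta')
    have inner: "(LINT x|M. H (y, x)) = P t (indicator (ball b q)) y * indicator (ball a r) y" for y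
      by (simp add: H_def kernel_op_def mult.assoc[symmetric])
    have H: "integrable (M \<Otimes>\<^sub>M M) H"
    proof (rule Fubini_integrable[OF Hm])
      have "norm (H (y, x)) = H (y, x)" for y x using p_nonneg by (simp add: H_def)
      then show "integrable M (\<lambda>y. LINT x|M. norm (H (y, x)))"
        unfolding inner by (simp only: inner) (rule continuous_integrable_on_ball[OF P_measurable[OF ind(1)] P_bound[OF ind]])
      have "integrable M (\<lambda>x. p t y x * indicator (ball b q) x * indicator (ball a r) y)" for y
        by (intro integrable_mult_left p_mult_integrable[OF ind])
      then show "AE y in M. integrable M (\<lambda>x. H (y, x))"
        by (simp add: H_def mult.assoc)
    qed
    have "(LINT x|M. P t (indicator (ball a r)) x * indicator (ball b q) x)
        = (LINT y|M. LINT x|M. H (y, x))"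
      unfolding inner by (subst balls) (simp only: mult.commute)
    also have "\<dots> = (LINT x|M. LINT y|M. H (y, x))"
      by (rule Fubini_integral[symmetric]) (simp add: H)
    also have "\<dots> = (LINT x|M. ?h x * indicator (ball b q) x)"
    proof (intro Bochner_Integration.integral_cong refl)
      fix x
      have "(LINT y|M. H (y, x)) = (LINT y|M. p t y x * indicator (ball a r) y * indicator (ball b q) x)"
        by (intro Bochner_Integration.integral_cong refl) (simp add: H_def)
      then show "(LINT y|M. H (y, x)) = ?h x * indicator (ball b q) x" by simp
    qed
    finally show "(LINT x|M. P t (indicator (ball a r)) x * indicator (ball b q) x) = (LINT x|M. ?h x * indicator (ball b q) x)" .
  qed
  show ?thesis
  proof (rule eq_of_ball_integrals[OF p_cont_right p_cont_left])
    show "\<bar>p t x z\<bar> \<le> ?C" "\<bar>p t z x\<bar> \<le> ?C" for z by (rule p_abs_upper)+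
    show "(LINT z|M. p t x z * indicator (ball a r) z) = (LINT z|M. p t z x * indicator (ball a r) z)" for a r
      using swap[of a r x] by (simp add: kernel_op_def)
  qed
qed

text \<open>By symmetry the left side is P_t applied to p_s(x,.), hence continuous in
  \<open>y\<close>. Integrating both sides over balls in \<open>y\<close> reduces the claim to the
  semigroup law, which continuity in \<open>x\<close> makes pointwise.\<close>

lemma chapman_kolmogorov_of_balls:
  assumes st: "0 < s" "0 < t" and sym: "\<And>x y. p t x y = p t y x"
    and balls: "\<And>a r. AE x in M. P (s + t) (indicator (ball a r)) x = P s (P t (indicator (ball a r))) x"
  shows "(LINT z|M. p s x z * p t z y) = p (s + t) x y"
proof -
  have ind: "indicator (ball a r) \<in> borel_measurable M" "\<And>y. \<bar>indicator (ball a r) y\<bar> \<le> (1::real)" for a r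
    by (auto simp: indicator_def simp del: mem_ball)
  let ?C = "c3 * s powr (- dH / dW)" and ?D = "c3 * (s + t) powr (- dH / dW)"
  have q: "(LINT z|M. p s x z * p t z y) = P t (p s x) y" for y
    unfolding kernel_op_def using sym[of y] by (simp add: mult.commute)
  show ?thesis
  proof (rule eq_of_ball_integrals[where f = "\<lambda>y. LINT z|M. p s x z * p t z y" and g = "p (s + t) x" and x = y])
    show "continuous_on UNIV (\<lambda>y. LINT z|M. p s x z * p t z y)"
      unfolding q by (rule P_continuous[OF p_measurable p_abs_upper])
    show "continuous_on UNIV (\<lambda>y. p (s + t) x y)" by (rule p_cont_right)
    show "\<bar>LINT z|M. p s x z * p t z y\<bar> \<le> max (K_p * ?C) ?D" for y
      unfolding q using P_bound[OF p_measurable p_abs_upper, of t s x y] by simp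
    show "\<bar>p (s + t) x y\<bar> \<le> max (K_p * ?C) ?D" for y
      using p_abs_upper[of "s + t" x y] by simp
    fix a :: 'a and r :: real assume "0 < r"
    have "P (s + t) (indicator (ball a r)) x = P s (P t (indicator (ball a r))) x"
      by (rule AE_eq_continuous[OF P_continuous[OF ind] P_continuous[OF P_measurable[OF ind(1)] P_bound[OF ind]] balls])
    then show "(LINT y|M. (LINT z|M. p s x z * p t z y) * indicator (ball a r) y) = (LINT y|M. p (s + t) x y * indicator (ball a r) y)"
      unfolding P_compose[OF ind] by (simp add: kernel_op_def)
  qed
qed

end

locale heat_kernel_space = heat_kernel_bounds M dH c1 c2 p dW c3
  for M :: "'a::metric_space measure" and dH c1 c2 :: real and p dW c3 +
  fixes c5 :: real
  assumes c5_pos: "0 < c5"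
    and p_sym: "p s x y = p s y x"
    and p_lower: "0 < s \<Longrightarrow> dist x y \<le> 4 * s powr (1 / dW) \<Longrightarrow> c5 * s powr (- dH / dW) \<le> p s x y"
    and chapman_kolmogorov: "0 < s \<Longrightarrow> 0 < t \<Longrightarrow> (LINT z|M. p s x z * p t z y) = p (s + t) x y"
    and contraction: "0 < s \<Longrightarrow> f \<in> L2_fun M \<Longrightarrow> (LINT x|M. (kernel_op M p s f x)\<^sup>2) \<le> (LINT x|M. (f x)\<^sup>2)"
begin

section \<open>Complete monotonicity in time and its consequences\<close>

lemma p_prod_integrable: "integrable M (\<lambda>z. p s x z * p t y z)"
  by (rule p_mult_integrable[OF p_measurable p_abs_upper])

lemma p_prod_integral: "0 < s \<Longrightarrow> 0 < t \<Longrightarrow> (LINT z|M. p s x z * p t y z) = p (s + t) x y"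
  using chapman_kolmogorov[of s t x y] by (simp add: p_sym[of t _ y])

definition comb :: "real \<Rightarrow> 'a \<Rightarrow> 'a \<Rightarrow> real \<Rightarrow> 'a \<Rightarrow> real" where
  "comb e x y s z = p s x z + e * p s y z"

text \<open>\<open>\<psi> e x y s\<close> is the squared \<open>L\<^sup>2\<close> norm of \<open>comb e x y (s / 2)\<close>; contraction of the semigroup makes
  it completely monotone in \<open>s\<close>, and \<open>p\<^sub>s(x,y)\<close> is recovered by polarization.\<close>

definition \<psi> :: "real \<Rightarrow> 'a \<Rightarrow> 'a \<Rightarrow> real \<Rightarrow> real" where
  "\<psi> e x y s = p s x x + e\<^sup>2 * p s y y + 2 * e * p s x y"

lemma comb_measurable [measurable]: "comb e x y s \<in> borel_measurable M"
  unfolding comb_def[abs_def] by measurable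

lemma comb_inner:
  "integrable M (\<lambda>z. comb e x y s z * comb e x y t z)"
  "0 < s \<Longrightarrow> 0 < t \<Longrightarrow> (LINT z|M. comb e x y s z * comb e x y t z) = \<psi> e x y (s + t)"
proof -
  have eq: "comb e x y s z * comb e x y t z = p s x z * p t x z + e * (p s x z * p t y z)
      + e * (p s y z * p t x z) + e\<^sup>2 * (p s y z * p t y z)" for z
    by (simp add: comb_def power2_eq_square algebra_simps)
  show "integrable M (\<lambda>z. comb e x y s z * comb e x y t z)"
    unfolding eq using p_prod_integrable by (intro Bochner_Integration.integrable_add integrable_mult_right)
  show "(LINT z|M. comb e x y s z * comb e x y t z) = \<psi> e x y (s + t)" if "0 < s" "0 < t"
    unfolding eq using p_prod_integrable
    by (simp add: p_prod_integral[OF that] \<psi>_def p_sym[of _ y x])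
qed

lemma comb_P: "0 < s \<Longrightarrow> 0 < t \<Longrightarrow> P t (comb e x y s) z = comb e x y (t + s) z"
proof -
  assume st: "0 < s" "0 < t"
  have "P t (comb e x y s) z = (LINT w|M. p t z w * p s x w + e * (p t z w * p s y w))"
    unfolding kernel_op_def comb_def
    by (intro Bochner_Integration.integral_cong) (auto simp: algebra_simps)
  also have "\<dots> = p (t + s) z x + e * p (t + s) z y"
    using p_prod_integrable st by (simp add: p_prod_integral)
  finally show ?thesis by (simp add: comb_def p_sym[of _ z])
qed

lemma comb_diff_inner:
  assumes "0 < s" "0 < t"
  shows "integrable M (\<lambda>z. (comb e x y s z - comb e x y t z)\<^sup>2)"
    and "(LINT z|M. (comb e x y s z - comb e x y t z)\<^sup>2) = \<psi> e x y (2 * s) - 2 * \<psi> e x y (s + t) + \<psi> e x y (2 * t)"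
proof -
  have eq: "(comb e x y s z - comb e x y t z)\<^sup>2
      = comb e x y s z * comb e x y s z - 2 * (comb e x y s z * comb e x y t z) + comb e x y t z * comb e x y t z" for z
    by (simp add: power2_eq_square algebra_simps)
  show "integrable M (\<lambda>z. (comb e x y s z - comb e x y t z)\<^sup>2)"
    unfolding eq using comb_inner(1)
    by (intro Bochner_Integration.integrable_add Bochner_Integration.integrable_diff integrable_mult_right)
  show "(LINT z|M. (comb e x y s z - comb e x y t z)\<^sup>2) = \<psi> e x y (2 * s) - 2 * \<psi> e x y (s + t) + \<psi> e x y (2 * t)"
    unfolding eq using comb_inner(1) assms by (simp add: comb_inner(2))
qed

lemma \<psi>_nonneg: "0 < s \<Longrightarrow> 0 \<le> \<psi> e x y s"
proof -
  assume s: "0 < s"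
  have "0 \<le> (LINT z|M. comb e x y (s / 2) z * comb e x y (s / 2) z)" by simp
  then show ?thesis using s by (simp add: comb_inner(2))
qed

text \<open>\<open>P\<close> over the duration (t - s) / 2 carries \<open>comb\<close> at time s / 2
  to \<open>comb\<close> at time t / 2 and does not increase its L2 norm.\<close>

lemma \<psi>_antimono: "0 < s \<Longrightarrow> s \<le> t \<Longrightarrow> \<psi> e x y t \<le> \<psi> e x y s"
proof -
  assume s: "0 < s" and st: "s \<le> t"
  show ?thesis
  proof (cases "s = t")
    case False
    let ?h = "(t - s) / 2"
    have h: "0 < ?h" using st False by simp
    have "comb e x y (s / 2) \<in> L2_fun M"
      using comb_inner(1)[of e x y "s / 2" "s / 2"] by (simp add: L2_fun_def power2_eq_square)
    from contraction[OF h this]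
    have "(LINT z|M. (comb e x y (?h + s / 2) z)\<^sup>2) \<le> (LINT z|M. (comb e x y (s / 2) z)\<^sup>2)"
      using s h by (simp add: comb_P)
    moreover have "?h + s / 2 = t / 2" by (simp add: field_simps)
    ultimately have "(LINT z|M. comb e x y (t / 2) z * comb e x y (t / 2) z) \<le> (LINT z|M. comb e x y (s / 2) z * comb e x y (s / 2) z)"
      by (simp only: power2_eq_square)
    then show ?thesis using s st by (simp add: comb_inner(2))
  qed simp
qed

lemma \<psi>_convex: "0 < s \<Longrightarrow> 0 \<le> h \<Longrightarrow> 0 \<le> \<psi> e x y s - 2 * \<psi> e x y (s + h) + \<psi> e x y (s + 2 * h)"
proof -
  assume s: "0 < s" and h: "0 \<le> h"
  have "0 \<le> (LINT z|M. (comb e x y (s / 2) z - comb e x y (s / 2 + h) z)\<^sup>2)" by simp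
  then show ?thesis
    using s h by (simp add: comb_diff_inner(2) algebra_simps)
qed

text \<open>The right side is the squared norm of a difference of two values of \<open>comb\<close>;
  the contraction of duration h / 2 shifts the arguments of \<open>\<psi>\<close> by
  \<open>h\<close>.\<close>

lemma \<psi>_third:
  assumes s: "0 < s" and h: "0 < h"
  shows "\<psi> e x y (s + h) - 2 * \<psi> e x y (s + 2 * h) + \<psi> e x y (s + 3 * h) \<le> \<psi> e x y s - 2 * \<psi> e x y (s + h) + \<psi> e x y (s + 2 * h)"
proof -
  let ?f = "\<lambda>z. comb e x y (s / 2) z - comb e x y (s / 2 + h) z"
  have L2: "?f \<in> L2_fun M"
    using comb_diff_inner(1)[of "s / 2" "s / 2 + h" e x y] s h by (simp add: L2_fun_def)
  have int: "integrable M (\<lambda>w. p (h / 2) z w * comb e x y t w)" for z t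
  proof -
    have "p (h / 2) z w * comb e x y t w = p (h / 2) z w * p t x w + e * (p (h / 2) z w * p t y w)" for w
      by (simp add: comb_def algebra_simps)
    then show ?thesis using p_prod_integrable by simp
  qed
  have "P (h / 2) ?f z = comb e x y (s / 2 + h / 2) z - comb e x y (s / 2 + h + h / 2) z" for z
  proof -
    have "P (h / 2) ?f z = P (h / 2) (comb e x y (s / 2)) z - P (h / 2) (comb e x y (s / 2 + h)) z"
      unfolding kernel_op_def using int by (simp add: right_diff_distrib)
    then show ?thesis using s h by (simp add: comb_P add_ac)
  qed
  then have "(LINT z|M. (comb e x y (s / 2 + h / 2) z - comb e x y (s / 2 + h + h / 2) z)\<^sup>2) \<le> (LINT z|M. (?f z)\<^sup>2)"
    using contraction[OF _ L2, of "h / 2"] h by simp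
  then show ?thesis
    using s h by (simp add: comb_diff_inner(2) algebra_simps)
qed

lemma p_polarization: "p s x y = (\<psi> 1 x y s - \<psi> (-1) x y s) / 4"
  by (simp add: \<psi>_def)

text \<open>Monotonicity of \<open>\<psi>\<close> on positive times makes it Borel, polarization
  passes this on to the kernel, and \<open>p_zero\<close> covers the rest of the line.\<close>

lemma p_measurable_time: "(\<lambda>s. p s x y) \<in> borel_measurable borel"
proof -
  have m: "(\<lambda>s. \<psi> e x y s) \<in> borel_measurable (restrict_space borel {0<..})" for e
  proof -
    have "mono_on {0<..} (\<lambda>s. - \<psi> e x y s)"
      using \<psi>_antimono by (auto simp: mono_on_def)
    then have "(\<lambda>s. - \<psi> e x y s) \<in> borel_measurable (restrict_space borel {0<..})"
      by (rule borel_measurable_mono_on_fnc)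
    then show ?thesis
      using borel_measurable_uminus[of "\<lambda>s. - \<psi> e x y s"] by simp
  qed
  have "(\<lambda>s. p s x y) \<in> borel_measurable (restrict_space borel {0<..})"
    unfolding p_polarization[of _ x y] using m by measurable
  then have "(\<lambda>s. if s \<in> {0<..} then p s x y else 0) \<in> borel_measurable borel"
    by (subst measurable_If_restrict_space_iff) (auto simp del: Collect_mem_eq simp: greaterThan_def[symmetric])
  moreover have "(\<lambda>s. if s \<in> {0<..} then p s x y else 0) = (\<lambda>s. p s x y)"
    using p_zero by (auto simp: fun_eq_iff)
  ultimately show ?thesis by simp
qed

lemma p_upper_mono:
  assumes "0 < t" "t \<le> s"
  shows "p s x y \<le> c3 * t powr (- dH / dW)"
proof -
  have "c3 * s powr (- dH / dW) \<le> c3 * t powr (- dH / dW)"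
    using assms c3_pos dH_pos dW_pos by (intro mult_left_mono powr_mono2') auto
  then show ?thesis using p_upper_const[of s x y] by simp
qed

text \<open>\<open>second_difference_le\<close> is applied to samples with step \<open>h\<close>
  whose 2n-th lies at \<open>s\<close> and whose first lies no earlier than t / 2. From n + 1 > t /
  (4h) comes 16 (h/t)^2, and the first sample is at most four times the kernel bound, whence
  64.\<close>

lemma \<psi>_second_difference:
  assumes t: "0 < t" "t \<le> s" and h: "0 < h" and e: "e = 1 \<or> e = - 1"
  shows "\<psi> e x y s - 2 * \<psi> e x y (s + h) + \<psi> e x y (s + 2 * h)
    \<le> 64 * c3 * (t / 2) powr (- dH / dW) * (h / t)\<^sup>2"
proof -
  \<comment> \<open>Going back 2n steps from \<open>s\<close> then uses at most t / 2; n = 0 is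
    allowed.\<close>
  define n where "n = nat \<lfloor>t / (4 * h)\<rfloor>"
  have th: "0 < t / (4 * h)" using t h by simp
  have n: "real n \<le> t / (4 * h)" "t / (4 * h) < real (Suc n)"
  proof -
    have "real n = of_int \<lfloor>t / (4 * h)\<rfloor>" using th unfolding n_def by (simp add: of_nat_nat)
    then show "real n \<le> t / (4 * h)" "t / (4 * h) < real (Suc n)" by linarith+
  qed
  define s0 where "s0 = s - 2 * n * h"
  have nh: "2 * n * h \<le> t / 2" using n(1) h by (simp add: field_simps)
  have s0: "t / 2 \<le> s0" using nh t by (simp add: s0_def)
  then have s0_pos: "0 < s0" using t by simp
  define E where "E k = \<psi> e x y (s0 + real k * h)" for k
  have pos: "0 < s0 + real k * h" for k
    using s0_pos h by (simp add: add_pos_nonneg)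
  have "E (2 * n) - 2 * E (Suc (2 * n)) + E (Suc (Suc (2 * n))) \<le> E 0 / (real (Suc n))\<^sup>2"
  proof (rule second_difference_le)
    fix k
    show "0 \<le> E k" unfolding E_def by (rule \<psi>_nonneg[OF pos])
    show "E (Suc k) \<le> E k"
      unfolding E_def using h by (intro \<psi>_antimono[OF pos]) (simp add: algebra_simps)
    show "0 \<le> E k - 2 * E (Suc k) + E (Suc (Suc k))"
      using \<psi>_convex[OF pos, of h e x y k] h unfolding E_def by (simp add: algebra_simps)
    show "E (Suc k) - 2 * E (Suc (Suc k)) + E (Suc (Suc (Suc k))) \<le> E k - 2 * E (Suc k) + E (Suc (Suc k))"
      using \<psi>_third[OF pos h, of e x y k] unfolding E_def by (simp add: algebra_simps)
  qed
  also have "E (2 * n) - 2 * E (Suc (2 * n)) + E (Suc (Suc (2 * n))) = \<psi> e x y s - 2 * \<psi> e x y (s + h) + \<psi> e x y (s + 2 * h)"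
    unfolding E_def s0_def by (simp add: algebra_simps)
  also have "E 0 / (real (Suc n))\<^sup>2 \<le> E 0 / (t / (4 * h))\<^sup>2"
    using n th s0_pos \<psi>_nonneg[OF s0_pos, of e x y]
    by (intro divide_left_mono power_mono mult_pos_pos) (auto simp: E_def)
  also have "\<dots> = E 0 * 16 * (h / t)\<^sup>2"
    by (simp add: power2_eq_square)
  also have "\<dots> \<le> (4 * (c3 * (t / 2) powr (- dH / dW))) * 16 * (h / t)\<^sup>2"
  proof -
    have "p s0 x' y' \<le> c3 * (t / 2) powr (- dH / dW)" for x' y'
      using p_upper_mono[OF _ s0] t by simp
    from this[of x x] this[of y y] this[of x y] p_nonneg[of s0 x y] e
    have "E 0 \<le> 4 * (c3 * (t / 2) powr (- dH / dW))"
      by (auto simp: E_def \<psi>_def)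
    then show ?thesis by (intro mult_right_mono) auto
  qed
  finally show ?thesis by (simp add: mult_ac)
qed

lemma p_second_difference:
  assumes t: "0 < t" "t \<le> s" and h: "0 < h"
  shows "\<bar>p (s + 2 * h) x y - 2 * p (s + h) x y + p s x y\<bar> \<le> 32 * c3 * (t / 2) powr (- dH / dW) * (h / t)\<^sup>2"
proof -
  have arith: "\<bar>(a2 - b2) / 4 - 2 * ((a1 - b1) / 4) + (a0 - b0) / 4\<bar> \<le> 32 * K"
    if "0 \<le> a0 - 2 * a1 + a2" "a0 - 2 * a1 + a2 \<le> 64 * K" "0 \<le> b0 - 2 * b1 + b2" "b0 - 2 * b1 + b2 \<le> 64 * K"
    for a0 a1 a2 b0 b1 b2 K :: real
    using that unfolding abs_le_iff by (intro conjI; argo)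
  define K where "K = c3 * (t / 2) powr (- dH / dW) * (h / t)\<^sup>2"
  have "\<bar>p (s + 2 * h) x y - 2 * p (s + h) x y + p s x y\<bar> \<le> 32 * K"
    unfolding p_polarization[of _ x y]
  proof (rule arith)
    show "0 \<le> \<psi> 1 x y s - 2 * \<psi> 1 x y (s + h) + \<psi> 1 x y (s + 2 * h)"
      "0 \<le> \<psi> (- 1) x y s - 2 * \<psi> (- 1) x y (s + h) + \<psi> (- 1) x y (s + 2 * h)"
      using t h by (auto intro!: \<psi>_convex)
    show "\<psi> 1 x y s - 2 * \<psi> 1 x y (s + h) + \<psi> 1 x y (s + 2 * h) \<le> 64 * K"
      "\<psi> (- 1) x y s - 2 * \<psi> (- 1) x y (s + h) + \<psi> (- 1) x y (s + 2 * h) \<le> 64 * K"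
      using \<psi>_second_difference[OF t h disjI1[OF refl], of x y] \<psi>_second_difference[OF t h disjI2[OF refl], of x y]
      by (simp_all add: K_def mult.assoc)
  qed
  then show ?thesis by (simp add: K_def mult.assoc)
qed

text \<open>Interpolation between the second difference, quadratic in h / t but without spatial
  decay, and the size of the kernel, which carries the squared weight. The outcome is linear in h /
  t and keeps one power of the weight.\<close>

lemma p_time_difference:
  assumes t: "0 < t" and h: "0 < h" "h \<le> t"
  shows "\<bar>p (t + h) x y - p t x y\<bar> \<le> 66 * c3 * (h / t) * t powr (- dH / dW) * wt ((2 * t) powr (1 / dW)) x y"
proof -
  let ?w = "wt ((2 * t) powr (1 / dW)) x y" and ?T = "t powr (- dH / dW)"
  have w0: "0 < ?w"
    using add_pos_nonneg[OF zero_less_one, of "dist x y / (2 * t) powr (1 / dW)"]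
    unfolding wt_def by (simp only: powr_gt_zero) auto
  have w1: "?w \<le> 1" using t by (intro wt_le_1) auto
  have T: "0 < ?T" using t by simp
  have up: "p s x y \<le> c3 * ?T * ?w\<^sup>2" if s: "t \<le> s" "s \<le> 2 * t" for s
  proof -
    have "wt (s powr (1 / dW)) x y \<le> ?w"
    proof -
      have "s powr (1 / dW) \<le> (2 * t) powr (1 / dW)"
        using s t dW_pos by (intro powr_mono2) auto
      then have "dist x y / (2 * t) powr (1 / dW) \<le> dist x y / s powr (1 / dW)"
        using s t by (intro divide_left_mono) auto
      then show ?thesis
        unfolding wt_def using dH_pos add_pos_nonneg[OF zero_less_one, of "dist x y / (2 * t) powr (1 / dW)"]
        by (intro powr_mono2') auto
    qed
    then have "(wt (s powr (1 / dW)) x y)\<^sup>2 \<le> ?w\<^sup>2"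
      using wt_nonneg by (intro power_mono) auto
    moreover have "s powr (- dH / dW) \<le> ?T"
      using s t dH_pos dW_pos by (intro powr_mono2') auto
    ultimately have "c3 * s powr (- dH / dW) * (wt (s powr (1 / dW)) x y)\<^sup>2 \<le> c3 * ?T * ?w\<^sup>2"
      using c3_pos by (intro mult_mono mult_nonneg_nonneg) auto
    then show ?thesis using p_upper[of s x y] s t by simp
  qed
  show ?thesis
  proof (cases "t * ?w \<le> h")
    \<comment> \<open>Here the size bound alone suffices, since w^2 \<le> w h / t.\<close>
    case True
    have "\<bar>p (t + h) x y - p t x y\<bar> \<le> c3 * ?T * ?w\<^sup>2"
      using up[of t] up[of "t + h"] p_nonneg[of "t + h" x y] p_nonneg[of t x y] t h by (auto simp: abs_le_iff)
    also have "\<dots> = c3 * ?T * ?w * ?w" by (simp add: power2_eq_square)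
    also have "\<dots> \<le> c3 * ?T * ?w * (h / t)"
      using True t w0 c3_pos by (intro mult_left_mono) (auto simp: field_simps)
    also have "\<dots> \<le> 66 * (c3 * ?T * ?w * (h / t))"
    proof -
      have le66: "X \<le> 66 * X" if "0 \<le> X" for X :: real using that by simp
      show ?thesis by (rule le66) (use t h w0 c3_pos in simp)
    qed
    finally show ?thesis by (simp add: mult_ac)
  next
    case False
    \<comment> \<open>This number of steps balances w^2 / n against n (h/t)^2: both become of order
      w h / t, with constants 2 and 64 that add up to 66. It is at least 1 since t w > h, and n h
      \<le> t keeps the endpoint within [t, 2t].\<close>
    define n where "n = nat \<lfloor>t * ?w / h\<rfloor>"
    have q1: "1 < t * ?w / h" using False h by simp
    have n_le: "real n \<le> t * ?w / h" using q1 unfolding n_def by (simp add: of_nat_nat)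
    have n_pos: "0 < n" using q1 unfolding n_def by (simp add: zero_less_nat_eq)
    have n_ge: "t * ?w / h \<le> 2 * real n"
    proof -
      have "t * ?w / h < real n + 1" using q1 unfolding n_def by (simp add: of_nat_nat)
      then show ?thesis using n_pos by linarith
    qed
    have nh: "real n * h \<le> t"
    proof -
      have "real n * h \<le> t * ?w" using n_le h by (simp add: field_simps)
      also have "\<dots> \<le> t" using w1 t by (simp add: mult_left_le)
      finally show ?thesis .
    qed
    define f where "f j = p (t + real j * h) x y" for j
    let ?A = "32 * c3 * (t / 2) powr (- dH / dW) * (h / t)\<^sup>2"
    have "\<bar>f 1 - f 0\<bar> \<le> (c3 * ?T * ?w\<^sup>2) / real n + real n * ?A"
    proof (rule first_difference_le)
      show "\<bar>f (Suc (Suc j)) - 2 * f (Suc j) + f j\<bar> \<le> ?A" for j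
        using p_second_difference[OF t(1) _ h(1), of "t + real j * h" x y] h
        unfolding f_def by (simp add: algebra_simps)
    qed (use n_pos up[of t] up[of "t + real n * h"] p_nonneg nh t h in \<open>auto simp: f_def\<close>)
    also have "(c3 * ?T * ?w\<^sup>2) / real n \<le> (c3 * ?T * ?w\<^sup>2) / (t * ?w / h / 2)"
    proof (rule divide_left_mono)
      show "t * ?w / h / 2 \<le> real n" using n_ge by argo
      show "0 < real n * (t * ?w / h / 2)" using n_pos t w0 h by simp
    qed (use c3_pos in simp)
    also have "\<dots> = 2 * c3 * ?T * ?w * (h / t)"
      using w0 t h by (simp add: field_simps power2_eq_square)
    also have "real n * ?A \<le> (t * ?w / h) * ?A"
      using n_le c3_pos by (intro mult_right_mono) auto
    also have "(t * ?w / h) * ?A \<le> 64 * c3 * ?T * ?w * (h / t)"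
    proof -
      have "(t / 2) powr (- dH / dW) = ?T * 2 powr (dH / dW)"
        using t by (simp add: powr_divide powr_minus field_simps)
      also have "\<dots> \<le> ?T * 2"
        using dH_less_dW dW_pos powr_mono[of "dH / dW" 1 2] by (intro mult_left_mono) auto
      finally have "(t * ?w / h) * ?A \<le> (t * ?w / h) * (32 * c3 * (?T * 2) * (h / t)\<^sup>2)"
        using t w0 h c3_pos by (intro mult_left_mono mult_right_mono) auto
      also have "\<dots> = 64 * c3 * ?T * ?w * (h / t)"
        using t h by (simp add: field_simps power2_eq_square)
      finally show ?thesis .
    qed
    finally show ?thesis by (simp add: f_def mult_ac)
  qed
qed

text \<open>132 = 66 * 2, where 2 bounds the factor 2^(dH/dW) lost by integrating a weight of scale
  (2t)^(1/dW).\<close>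

definition K_time :: real where "K_time = 132 * K_p"

lemma p_time_difference_L1:
  assumes t: "0 < t" and h: "0 < h"
  shows "(LINT y|M. \<bar>p (t + h) x y - p t x y\<bar>) \<le> K_time * (h / t)"
proof (cases "h \<le> t")
  case True
  let ?r = "(2 * t) powr (1 / dW)" and ?c = "66 * c3 * (h / t) * t powr (- dH / dW)"
  have r: "0 < ?r" using t by simp
  have "(LINT y|M. \<bar>p (t + h) x y - p t x y\<bar>) \<le> (LINT y|M. ?c * wt ?r x y)"
    using p_integrable integrable_wt[OF r]
    by (intro integral_mono p_time_difference[OF t h True]) auto
  also have "\<dots> = ?c * (LINT y|M. wt ?r x y)" by simp
  also have "\<dots> \<le> ?c * (K_wt * ?r powr dH)"
    using c3_pos t h by (intro mult_left_mono integral_wt[OF r]) auto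
  also have "\<dots> = 66 * K_p * (h / t) * (t powr (- dH / dW) * ?r powr dH)"
    by (simp add: K_p_def)
  also have "t powr (- dH / dW) * ?r powr dH = 2 powr (dH / dW)"
    using t by (simp add: powr_powr powr_mult powr_minus)
  also have "66 * K_p * (h / t) * 2 powr (dH / dW) \<le> 66 * K_p * (h / t) * 2"
    using dH_less_dW dW_pos powr_mono[of "dH / dW" 1 2] K_p_pos h t by (intro mult_left_mono) auto
  finally show ?thesis by (simp add: K_time_def)
next
  case False
  have "(LINT y|M. \<bar>p (t + h) x y - p t x y\<bar>) \<le> (LINT y|M. p (t + h) x y + p t x y)"
  proof (rule integral_mono)
    show "\<bar>p (t + h) x y - p t x y\<bar> \<le> p (t + h) x y + p t x y" for y
      using p_nonneg[of "t + h" x y] p_nonneg[of t x y] by linarith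
  qed (use p_integrable in auto)
  also have "\<dots> \<le> K_p + K_p"
    using p_mass[of "t + h" x] p_mass[of t x] p_integrable by simp
  also have "\<dots> \<le> K_time * 1"
    using K_p_pos by (simp add: K_time_def)
  also have "\<dots> \<le> K_time * (h / t)"
    using False t K_p_pos by (intro mult_left_mono) (auto simp: K_time_def)
  finally show ?thesis .
qed

section \<open>The Green kernel as a resolvent kernel\<close>

lemma P_semigroup:
  assumes s: "0 < s" "0 < t" and g: "g \<in> borel_measurable M" and B: "\<And>y. \<bar>g y\<bar> \<le> B"
  shows "P s (P t g) x = P (s + t) g x"
  unfolding P_compose[OF g B] by (simp add: chapman_kolmogorov[OF s] kernel_op_def)

text \<open>Division by \<open>l\<close> undoes the normalisation of \<open>expo\<close>: this is
  the integral of e^(-ls) p_s(x,y) over s > 0.\<close>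

definition green :: "real \<Rightarrow> 'a \<Rightarrow> 'a \<Rightarrow> real" where
  "green l x y = (LINT s|expo l. p s x y) / l"

lemma p_measurable_expo [measurable]: "(\<lambda>s. p s x y) \<in> borel_measurable (expo l)"
  using p_measurable_time by (simp add: measurable_cong_sets[OF sets_expo refl])

lemma p_measurable_joint [measurable]: "(\<lambda>(s, y). p s x y) \<in> borel_measurable (expo l \<Otimes>\<^sub>M M)"
  by (rule caratheodory_measurable) (auto intro: p_cont_right)

lemma exponent_gt: "- 1 < - dH / dW"
  using dH_less_dW dW_pos by (simp add: field_simps)

lemma p_time_integrable: "0 < l \<Longrightarrow> integrable (expo l) (\<lambda>s. p s x y)"
proof (rule Bochner_Integration.integrable_bound)
  assume l: "0 < l"
  show "integrable (expo l) (\<lambda>s. c3 * s powr (- dH / dW))"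
    by (intro integrable_mult_right expo_moment(1) l exponent_gt)
  show "AE s in expo l. norm (p s x y) \<le> norm (c3 * s powr (- dH / dW))"
    using p_abs_upper c3_pos by (auto intro!: AE_I2)
qed measurable

text \<open>The spatial integral of the absolute value is bounded uniformly in time and the time
  measure is finite. Taking another kernel for \<open>g\<close> yields the product formulas behind
  the resolvent identity.\<close>

lemma green_fubini:
  assumes l: "0 < l" and g [measurable]: "g \<in> borel_measurable M" and B: "\<And>y. \<bar>g y\<bar> \<le> B"
  shows "integrable (expo l) (\<lambda>s. P s g x)"
    and "integrable M (\<lambda>y. green l x y * g y)"
    and "(LINT y|M. green l x y * g y) = (LINT s|expo l. P s g x) / l"
proof -
  interpret T: prob_space "expo l" by (rule prob_space_expo[OF l])
  interpret pair_sigma_finite "expo l" M ..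
  define H where "H = (\<lambda>(s, y). p s x y * g y)"
  have Hm [measurable]: "H \<in> borel_measurable (expo l \<Otimes>\<^sub>M M)"
    unfolding H_def using p_measurable_joint[of x l] by (simp add: case_prod_beta')
  have H: "integrable (expo l \<Otimes>\<^sub>M M) H"
  proof (rule Fubini_integrable[OF Hm])
    have "(LINT y|M. norm (H (s, y))) \<le> K_p * B" for s
      using P_abs_integral_le[OF g B] by (simp add: H_def)
    then show "integrable (expo l) (\<lambda>s. LINT y|M. norm (H (s, y)))"
      by (intro T.integrable_const_bound[where B = "K_p * B"] AE_I2) auto
    show "AE s in expo l. integrable M (\<lambda>y. H (s, y))"
      using p_mult_integrable[OF g B] by (simp add: H_def)
  qed
  have inner: "(LINT s|expo l. H (s, y)) = l * (green l x y * g y)" for y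
    using l by (simp add: H_def green_def)
  show "integrable (expo l) (\<lambda>s. P s g x)"
    using integrable_fst[of "\<lambda>s y. H (s, y)"] H by (simp add: H_def kernel_op_def)
  have "integrable M (\<lambda>y. l * (green l x y * g y))"
    using integrable_snd[of "\<lambda>s y. H (s, y)"] H inner by simp
  then show "integrable M (\<lambda>y. green l x y * g y)"
    using l by simp
  have "(LINT s|expo l. P s g x) = l * (LINT y|M. green l x y * g y)"
  proof -
    have "(LINT y|M. LINT s|expo l. H (s, y)) = (LINT s|expo l. LINT y|M. H (s, y))"
      by (rule Fubini_integral) (simp add: H)
    moreover have "(LINT y|M. H (s, y)) = P s g x" for s
      by (simp add: H_def kernel_op_def)
    ultimately show ?thesis unfolding inner by simp
  qed
  then show "(LINT y|M. green l x y * g y) = (LINT s|expo l. P s g x) / l"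
    using l by simp
qed

lemma green_continuous: "0 < l \<Longrightarrow> continuous_on UNIV (green l x)"
proof (rule continuous_on_sequentiallyI)
  fix v :: "nat \<Rightarrow> 'a" and y assume l: "0 < l" and v: "v \<longlonglongrightarrow> y"
  have "(\<lambda>n. LINT s|expo l. p s x (v n)) \<longlonglongrightarrow> (LINT s|expo l. p s x y)"
  proof (rule integral_dominated_convergence)
    show "integrable (expo l) (\<lambda>s. c3 * s powr (- dH / dW))"
      by (intro integrable_mult_right expo_moment(1) l exponent_gt)
    show "AE s in expo l. norm (p s x (v n)) \<le> c3 * s powr (- dH / dW)" for n
      using p_abs_upper by (auto intro!: AE_I2)
    show "AE s in expo l. (\<lambda>n. p s x (v n)) \<longlonglongrightarrow> p s x y"
      by (intro AE_I2 continuous_on_tendsto_compose[OF p_cont_right v]) auto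
  qed measurable
  then show "(\<lambda>n. green l x (v n)) \<longlonglongrightarrow> green l x y"
    unfolding green_def using l by (intro tendsto_intros) auto
qed

lemma green_sym: "green l x y = green l y x"
  by (simp add: green_def p_sym[of _ x y])

lemma green_nonneg: "0 < l \<Longrightarrow> 0 \<le> green l x y"
  using p_nonneg by (simp add: green_def)

lemma green_upper: "0 < l \<Longrightarrow> green l x y \<le> c3 * Gamma (1 - dH / dW) * l powr (- (dW - dH) / dW)"
proof -
  assume l: "0 < l"
  have "(LINT s|expo l. p s x y) \<le> (LINT s|expo l. c3 * s powr (- dH / dW))"
    using p_upper_const by (intro integral_mono p_time_integrable integrable_mult_right expo_moment(1) l exponent_gt)
  also have "\<dots> = c3 * Gamma (1 - dH / dW) * l powr (dH / dW)"
    using expo_moment(2)[OF l exponent_gt] by simp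
  finally have "green l x y \<le> c3 * Gamma (1 - dH / dW) * l powr (dH / dW) / l"
    unfolding green_def using l by (intro divide_right_mono) auto
  also have "\<dots> = c3 * Gamma (1 - dH / dW) * (l powr (dH / dW) * l powr (- 1))"
    using l by (simp add: powr_minus field_simps)
  also have "l powr (dH / dW) * l powr (- 1) = l powr (- (dW - dH) / dW)"
    using dW_pos by (simp only: powr_add[symmetric]) (simp add: diff_divide_distrib)
  finally show ?thesis .
qed

text \<open>On this window of length 1 / l the density is at least l e^(-2).\<close>

lemma expo_measure_lower:
  assumes l: "0 < l"
  shows "exp (- 2) \<le> measure (expo l) {1 / l..2 / l}"
proof -
  interpret T: prob_space "expo l" by (rule prob_space_expo[OF l])
  have "ennreal (exp (- 2)) = ennreal (l * exp (- 2)) * emeasure lborel {1 / l..2 / l}"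
    using l by (subst emeasure_lborel_Icc) (auto simp: ennreal_mult[symmetric] field_simps)
  also have "\<dots> = (\<integral>\<^sup>+s. ennreal (l * exp (- 2)) * indicator {1 / l..2 / l} s \<partial>lborel)"
    by (simp add: nn_integral_cmult_indicator)
  also have "\<dots> \<le> (\<integral>\<^sup>+s. ennreal (exponential_density l s) * indicator {1 / l..2 / l} s \<partial>lborel)"
  proof (rule nn_integral_mono)
    fix s :: real
    show "ennreal (l * exp (- 2)) * indicator {1 / l..2 / l} s \<le> ennreal (exponential_density l s) * indicator {1 / l..2 / l} s"
    proof (cases "s \<in> {1 / l..2 / l}")
      case True
      then have "s * l \<le> 2" "0 \<le> s" using l by (auto simp: field_simps intro: order_trans[of 0 "1 / l"])
      then have "l * exp (- 2) \<le> exponential_density l s"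
        using l by (auto simp: exponential_density_def)
      then show ?thesis using True by (simp add: ennreal_leI)
    qed simp
  qed
  also have "\<dots> = emeasure (expo l) {1 / l..2 / l}"
    unfolding expo_def by (subst emeasure_density) auto
  finally show ?thesis
    by (simp add: T.emeasure_eq_measure)
qed

text \<open>Only times in [1/l, 2/l] are kept. There s^(1/dW) is at least l^(-1/dW), so the pair
  lies in the range of \<open>p_lower\<close>.\<close>

lemma green_lower:
  assumes l: "0 < l" and d: "dist x y \<le> 4 * l powr (- 1 / dW)"
  shows "c5 * 2 powr (- dH / dW) * exp (- 2) * l powr (- (dW - dH) / dW) \<le> green l x y"
proof -
  interpret T: prob_space "expo l" by (rule prob_space_expo[OF l])
  let ?I = "{1 / l..2 / l}" and ?c = "c5 * (2 / l) powr (- dH / dW)"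
  have "?c * exp (- 2) \<le> ?c * measure (expo l) ?I"
    using c5_pos expo_measure_lower[OF l] by (intro mult_left_mono) auto
  also have "\<dots> = (LINT s|expo l. ?c * indicator ?I s)"
    by simp
  also have "\<dots> \<le> (LINT s|expo l. p s x y)"
  proof (rule integral_mono)
    show "integrable (expo l) (\<lambda>s. ?c * indicator ?I s)"
      by (intro integrable_mult_right integrable_real_indicator) (auto simp: T.emeasure_eq_measure)
    fix s :: real
    show "?c * indicator ?I s \<le> p s x y"
    proof (cases "s \<in> ?I")
      case True
      then have s: "1 / l \<le> s" "s \<le> 2 / l" by auto
      have s0: "0 < s" using s(1) l by (meson less_le_trans zero_less_divide_1_iff)
      have "l powr (- 1 / dW) = (1 / l) powr (1 / dW)"
        using l by (simp add: powr_divide powr_minus_divide)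
      also have "\<dots> \<le> s powr (1 / dW)"
        using s l dW_pos by (intro powr_mono2) auto
      finally have "c5 * s powr (- dH / dW) \<le> p s x y"
        using d by (intro p_lower[OF s0]) simp
      moreover have "?c \<le> c5 * s powr (- dH / dW)"
        using s s0 c5_pos dH_pos dW_pos by (intro mult_left_mono powr_mono2') auto
      ultimately show ?thesis using True by simp
    qed (use p_nonneg in simp)
  qed (rule p_time_integrable[OF l])
  finally have "?c * exp (- 2) / l \<le> green l x y"
    unfolding green_def using l by (intro divide_right_mono) auto
  also have "?c * exp (- 2) / l = c5 * 2 powr (- dH / dW) * exp (- 2) * (l powr (dH / dW) * l powr (- 1))"
    using l by (simp add: powr_divide powr_minus field_simps)
  also have "l powr (dH / dW) * l powr (- 1) = l powr (- (dW - dH) / dW)"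
    using dW_pos by (simp only: powr_add[symmetric]) (simp add: diff_divide_distrib)
  finally show ?thesis .
qed

lemma green_posdef: "0 < l \<Longrightarrow> 2 * green l x y \<le> green l x x + green l y y"
proof -
  assume l: "0 < l"
  have "2 * p s x y \<le> p s x x + p s y y" for s
    using \<psi>_nonneg[of s "- 1" x y] p_zero[of s] by (cases "0 < s") (auto simp: \<psi>_def)
  then have "(LINT s|expo l. 2 * p s x y) \<le> (LINT s|expo l. p s x x + p s y y)"
    using p_time_integrable[OF l] by (intro integral_mono) auto
  then have "2 * (LINT s|expo l. p s x y) / l \<le> ((LINT s|expo l. p s x x) + (LINT s|expo l. p s y y)) / l"
    using p_time_integrable[OF l] l by (intro divide_right_mono) auto
  then show ?thesis by (simp add: green_def add_divide_distrib)
qed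

text \<open>One of the two weights pays the factor s^(1/dW) / r by \<open>wt_far\<close>, the other
  is integrated.\<close>

lemma P_far:
  assumes s: "0 < s" and r: "0 < r"
  shows "P s (indicator {y. r \<le> dist x y}) x \<le> K_p / r * s powr (1 / dW)"
proof -
  let ?F = "{y. r \<le> dist x y}" and ?R = "s powr (1 / dW)"
  have F [measurable]: "?F \<in> sets M"
    by (auto simp: sets_M intro!: borel_closed closed_Collect_le continuous_intros)
  have R: "0 < ?R" using s by simp
  have "P s (indicator ?F) x \<le> (LINT y|M. c3 * s powr (- dH / dW) * (?R / r) * wt ?R x y)"
    unfolding kernel_op_def
  proof (rule integral_mono)
    show "integrable M (\<lambda>y. p s x y * indicator ?F y)"
      by (rule p_mult_integrable[where B = 1, OF borel_measurable_indicator[OF F]]) (auto simp: indicator_def)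
    show "integrable M (\<lambda>y. c3 * s powr (- dH / dW) * (?R / r) * wt ?R x y)"
      by (intro integrable_mult_right integrable_wt R)
    fix y
    show "p s x y * indicator ?F y \<le> c3 * s powr (- dH / dW) * (?R / r) * wt ?R x y"
    proof (cases "y \<in> ?F")
      case True
      have "p s x y \<le> c3 * s powr (- dH / dW) * (wt ?R x y * wt ?R x y)"
        using p_upper[OF s, of x y] by (simp add: power2_eq_square)
      also have "\<dots> \<le> c3 * s powr (- dH / dW) * (?R / r * wt ?R x y)"
        using wt_far[OF R r, of x y] True wt_nonneg c3_pos by (intro mult_left_mono mult_right_mono) auto
      finally show ?thesis using True by (simp add: mult.assoc)
    next
      case False
      then show ?thesis using c3_pos R r wt_nonneg by simp
    qed
  qed
  also have "\<dots> = c3 * s powr (- dH / dW) * (?R / r) * (LINT y|M. wt ?R x y)"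
    by simp
  also have "\<dots> \<le> c3 * s powr (- dH / dW) * (?R / r) * (K_wt * ?R powr dH)"
    using c3_pos R r by (intro mult_left_mono integral_wt) auto
  also have "\<dots> = K_p / r * ?R * (s powr (- dH / dW) * ?R powr dH)"
    by (simp add: K_p_def)
  finally show ?thesis by (simp only: scale_cancel[OF s] mult_1_right)
qed

text \<open>Averaging \<open>P_far\<close> over an exponential time leaves a multiple of
  l^(-1/dW).\<close>

lemma green_concentration:
  assumes r: "0 < r"
  shows "((\<lambda>l. l * (LINT y|M. green l x y * indicator {y. r \<le> dist x y} y)) \<longlongrightarrow> 0) at_top"
proof (rule tendsto_sandwich[where f = "\<lambda>_. 0" and h = "\<lambda>l. K_p / r * Gamma (1 + 1 / dW) * l powr (- (1 / dW))"])
  let ?F = "{y. r \<le> dist x y}"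
  have F [measurable]: "?F \<in> sets M"
    by (auto simp: sets_M intro!: borel_closed closed_Collect_le continuous_intros)
  show "\<forall>\<^sub>F l in at_top. 0 \<le> l * (LINT y|M. green l x y * indicator ?F y)"
    using eventually_gt_at_top[of 0]
    by eventually_elim (auto intro!: mult_nonneg_nonneg integral_nonneg_AE AE_I2 green_nonneg)
  show "\<forall>\<^sub>F l in at_top. l * (LINT y|M. green l x y * indicator ?F y) \<le> K_p / r * Gamma (1 + 1 / dW) * l powr (- (1 / dW))"
    using eventually_gt_at_top[of 0]
  proof eventually_elim
    fix l :: real assume l: "0 < l"
    have b: "- 1 < 1 / dW" using dW_pos by (meson less_trans minus_less_iff zero_less_divide_1_iff neg_less_0_iff_less zero_less_one)
    have ind: "indicator ?F \<in> borel_measurable M" "\<And>y. \<bar>indicator ?F y\<bar> \<le> (1::real)"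
      by (auto simp: indicator_def)
    have "l * (LINT y|M. green l x y * indicator ?F y) = (LINT s|expo l. P s (indicator ?F) x)"
      using green_fubini(3)[OF l ind, of x] l by simp
    also have "\<dots> \<le> (LINT s|expo l. K_p / r * s powr (1 / dW))"
    proof (rule integral_mono_AE)
      show "AE s in expo l. P s (indicator ?F) x \<le> K_p / r * s powr (1 / dW)"
        using AE_expo_pos by eventually_elim (rule P_far[OF _ r])
    qed (intro green_fubini(1)[OF l ind] integrable_mult_right expo_moment(1)[OF l b])+
    also have "\<dots> = K_p / r * Gamma (1 + 1 / dW) * l powr (- (1 / dW))"
      using expo_moment(2)[OF l b] by simp
    finally show "l * (LINT y|M. green l x y * indicator ?F y) \<le> K_p / r * Gamma (1 + 1 / dW) * l powr (- (1 / dW))" .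
  qed
  have "((\<lambda>l. l powr (- (1 / dW))) \<longlongrightarrow> 0) at_top"
    using dW_pos by (intro tendsto_neg_powr filterlim_ident) auto
  then show "((\<lambda>l. K_p / r * Gamma (1 + 1 / dW) * l powr (- (1 / dW))) \<longlongrightarrow> 0) at_top"
    by (rule tendsto_mult_right_zero)
qed auto

text \<open>Both kernels are Laplace integrals of the same nonnegative function. The extended-real
  form matches the density in \<open>expo_convolution\<close> up to the factor l m / (m -
  l).\<close>

lemma green_difference:
  assumes l: "0 < l" "l < m"
  shows "0 \<le> green l x y - green m x y"
    and "ennreal (green l x y - green m x y) =
    (\<integral>\<^sup>+r. ennreal (p r x y) * ennreal (indicator {0..} r * (exp (- l * r) - exp (- m * r))) \<partial>lborel)"
proof -
  have m: "0 < m" using l by simp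
  note pm = p_measurable_time[of x y]
  have rep: "integrable lborel (\<lambda>s. indicator {0..} s * (exp (- k * s) * p s x y))"
      "green k x y = (LINT s|lborel. indicator {0..} s * (exp (- k * s) * p s x y))" if k: "0 < k" for k
  proof -
    have eq: "exponential_density k s * p s x y = k * (indicator {0..} s * (exp (- k * s) * p s x y))" for s
      by (auto simp: exponential_density_def indicator_def mult.commute)
    have "integrable lborel (\<lambda>s. exponential_density k s * p s x y)"
      using p_time_integrable[OF k, of x y] k pm unfolding expo_def
      by (subst (asm) integrable_density) (auto simp: exponential_density_nonneg)
    then show "integrable lborel (\<lambda>s. indicator {0..} s * (exp (- k * s) * p s x y))"
      unfolding eq using k by simp
    have "(LINT s|expo k. p s x y) = (LINT s|lborel. exponential_density k s * p s x y)"
      using k pm unfolding expo_def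
      by (subst integral_density) (auto simp: exponential_density_nonneg)
    then show "green k x y = (LINT s|lborel. indicator {0..} s * (exp (- k * s) * p s x y))"
      unfolding eq green_def using k by simp
  qed
  have eq: "indicator {0..} s * (exp (- l * s) * p s x y) - indicator {0..} s * (exp (- m * s) * p s x y)
      = p s x y * (indicator {0..} s * (exp (- l * s) - exp (- m * s)))" for s
    by (simp add: algebra_simps)
  have nn: "0 \<le> indicator {0..} s * (exp (- l * s) - exp (- m * s))" for s :: real
    using l by (auto simp: indicator_def mult_right_mono)
  have diff: "green l x y - green m x y = (LINT s|lborel. p s x y * (indicator {0..} s * (exp (- l * s) - exp (- m * s))))"
    unfolding rep(2)[OF l(1)] rep(2)[OF m] using rep(1)[OF l(1)] rep(1)[OF m]
    by (subst Bochner_Integration.integral_diff[symmetric]) (simp_all only: eq)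
  show "0 \<le> green l x y - green m x y"
    unfolding diff using p_nonneg nn by (intro integral_nonneg_AE AE_I2) auto
  note diff
  moreover have "integrable lborel (\<lambda>s. p s x y * (indicator {0..} s * (exp (- l * s) - exp (- m * s))))"
    using Bochner_Integration.integrable_diff[OF rep(1)[OF l(1)] rep(1)[OF m]] by (simp only: eq)
  ultimately have "ennreal (green l x y - green m x y) =
      (\<integral>\<^sup>+s. ennreal (p s x y * (indicator {0..} s * (exp (- l * s) - exp (- m * s)))) \<partial>lborel)"
    using p_nonneg nn by (subst nn_integral_eq_integral) auto
  then show "ennreal (green l x y - green m x y) =
      (\<integral>\<^sup>+r. ennreal (p r x y) * ennreal (indicator {0..} r * (exp (- l * r) - exp (- m * r))) \<partial>lborel)"
    using p_nonneg nn by (simp add: ennreal_mult)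
qed

lemma green_abs_upper: "0 < l \<Longrightarrow> \<bar>green l x y\<bar> \<le> c3 * Gamma (1 - dH / dW) * l powr (- (dW - dH) / dW)"
  using green_upper green_nonneg by simp

lemma green_measurable [measurable]: "0 < l \<Longrightarrow> green l x \<in> borel_measurable M"
  by (intro continuous_measurable green_continuous)

lemma green_integrable: "0 < l \<Longrightarrow> integrable M (green l x)"
  using green_fubini(2)[of l "\<lambda>_. 1" 1 x] by simp

text \<open>By Chapman-Kolmogorov the left side is 1 / (l m) times the mean of p_(S+T)(x,y) for
  independent exponential times of rates \<open>l\<close> and \<open>m\<close>;
  \<open>expo_convolution\<close> and \<open>green_difference\<close> evaluate it.\<close>

lemma green_resolvent:
  assumes l: "0 < l" "l < m"
  shows "(LINT z|M. green l x z * green m z y) = (green l x y - green m x y) / (m - l)"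
proof -
  have m: "0 < m" using l by simp
  have inner: "integrable (expo m) (\<lambda>t. P t (p s x) y)" "P s (green m y) x = (LINT t|expo m. P t (p s x) y) / m" for s
  proof -
    show "integrable (expo m) (\<lambda>t. P t (p s x) y)"
      by (rule green_fubini(1)[OF m p_measurable p_abs_upper])
    have "P s (green m y) x = (LINT z|M. green m y z * p s x z)"
      by (simp add: kernel_op_def mult.commute)
    also have "\<dots> = (LINT t|expo m. P t (p s x) y) / m"
      by (rule green_fubini(3)[OF m p_measurable p_abs_upper])
    finally show "P s (green m y) x = (LINT t|expo m. P t (p s x) y) / m" .
  qed
  have PP: "P t (p s x) y = p (s + t) x y" if "0 < s" "0 < t" for s t
    using chapman_kolmogorov[OF that, of x y] by (simp add: kernel_op_def p_sym[of _ y] mult.commute)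
  have "(LINT z|M. green l x z * green m z y) = (LINT z|M. green l x z * green m y z)"
    using green_sym by simp
  also have "\<dots> = (LINT s|expo l. P s (green m y) x) / l"
    by (rule green_fubini(3)[OF l(1) green_measurable[OF m] green_abs_upper[OF m]])
  finally have lhs: "(LINT z|M. green l x z * green m z y) = (LINT s|expo l. P s (green m y) x) / l" .
  have int: "integrable (expo l) (\<lambda>s. P s (green m y) x)"
    by (rule green_fubini(1)[OF l(1) green_measurable[OF m] green_abs_upper[OF m]])
  have P_nonneg: "0 \<le> P s g z" if "\<And>w. 0 \<le> g w" for s g z
    using that p_nonneg by (simp add: kernel_op_def)
  have "ennreal (LINT s|expo l. P s (green m y) x) = (\<integral>\<^sup>+s. ennreal (P s (green m y) x) \<partial>expo l)"
    using int P_nonneg green_nonneg[OF m] by (subst nn_integral_eq_integral) auto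
  also have "\<dots> = (\<integral>\<^sup>+s. ennreal (1 / m) * (\<integral>\<^sup>+t. ennreal (p (s + t) x y) \<partial>expo m) \<partial>expo l)"
  proof (rule nn_integral_cong_AE)
    show "AE s in expo l. ennreal (P s (green m y) x) = ennreal (1 / m) * (\<integral>\<^sup>+t. ennreal (p (s + t) x y) \<partial>expo m)"
      using AE_expo_pos
    proof eventually_elim
      fix s :: real assume s: "0 < s"
      have "ennreal (P s (green m y) x) = ennreal (1 / m) * ennreal (LINT t|expo m. P t (p s x) y)"
        using m P_nonneg p_nonneg by (subst ennreal_mult[symmetric]) (auto simp: inner(2) intro!: integral_nonneg_AE AE_I2)
      also have "ennreal (LINT t|expo m. P t (p s x) y) = (\<integral>\<^sup>+t. ennreal (P t (p s x) y) \<partial>expo m)"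
        using inner(1) P_nonneg p_nonneg by (subst nn_integral_eq_integral) auto
      also have "\<dots> = (\<integral>\<^sup>+t. ennreal (p (s + t) x y) \<partial>expo m)"
      proof (rule nn_integral_cong_AE)
        show "AE t in expo m. ennreal (P t (p s x) y) = ennreal (p (s + t) x y)"
          using AE_expo_pos by eventually_elim (simp add: PP[OF s])
      qed
      finally show "ennreal (P s (green m y) x) = ennreal (1 / m) * (\<integral>\<^sup>+t. ennreal (p (s + t) x y) \<partial>expo m)" .
    qed
  qed
  also have "\<dots> = ennreal (1 / m) * (\<integral>\<^sup>+s. (\<integral>\<^sup>+t. ennreal (p (s + t) x y) \<partial>expo m) \<partial>expo l)"
  proof (rule nn_integral_cmult)
    interpret T: prob_space "expo m" by (rule prob_space_expo[OF m])
    have "(\<lambda>(s, t). ennreal (p (s + t) x y)) \<in> borel_measurable (expo l \<Otimes>\<^sub>M expo m)"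
      using measurable_compose[OF _ p_measurable_time[of x y], of "\<lambda>z. fst z + snd z" "expo l \<Otimes>\<^sub>M expo m"]
      by (simp add: case_prod_beta')
    then show "(\<lambda>s. \<integral>\<^sup>+t. ennreal (p (s + t) x y) \<partial>expo m) \<in> borel_measurable (expo l)"
      by (rule T.borel_measurable_nn_integral)
  qed
  also have "(\<integral>\<^sup>+s. (\<integral>\<^sup>+t. ennreal (p (s + t) x y) \<partial>expo m) \<partial>expo l) =
      (\<integral>\<^sup>+r. ennreal (p r x y) * ennreal (indicator {0..} r * (l * m / (m - l) * (exp (- l * r) - exp (- m * r)))) \<partial>lborel)"
    using p_measurable_time by (intro expo_convolution[OF l]) simp
  also have "\<dots> = (\<integral>\<^sup>+r. ennreal (l * m / (m - l)) * (ennreal (p r x y) * ennreal (indicator {0..} r * (exp (- l * r) - exp (- m * r)))) \<partial>lborel)"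
  proof (rule nn_integral_cong)
    fix r :: real
    have nn: "0 \<le> indicator {0..} r * (exp (- l * r) - exp (- m * r))"
      using l by (auto simp: indicator_def mult_right_mono)
    have "indicator {0..} r * (l * m / (m - l) * (exp (- l * r) - exp (- m * r)))
        = l * m / (m - l) * (indicator {0..} r * (exp (- l * r) - exp (- m * r)))"
      by simp
    then have "ennreal (indicator {0..} r * (l * m / (m - l) * (exp (- l * r) - exp (- m * r))))
        = ennreal (l * m / (m - l)) * ennreal (indicator {0..} r * (exp (- l * r) - exp (- m * r)))"
      using l m nn by (simp only:) (rule ennreal_mult, auto)
    then show "ennreal (p r x y) * ennreal (indicator {0..} r * (l * m / (m - l) * (exp (- l * r) - exp (- m * r))))
       = ennreal (l * m / (m - l)) * (ennreal (p r x y) * ennreal (indicator {0..} r * (exp (- l * r) - exp (- m * r))))"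
      by (simp only: mult_ac)
  qed
  also have "\<dots> = ennreal (l * m / (m - l)) * ennreal (green l x y - green m x y)"
    unfolding green_difference(2)[OF l] using p_measurable_time[of x y] by (intro nn_integral_cmult) measurable
  finally have eq: "ennreal (LINT s|expo l. P s (green m y) x) =
      ennreal (1 / m) * (ennreal (l * m / (m - l)) * ennreal (green l x y - green m x y))" .
  let ?D = "green l x y - green m x y"
  have "ennreal (LINT s|expo l. P s (green m y) x) = ennreal (1 / m * (l * m / (m - l) * ?D))"
  proof -
    have "ennreal a * (ennreal b * ennreal d) = ennreal (a * (b * d))" if "0 \<le> a" "0 \<le> b" "0 \<le> d" for a b d
      using that by (simp add: ennreal_mult)
    then show ?thesis
      unfolding eq using l m green_difference(1)[OF l, of x y] by simp
  qed
  then have "(LINT s|expo l. P s (green m y) x) = 1 / m * (l * m / (m - l) * ?D)"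
    using l m green_difference(1)[OF l, of x y] P_nonneg green_nonneg[OF m]
    by (subst (asm) ennreal_inj) (auto intro!: integral_nonneg_AE AE_I2)
  also have "1 / m * (l * m / (m - l) * ?D) = l * (?D / (m - l))"
    using m by simp
  finally show ?thesis
    unfolding lhs using l by simp
qed

end

text \<open>\<open>p_mass\<close> yields only the constant \<open>K_p\<close>. The constant 1
  matters for the maximum principle and the jump energy, so it is isolated here, to be supplied by
  the Dirichlet form.\<close>

locale markov_heat_kernel = heat_kernel_space +
  assumes green_mass: "0 < l \<Longrightarrow> l * (LINT y|M. green l x y) \<le> 1"
begin

sublocale resolvent_kernel M dH c1 c2 green dW "c5 * 2 powr (- dH / dW) * exp (- 2)" "c3 * Gamma (1 - dH / dW)"
proof
  show "0 < c3 * Gamma (1 - dH / dW)"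
    using c3_pos exponent_gt by (intro mult_pos_pos Gamma_real_pos) auto
qed (use dH_less_dW c5_pos green_continuous green_sym green_nonneg green_integrable green_mass green_resolvent
    green_upper green_lower green_concentration green_posdef in auto)

text \<open>The generator itself is never applied: a Lipschitz bound in time for P_t g stands in for
  the bound on L P_t g, and Yosida approximations of level m tending to infinity stand in for the
  representation through U_l.\<close>

theorem P_hoelder:
  "\<exists>C>0. \<forall>t>0. \<forall>g\<in>borel_measurable M. \<forall>B. (\<forall>y. \<bar>g y\<bar> \<le> B) \<longrightarrow>
    (\<forall>x y. \<bar>P t g x - P t g y\<bar> \<le> C * (dist x y powr (dW - dH) / t powr ((dW - dH) / dW)) * B)"
proof -
  obtain C where C: "C > 0" "\<And>l x y. l > 0 \<Longrightarrow> (LINT z|M. \<bar>green l x z - green l y z\<bar>) \<le> C * dist x y powr (dW - dH) / l powr (dH / dW)"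
    using u_L1_hoelder by blast
  have K: "0 < K_time" using K_p_pos by (simp add: K_time_def)
  show ?thesis
  proof (intro exI[of _ "(K_time + K_p) * C"] conjI allI impI ballI)
    show "0 < (K_time + K_p) * C" using K K_p_pos C(1) by simp
    fix t :: real and g :: "'a \<Rightarrow> real" and B :: real and x y :: 'a
    assume t: "0 < t" and g [measurable]: "g \<in> borel_measurable M" and "\<forall>y. \<bar>g y\<bar> \<le> B"
    then have B: "\<And>y. \<bar>g y\<bar> \<le> B" by blast
    have B0: "0 \<le> B" using B by (meson abs_ge_zero order_trans)
    define f where "f = P t g"
    define l where "l = 1 / t"
    have l: "0 < l" using t by (simp add: l_def)
    have fm [measurable]: "f \<in> borel_measurable M" by (simp add: f_def)
    have fB: "\<bar>f z\<bar> \<le> K_p * B" for z unfolding f_def by (rule P_bound[OF g B])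
    \<comment> \<open>\<open>K_time\<close> accounts for the time derivative of \<open>f\<close>,
      and \<open>K_p\<close> for l f with l = 1 / t.\<close>
    define N where "N = (K_time + K_p) * B / t"
    have N0: "0 \<le> N" using K K_p_pos B0 t by (simp add: N_def)
    have time: "\<bar>P s f z - f z\<bar> \<le> K_time * B / t * s" if s: "0 < s" for s z
    proof -
      have "P s f z - f z = (LINT w|M. (p (t + s) z w - p t z w) * g w)"
        unfolding f_def using P_semigroup[OF s t g B] p_mult_integrable[OF g B]
        by (simp add: kernel_op_def left_diff_distrib add.commute)
      also have "\<bar>\<dots>\<bar> \<le> (LINT w|M. \<bar>(p (t + s) z w - p t z w) * g w\<bar>)"
        by (rule integral_abs_bound)
      also have "\<dots> \<le> (LINT w|M. \<bar>p (t + s) z w - p t z w\<bar> * B)"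
      proof (rule integral_mono)
        have "integrable M (\<lambda>w. p (t + s) z w * g w - p t z w * g w)"
          using p_mult_integrable[OF g B] by auto
        then show "integrable M (\<lambda>w. \<bar>(p (t + s) z w - p t z w) * g w\<bar>)"
          by (simp add: left_diff_distrib)
        show "integrable M (\<lambda>w. \<bar>p (t + s) z w - p t z w\<bar> * B)"
          using p_integrable by auto
        show "\<bar>(p (t + s) z w - p t z w) * g w\<bar> \<le> \<bar>p (t + s) z w - p t z w\<bar> * B" for w
          using B by (simp add: abs_mult mult_left_mono)
      qed
      also have "\<dots> = (LINT w|M. \<bar>p (t + s) z w - p t z w\<bar>) * B" by simp
      also have "\<dots> \<le> K_time * (s / t) * B"
        using B0 by (intro mult_right_mono p_time_difference_L1 t s)
      finally show ?thesis by (simp add: mult_ac)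
    qed
    \<comment> \<open>The Lipschitz bound in time, averaged over an exponential time of mean 1 /
      m.\<close>
    have res: "\<bar>m * U m f z - f z\<bar> \<le> K_time * B / t / m" if m: "0 < m" for m z
    proof -
      interpret T: prob_space "expo m" by (rule prob_space_expo[OF m])
      have i: "integrable (expo m) (\<lambda>s. P s f z)" by (rule green_fubini(1)[OF m fm fB])
      have "m * U m f z - f z = (LINT s|expo m. P s f z - f z)"
        unfolding U_def using green_fubini(3)[OF m fm fB, of z] m i by (simp add: T.prob_space[simplified])
      also have "\<bar>\<dots>\<bar> \<le> (LINT s|expo m. \<bar>P s f z - f z\<bar>)"
        by (rule integral_abs_bound)
      also have "\<dots> \<le> (LINT s|expo m. K_time * B / t * s powr 1)"
      proof (rule integral_mono_AE)
        show "integrable (expo m) (\<lambda>s. \<bar>P s f z - f z\<bar>)" using i by auto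
        show "integrable (expo m) (\<lambda>s. K_time * B / t * s powr 1)"
          by (intro integrable_mult_right expo_moment(1) m) auto
        show "AE s in expo m. \<bar>P s f z - f z\<bar> \<le> K_time * B / t * s powr 1"
          using AE_expo_pos by eventually_elim (use time in auto)
      qed
      also have "\<dots> = K_time * B / t / m"
        using expo_moment(2)[OF m, of 1] m Gamma_fact[of 1, where 'a = real] by (simp add: powr_minus divide_inverse)
      finally show ?thesis .
    qed
    \<comment> \<open>The resolvent identity writes \<open>(m - l) U\<^sub>m f\<close> as \<open>U\<^sub>l\<close> of a Yosida approximation of \<open>(l - L) f\<close>.\<close>
    have main: "\<bar>(m - l) * U m f x - (m - l) * U m f y\<bar> \<le> N * (C * dist x y powr (dW - dH) / l powr (dH / dW))"
      if lm: "l < m" for m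
    proof -
      have m: "0 < m" using l lm by simp
      define b where "b = m - l"
      have b: "0 < b" using lm by (simp add: b_def)
      define h where "h z = b * (f z - b * U m f z)" for z
      have Um [measurable]: "U m f \<in> borel_measurable M" using m by measurable
      have hm [measurable]: "h \<in> borel_measurable M" unfolding h_def[abs_def] by measurable
      have UB: "\<bar>U m f z\<bar> \<le> K_p * B / m" for z by (rule U_bound[OF m fm fB])
      have hB: "\<bar>h z\<bar> \<le> N" for z
      proof -
        have "f z - b * U m f z = (f z - m * U m f z) + l * U m f z" by (simp add: b_def algebra_simps)
        then have "\<bar>f z - b * U m f z\<bar> \<le> \<bar>f z - m * U m f z\<bar> + l * \<bar>U m f z\<bar>"
          using l abs_triangle_ineq[of "f z - m * U m f z" "l * U m f z"] by (simp add: abs_mult)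
        also have "\<dots> \<le> K_time * B / t / m + l * (K_p * B / m)"
          using res[OF m, of z] UB[of z] l by (intro add_mono mult_left_mono) (auto simp: abs_minus_commute)
        also have "\<dots> = N / m"
          by (simp add: N_def l_def add_divide_distrib distrib_right)
        finally have "\<bar>h z\<bar> \<le> b * (N / m)"
          unfolding h_def using b by (simp add: abs_mult mult_left_mono del: times_divide_eq_right)
        also have "\<dots> \<le> N"
          using b l m N0 unfolding b_def by (simp add: field_simps)
        finally show ?thesis .
      qed
      \<comment> \<open>From b U_l U_m f = U_l f - U_m f: U_l h = b U_l f - b (U_l f - U_m
        f).\<close>
      have rep: "b * U m f z = (LINT w|M. green l z w * h w)" for z
      proof -
        have "(LINT w|M. U m (green l z) w * f w) = (LINT w|M. green l z w * U m f w)"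
          by (rule U_dual(2)[OF m green_integrable[OF l] fm fB])
        also have "(LINT w|M. U m (green l z) w * f w) = (LINT w|M. (green l z w * f w - green m z w * f w) / b)"
          using potential_difference[OF l lm, of 1 z 0 z] by (simp add: b_def left_diff_distrib)
        also have "\<dots> = (U l f z - U m f z) / b"
          using u_mult_integrable[OF l fm fB] u_mult_integrable[OF m fm fB] by (simp add: U_def)
        finally have UU: "b * (LINT w|M. green l z w * U m f w) = U l f z - U m f z"
          using b by (simp add: field_simps)
        have "(LINT w|M. green l z w * h w) = (LINT w|M. b * (green l z w * f w) - b * (b * (green l z w * U m f w)))"
          by (intro Bochner_Integration.integral_cong) (auto simp: h_def algebra_simps)
        also have "\<dots> = b * U l f z - b * (b * (LINT w|M. green l z w * U m f w))"
          using u_mult_integrable[OF l fm fB] u_mult_integrable[OF l Um UB] by (simp add: U_def)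
        also have "\<dots> = b * U m f z" unfolding UU by (simp add: algebra_simps)
        finally show ?thesis by simp
      qed
      have i: "integrable M (\<lambda>w. green l z w * h w)" for z
        by (rule u_mult_integrable[OF l hm hB])
      have "b * U m f x - b * U m f y = (LINT w|M. (green l x w - green l y w) * h w)"
        unfolding rep using i by (simp add: left_diff_distrib)
      also have "\<bar>\<dots>\<bar> \<le> (LINT w|M. \<bar>(green l x w - green l y w) * h w\<bar>)"
        by (rule integral_abs_bound)
      also have "\<dots> \<le> (LINT w|M. N * \<bar>green l x w - green l y w\<bar>)"
      proof (rule integral_mono)
        have "integrable M (\<lambda>w. green l x w * h w - green l y w * h w)"
          using i by (intro Bochner_Integration.integrable_diff)
        then show "integrable M (\<lambda>w. \<bar>(green l x w - green l y w) * h w\<bar>)"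
          by (simp add: left_diff_distrib)
        show "integrable M (\<lambda>w. N * \<bar>green l x w - green l y w\<bar>)"
          using green_integrable[OF l] by auto
        show "\<bar>(green l x w - green l y w) * h w\<bar> \<le> N * \<bar>green l x w - green l y w\<bar>" for w
          using mult_left_mono[OF hB[of w] abs_ge_zero[of "green l x w - green l y w"]]
          by (simp add: abs_mult mult.commute)
      qed
      also have "\<dots> = N * (LINT w|M. \<bar>green l x w - green l y w\<bar>)" by simp
      also have "\<dots> \<le> N * (C * dist x y powr (dW - dH) / l powr (dH / dW))"
        using C(2)[OF l] N0 by (intro mult_left_mono)
      finally show ?thesis by (simp add: b_def)
    qed
    have lim: "((\<lambda>m. (m - l) * U m f z) \<longlongrightarrow> f z) at_top" for z
    proof (rule LIM_zero_cancel, rule Lim_null_comparison)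
      show "\<forall>\<^sub>F m in at_top. norm ((m - l) * U m f z - f z) \<le> N / m"
        using eventually_gt_at_top[of l]
      proof eventually_elim
        fix m assume lm: "l < m"
        then have m: "0 < m" using l by simp
        have "(m - l) * U m f z - f z = (m * U m f z - f z) - l * U m f z" by (simp add: algebra_simps)
        then have "\<bar>(m - l) * U m f z - f z\<bar> \<le> \<bar>m * U m f z - f z\<bar> + l * \<bar>U m f z\<bar>"
          using l abs_triangle_ineq4[of "m * U m f z - f z" "l * U m f z"] by (simp add: abs_mult)
        also have "\<dots> \<le> K_time * B / t / m + l * (K_p * B / m)"
          using res[OF m, of z] U_bound[OF m fm fB, of z] l by (intro add_mono mult_left_mono) auto
        also have "\<dots> = N / m"
          by (simp add: N_def l_def add_divide_distrib distrib_right)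
        finally show "norm ((m - l) * U m f z - f z) \<le> N / m" by simp
      qed
      show "((\<lambda>m. N / m) \<longlongrightarrow> 0) at_top"
        by (rule tendsto_divide_0[OF tendsto_const filterlim_at_top_imp_at_infinity[OF filterlim_ident]])
    qed
    have "((\<lambda>m. \<bar>(m - l) * U m f x - (m - l) * U m f y\<bar>) \<longlongrightarrow> \<bar>f x - f y\<bar>) at_top"
      by (intro tendsto_intros lim)
    then have "\<bar>f x - f y\<bar> \<le> N * (C * dist x y powr (dW - dH) / l powr (dH / dW))"
      by (rule tendsto_upperbound[OF _ eventually_mono[OF eventually_gt_at_top[of l] main]]) auto
    also have "\<dots> = (K_time + K_p) * C * (dist x y powr (dW - dH) * (1 / (t * l powr (dH / dW)))) * B"
      by (simp add: N_def mult_ac)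
    also have "1 / (t * l powr (dH / dW)) = 1 / t powr ((dW - dH) / dW)"
    proof -
      have "t * l powr (dH / dW) = t powr 1 * t powr (- dH / dW)"
        using t by (simp add: l_def powr_divide powr_minus_divide)
      also have "\<dots> = t powr ((dW - dH) / dW)"
        using dW_pos by (simp only: powr_add[symmetric]) (simp add: diff_divide_distrib)
      finally show ?thesis by simp
    qed
    finally show "\<bar>P t g x - P t g y\<bar> \<le> (K_time + K_p) * C * (dist x y powr (dW - dH) / t powr ((dW - dH) / dW)) * B"
      by (simp add: f_def)
  qed
qed

end

section \<open>The Markov property of the resolvent\<close>

text \<open>Given that it exceeds \<open>t\<close>, an exponential time minus \<open>t\<close> is
  again exponential. As a substitution in the density this holds for every Borel \<open>J\<close>,
  integrable or not.\<close>

lemma expo_memoryless: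
  fixes J :: "real \<Rightarrow> real"
  assumes t: "0 \<le> t" and l: "0 < l" and J [measurable]: "J \<in> borel_measurable borel"
  shows "(LINT s|expo l. J (t + s)) = exp (l * t) * (LINT s|expo l. indicator {t..} s * J s)"
proof -
  note [measurable] = borel_measurable_erlang_density
  have "(LINT s|expo l. J (t + s)) = (LINT s|lborel. exponential_density l s * J (t + s))"
    unfolding expo_def using l by (subst integral_density) (auto simp: exponential_density_nonneg)
  also have "\<dots> = (LINT r|lborel. exponential_density l (r - t) * J r)"
    using lborel_integral_real_affine[of 1 "\<lambda>r. exponential_density l (r - t) * J r" t] by simp
  also have "\<dots> = (LINT r|lborel. exp (l * t) * (exponential_density l r * (indicator {t..} r * J r)))"
  proof (intro Bochner_Integration.integral_cong refl)
    fix r :: real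
    show "exponential_density l (r - t) * J r = exp (l * t) * (exponential_density l r * (indicator {t..} r * J r))"
      using t by (auto simp: exponential_density_def indicator_def exp_add[symmetric] algebra_simps)
  qed
  also have "\<dots> = exp (l * t) * (LINT s|expo l. indicator {t..} s * J s)"
    unfolding expo_def using l by (subst integral_density) (auto simp: exponential_density_nonneg)
  finally show ?thesis .
qed

text \<open>Cauchy-Schwarz on \<open>A\<close>, from the nonnegative integral of (f - c)^2 with c
  the mean of \<open>f\<close> on \<open>A\<close>; a null set \<open>A\<close> is treated
  apart.\<close>

lemma square_integral_le:
  fixes f :: "'b \<Rightarrow> real"
  assumes N: "finite_measure N" and A: "A \<in> sets N" and f [measurable]: "f \<in> borel_measurable N"
    and B: "\<And>s. \<bar>f s\<bar> \<le> B"
  shows "(LINT s|N. indicator A s * f s)\<^sup>2 \<le> measure N A * (LINT s|N. indicator A s * (f s)\<^sup>2)"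
proof -
  interpret finite_measure N by (rule N)
  note [measurable] = A
  let ?R = "LINT s|N. indicator A s * f s" and ?q = "measure N A" and ?S = "LINT s|N. indicator A s * (f s)\<^sup>2"
  have B0: "0 \<le> B" using B by (meson abs_ge_zero order_trans)
  have i1: "integrable N (\<lambda>s. indicator A s * f s)"
    using B B0 by (intro integrable_const_bound[where B = B] AE_I2) (auto simp: indicator_def)
  have f2: "(f s)\<^sup>2 \<le> B\<^sup>2" for s
    using B[of s] by (metis abs_ge_zero power2_abs power_mono)
  have i2: "integrable N (\<lambda>s. indicator A s * (f s)\<^sup>2)"
    using f2 by (intro integrable_const_bound[where B = "B\<^sup>2"] AE_I2) (auto simp: indicator_def)
  have i0: "integrable N (indicator A :: 'b \<Rightarrow> real)"
    by (simp add: emeasure_eq_measure)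
  have "0 \<le> ?S - 2 * c * ?R + c\<^sup>2 * ?q" for c
  proof -
    have "0 \<le> (LINT s|N. indicator A s * (f s - c)\<^sup>2)" by simp
    also have "\<dots> = (LINT s|N. indicator A s * (f s)\<^sup>2 - 2 * c * (indicator A s * f s) + c\<^sup>2 * indicator A s)"
      by (intro Bochner_Integration.integral_cong) (auto simp: power2_eq_square algebra_simps)
    also have "\<dots> = ?S - 2 * c * ?R + c\<^sup>2 * ?q"
      using i0 i1 i2 by simp
    finally show ?thesis .
  qed
  note quad = this
  show ?thesis
  proof (cases "?q = 0")
    case True
    have "?R = 0"
    proof (rule ccontr)
      assume R: "?R \<noteq> 0"
      \<comment> \<open>With no quadratic term this choice of c would give 0 \<le> - S - 2.\<close>
      have "0 \<le> ?S - 2 * ((?S + 1) / ?R) * ?R" using quad[of "(?S + 1) / ?R"] True by simp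
      then have "0 \<le> ?S - 2 * (?S + 1)" using R by simp
      moreover have "0 \<le> ?S" by simp
      moreover have "\<not> (0 \<le> S - 2 * (S + 1) \<and> 0 \<le> S)" for S :: real by (simp add: algebra_simps)
      ultimately show False by blast
    qed
    then show ?thesis using True by simp
  next
    case False
    then have q: "0 < ?q" by (simp add: zero_less_measure_iff)
    have "0 \<le> ?S - 2 * (?R / ?q) * ?R + (?R / ?q)\<^sup>2 * ?q" by (rule quad)
    also have "\<dots> = ?S - ?R\<^sup>2 / ?q" using q by (simp add: power2_eq_square field_simps)
    finally show ?thesis using q by (simp add: field_simps)
  qed
qed

lemma L2_norm_eq: "L2_norm M u = sqrt (LINT x|M. (u x)\<^sup>2)"
  by (simp add: L2_norm_def L2_inner_def power2_eq_square)

text \<open>Stands in for Minkowski; the factor 2 is harmless where the right side is shown to tend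
  to zero.\<close>

lemma L2_fun_add_scale:
  assumes u: "u \<in> L2_fun M" and v: "v \<in> L2_fun M"
  shows "(\<lambda>x. a * u x + b * v x) \<in> L2_fun M"
    and "(LINT x|M. (a * u x + b * v x)\<^sup>2) \<le> 2 * a\<^sup>2 * (LINT x|M. (u x)\<^sup>2) + 2 * b\<^sup>2 * (LINT x|M. (v x)\<^sup>2)"
proof -
  have [measurable]: "u \<in> borel_measurable M" "v \<in> borel_measurable M"
    using u v by (auto simp: L2_fun_def)
  have i: "integrable M (\<lambda>x. (u x)\<^sup>2)" "integrable M (\<lambda>x. (v x)\<^sup>2)"
    using u v by (auto simp: L2_fun_def)
  have le: "(a * u x + b * v x)\<^sup>2 \<le> 2 * a\<^sup>2 * (u x)\<^sup>2 + 2 * b\<^sup>2 * (v x)\<^sup>2" for x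
    using zero_le_power2[of "a * u x - b * v x"] by (simp add: power2_eq_square algebra_simps)
  have dom: "integrable M (\<lambda>x. 2 * a\<^sup>2 * (u x)\<^sup>2 + 2 * b\<^sup>2 * (v x)\<^sup>2)"
    using i by (intro Bochner_Integration.integrable_add integrable_mult_right)
  have i2: "integrable M (\<lambda>x. (a * u x + b * v x)\<^sup>2)"
    by (rule Bochner_Integration.integrable_bound[OF dom]) (auto intro!: AE_I2 order_trans[OF le])
  then show "(\<lambda>x. a * u x + b * v x) \<in> L2_fun M"
    by (simp add: L2_fun_def)
  have "(LINT x|M. (a * u x + b * v x)\<^sup>2) \<le> (LINT x|M. 2 * a\<^sup>2 * (u x)\<^sup>2 + 2 * b\<^sup>2 * (v x)\<^sup>2)"
    by (intro integral_mono i2 dom le)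
  also have "\<dots> = 2 * a\<^sup>2 * (LINT x|M. (u x)\<^sup>2) + 2 * b\<^sup>2 * (LINT x|M. (v x)\<^sup>2)"
    using i by simp
  finally show "(LINT x|M. (a * u x + b * v x)\<^sup>2) \<le> 2 * a\<^sup>2 * (LINT x|M. (u x)\<^sup>2) + 2 * b\<^sup>2 * (LINT x|M. (v x)\<^sup>2)" .
qed

context dirichlet_form
begin

lemma E_add_right:
  assumes "u \<in> F" "v \<in> F" "w \<in> F"
  shows "E w (\<lambda>x. u x + v x) = E w u + E w v"
  using E_add[OF assms] E_sym assms F_add by metis

lemma E_scale_right:
  assumes "u \<in> F" "w \<in> F"
  shows "E w (\<lambda>x. a * u x) = a * E w u"
  using E_scale[OF assms] E_sym assms F_scale by metis

text \<open>The clipped function is unchanged when a small multiple of the excess is added back, so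
  the Markov property says that it minimises the energy along that line.\<close>

lemma E_clip_excess:
  assumes u: "u \<in> F"
  defines "c \<equiv> \<lambda>x. min (max (u x) 0) 1"
  defines "w \<equiv> \<lambda>x. u x - c x"
  shows "w \<in> F" and "0 \<le> E u w"
proof -
  have c: "c \<in> F" unfolding c_def using E_markov[OF u] by blast
  have "(\<lambda>x. u x + (- 1) * c x) \<in> F" using F_add[OF u F_scale[OF c]] .
  then show w: "w \<in> F" by (simp add: w_def)
  \<comment> \<open>Every e > 0 works: the excess is negative only where the clip is 0 and positive
    only where it is 1.\<close>
  have quad: "0 \<le> 2 * e * E c w + e\<^sup>2 * E w w" if e: "0 < e" for e
  proof -
    let ?v = "\<lambda>x. c x + e * w x"
    have ew: "(\<lambda>x. e * w x) \<in> F" by (rule F_scale[OF w])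
    have v: "?v \<in> F" by (rule F_add[OF c ew])
    have "(\<lambda>x. min (max (?v x) 0) 1) = c"
    proof
      fix x
      consider "u x < 0" | "0 \<le> u x" "u x \<le> 1" | "1 < u x" by linarith
      then show "min (max (?v x) 0) 1 = c x"
      proof cases
        case 1
        then have "c x = 0" "w x = u x" by (auto simp: c_def w_def)
        then show ?thesis using 1 e by (simp add: max_def mult_le_0_iff)
      next
        case 2
        then have "w x = 0" by (auto simp: c_def w_def)
        then show ?thesis by (simp add: c_def)
      next
        case 3
        then have "c x = 1" "0 < w x" by (auto simp: c_def w_def)
        moreover have "0 < e * w x" using \<open>0 < w x\<close> e by (intro mult_pos_pos)
        ultimately show ?thesis by (simp add: min_def max_def)
      qed
    qed
    then have "E c c \<le> E ?v ?v" using E_markov[OF v] by simp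
    also have "E ?v ?v = E c c + 2 * e * E c w + e\<^sup>2 * E w w"
      using c w ew v by (simp add: E_add E_add_right E_scale E_scale_right E_sym[OF w c] power2_eq_square)
    finally show ?thesis by simp
  qed
  have "0 \<le> E c w"
  proof (rule ccontr)
    assume neg: "\<not> 0 \<le> E c w"
    have Eww: "0 \<le> E w w" by (rule E_nonneg[OF w])
    \<comment> \<open>Small enough that the quadratic term is at most - E c w, leaving a negative
      total; the + 1 covers E w w = 0.\<close>
    define e where "e = - E c w / (E w w + 1)"
    have e: "0 < e" unfolding e_def using neg Eww by (intro divide_pos_pos) auto
    have "0 \<le> e * (2 * E c w + e * E w w)" using quad[OF e] by (simp add: power2_eq_square algebra_simps)
    then have "0 \<le> 2 * E c w + e * E w w" using e by (simp add: zero_le_mult_iff)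
    moreover have "e * E w w \<le> - E c w"
      using neg Eww by (simp add: e_def field_simps)
    ultimately show False using neg by linarith
  qed
  moreover have "E u w = E c w + E w w"
  proof -
    have "u = (\<lambda>x. c x + w x)" by (simp add: w_def)
    then show ?thesis using E_add[OF c w w] by simp
  qed
  ultimately show "0 \<le> E u w" using E_nonneg[OF w] by simp
qed

text \<open>For u = l v with excess \<open>w\<close> over [0,1], the equation makes the integral of
  (u - g) w equal to - E u w / l, which is at most 0 by \<open>E_clip_excess\<close>. Since 0 \<le>
  g \<le> 1, the integrand dominates w^2, so \<open>w\<close> vanishes.\<close>

lemma resolvent_markov:
  assumes l: "0 < l" and gen: "form_generator M E F v (\<lambda>x. l * v x - g x)"
    and g: "g \<in> L2_fun M" "\<And>x. 0 \<le> g x" "\<And>x. g x \<le> 1"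
  shows "AE x in M. l * v x \<le> 1"
proof -
  define u where "u = (\<lambda>x. l * v x)"
  define w where "w = (\<lambda>x. u x - min (max (u x) 0) 1)"
  have v: "v \<in> F" and E_v: "\<And>w. w \<in> F \<Longrightarrow> E v w = - L2_inner M (\<lambda>x. l * v x - g x) w"
    using gen by (auto simp: form_generator_def)
  have u: "u \<in> F" unfolding u_def by (rule F_scale[OF v])
  have w: "w \<in> F" "0 \<le> E u w" using E_clip_excess[OF u] by (simp_all add: w_def)
  have L2: "u \<in> L2_fun M" "w \<in> L2_fun M" using u w F_L2 by auto
  have ug: "(\<lambda>x. 1 * u x + (- 1) * g x) \<in> L2_fun M" by (rule L2_fun_add_scale(1)[OF L2(1) g(1)])
  have [measurable]: "u \<in> borel_measurable M" "w \<in> borel_measurable M" "g \<in> borel_measurable M"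
    using L2 g by (auto simp: L2_fun_def)
  have iw: "integrable M (\<lambda>x. (w x)\<^sup>2)" using L2 by (simp add: L2_fun_def)
  have iug: "integrable M (\<lambda>x. (u x - g x)\<^sup>2)" using ug by (simp add: L2_fun_def)
  have i: "integrable M (\<lambda>x. (u x - g x) * w x)"
  proof (rule Bochner_Integration.integrable_bound)
    show "integrable M (\<lambda>x. (u x - g x)\<^sup>2 + (w x)\<^sup>2)" using iw iug by simp
    show "AE x in M. norm ((u x - g x) * w x) \<le> norm ((u x - g x)\<^sup>2 + (w x)\<^sup>2)"
    proof (rule AE_I2)
      fix x
      have "\<bar>p * q\<bar> \<le> p\<^sup>2 + q\<^sup>2" for p q :: real
        using zero_le_power2[of "\<bar>p\<bar> - \<bar>q\<bar>"] mult_nonneg_nonneg[OF abs_ge_zero[of p] abs_ge_zero[of q]]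
        unfolding power2_diff abs_mult power2_abs by linarith
      then show "norm ((u x - g x) * w x) \<le> norm ((u x - g x)\<^sup>2 + (w x)\<^sup>2)" by simp
    qed
  qed measurable
  have "(w x)\<^sup>2 \<le> (u x - g x) * w x" for x
  proof -
    consider "u x < 0" | "0 \<le> u x" "u x \<le> 1" | "1 < u x" by linarith
    then show ?thesis
    proof cases
      case 1
      then have "w x = u x" by (simp add: w_def)
      then show ?thesis using 1 g(2)[of x] by (simp add: power2_eq_square mult_right_mono_neg)
    next
      case 2
      then show ?thesis by (simp add: w_def)
    next
      case 3
      then have "w x = u x - 1" by (simp add: w_def)
      then show ?thesis using 3 g(3)[of x] by (simp add: power2_eq_square mult_right_mono)
    qed
  qed
  then have "(LINT x|M. (w x)\<^sup>2) \<le> (LINT x|M. (u x - g x) * w x)"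
    by (intro integral_mono iw i)
  also have "\<dots> = - E v w"
    using E_v[OF w(1)] by (simp add: L2_inner_def u_def)
  also have "\<dots> = - (E u w / l)"
    using E_scale[OF v w(1), of l] l by (simp add: u_def)
  also have "\<dots> \<le> 0" using w(2) l by simp
  finally have "(LINT x|M. (w x)\<^sup>2) \<le> 0" .
  then have "(LINT x|M. (w x)\<^sup>2) = 0" by (intro antisym) auto
  then have "AE x in M. (w x)\<^sup>2 = 0"
    by (subst (asm) integral_nonneg_eq_0_iff_AE[OF iw]) auto
  then show ?thesis
    by eventually_elim (auto simp: w_def u_def min_def max_def split: if_splits)
qed

end

section \<open>The time-averaged resolvent and its difference quotients\<close>

context heat_kernel_space
begin

lemma P_measurable_joint:
  assumes l: "0 < l" and g: "g \<in> borel_measurable M" and B: "\<And>y. \<bar>g y\<bar> \<le> B"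
  shows "(\<lambda>(s, y). P s g y) \<in> borel_measurable (expo l \<Otimes>\<^sub>M M)"
proof (rule caratheodory_measurable)
  show "(\<lambda>s. P s g y) \<in> borel_measurable (expo l)" for y
    using green_fubini(1)[OF l g B, of y] by auto
qed (rule P_continuous[OF g B])

text \<open>On bounded functions this is integration against \<open>green\<close>, by
  \<open>green_fubini\<close>; the time average is the form on which the semigroup acts by a
  shift.\<close>

definition V :: "real \<Rightarrow> ('a \<Rightarrow> real) \<Rightarrow> 'a \<Rightarrow> real" where
  "V l g x = (LINT s|expo l. P s g x) / l"

lemma V_continuous:
  assumes l: "0 < l" and g: "g \<in> borel_measurable M" and B: "\<And>y. \<bar>g y\<bar> \<le> B"
  shows "continuous_on UNIV (V l g)"
proof (rule continuous_on_sequentiallyI)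
  interpret T: prob_space "expo l" by (rule prob_space_expo[OF l])
  fix v :: "nat \<Rightarrow> 'a" and y assume v: "v \<longlonglongrightarrow> y"
  have "(\<lambda>n. LINT s|expo l. P s g (v n)) \<longlonglongrightarrow> (LINT s|expo l. P s g y)"
  proof (rule integral_dominated_convergence)
    show "integrable (expo l) (\<lambda>s. K_p * B)" by simp
    show "(\<lambda>s. P s g y) \<in> borel_measurable (expo l)" "\<And>n. (\<lambda>s. P s g (v n)) \<in> borel_measurable (expo l)"
      using green_fubini(1)[OF l g B] by auto
    show "AE s in expo l. norm (P s g (v n)) \<le> K_p * B" for n
      using P_bound[OF g B] by (auto intro!: AE_I2)
    show "AE s in expo l. (\<lambda>n. P s g (v n)) \<longlonglongrightarrow> P s g y"
      by (intro AE_I2 continuous_on_tendsto_compose[OF P_continuous[OF g B] v]) auto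
  qed
  then show "(\<lambda>n. V l g (v n)) \<longlonglongrightarrow> V l g y"
    unfolding V_def using l by (intro tendsto_intros) auto
qed

text \<open>Fubini and the semigroup law shift the exponential time by \<open>t\<close>;
  \<open>expo_memoryless\<close> trades the shift for a restriction to times beyond \<open>t\<close>
  and the factor e^(lt).\<close>

lemma P_V:
  assumes l: "0 < l" and t: "0 < t" and g: "g \<in> borel_measurable M" and B: "\<And>y. \<bar>g y\<bar> \<le> B"
  shows "P t (V l g) x = exp (l * t) / l * (LINT s|expo l. indicator {t..} s * P s g x)"
proof -
  interpret T: prob_space "expo l" by (rule prob_space_expo[OF l])
  interpret pair_sigma_finite "expo l" M ..
  define H where "H = (\<lambda>(s, y). p t x y * P s g y)"
  have Hm: "H \<in> borel_measurable (expo l \<Otimes>\<^sub>M M)"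
    unfolding H_def using P_measurable_joint[OF l g B] p_measurable[of t x] by (simp add: case_prod_beta')
  have H: "integrable (expo l \<Otimes>\<^sub>M M) H"
  proof (rule Fubini_integrable[OF Hm])
    have "(LINT y|M. norm (H (s, y))) \<le> K_p * (K_p * B)" for s
      using P_abs_integral_le[OF P_measurable[OF g] P_bound[OF g B]] by (simp add: H_def)
    then show "integrable (expo l) (\<lambda>s. LINT y|M. norm (H (s, y)))"
      using Hm by (intro T.integrable_const_bound[where B = "K_p * (K_p * B)"] AE_I2) auto
    show "AE s in expo l. integrable M (\<lambda>y. H (s, y))"
      using p_mult_integrable[OF P_measurable[OF g] P_bound[OF g B]] by (simp add: H_def)
  qed
  have "P t (V l g) x = (LINT y|M. LINT s|expo l. H (s, y)) / l"
    by (simp add: kernel_op_def V_def H_def)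
  also have "(LINT y|M. LINT s|expo l. H (s, y)) = (LINT s|expo l. LINT y|M. H (s, y))"
    by (rule Fubini_integral) (simp add: H)
  also have "\<dots> = (LINT s|expo l. P t (P s g) x)"
    by (simp add: H_def kernel_op_def)
  also have "\<dots> = (LINT s|expo l. P (t + s) g x)"
  proof (rule integral_cong_AE)
    have m: "(\<lambda>s. P s g x) \<in> borel_measurable borel"
      using green_fubini(1)[OF l g B, of x] by auto
    then show "(\<lambda>s. P (t + s) g x) \<in> borel_measurable (expo l)"
      using measurable_compose[OF _ m, of "\<lambda>s. t + s" "expo l"] by simp
    have "integrable (expo l) (\<lambda>s. LINT y|M. H (s, y))"
      using integrable_fst[of "\<lambda>s y. H (s, y)"] H by simp
    then show "(\<lambda>s. P t (P s g) x) \<in> borel_measurable (expo l)"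
      by (simp add: H_def kernel_op_def borel_measurable_integrable)
    show "AE s in expo l. P t (P s g) x = P (t + s) g x"
      using AE_expo_pos by eventually_elim (rule P_semigroup[OF t _ g B])
  qed
  also have "\<dots> = exp (l * t) * (LINT s|expo l. indicator {t..} s * P s g x)"
    using t l green_fubini(1)[OF l g B, of x] by (intro expo_memoryless) auto
  finally show ?thesis by simp
qed

text \<open>\<open>contraction\<close> compares Bochner integrals, which are 0 for a non-integrable
  square, so membership needs its own argument: symmetry and the mass bound put P_s g in L1, and a
  bounded L1 function is in L2.\<close>

lemma P_L2:
  assumes s: "0 < s" and g: "g \<in> L2_fun M" and B: "\<And>y. \<bar>g y\<bar> \<le> B" and int: "integrable M g"
  shows "P s g \<in> L2_fun M"
proof -
  have gm: "g \<in> borel_measurable M" using g by (simp add: L2_fun_def)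
  interpret pair_sigma_finite M M ..
  define H where "H = (\<lambda>(x, y). p s x y * \<bar>g x\<bar>)"
  have Hm: "H \<in> borel_measurable (M \<Otimes>\<^sub>M M)"
    unfolding H_def using p_measurable2[of s] gm by (simp add: case_prod_beta')
  have H: "integrable (M \<Otimes>\<^sub>M M) H"
  proof (rule Fubini_integrable[OF Hm])
    have "(LINT y|M. norm (H (x, y))) = \<bar>g x\<bar> * (LINT y|M. p s x y)" for x
      using p_nonneg by (simp add: H_def abs_mult)
    moreover have "integrable M (\<lambda>x. \<bar>g x\<bar> * (LINT y|M. p s x y))"
    proof (rule Bochner_Integration.integrable_bound)
      show "integrable M (\<lambda>x. g x * K_p)" using int by simp
      show "(\<lambda>x. \<bar>g x\<bar> * (LINT y|M. p s x y)) \<in> borel_measurable M"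
        using P_measurable[of "\<lambda>_. 1" s] gm by (simp add: kernel_op_def[abs_def])
      show "AE x in M. norm (\<bar>g x\<bar> * (LINT y|M. p s x y)) \<le> norm (g x * K_p)"
        using p_mass p_nonneg K_p_pos by (auto simp: abs_mult abs_of_nonneg intro!: AE_I2 mult_left_mono)
    qed
    ultimately show "integrable M (\<lambda>x. LINT y|M. norm (H (x, y)))" by simp
    show "AE x in M. integrable M (\<lambda>y. H (x, y))"
      using p_integrable by (simp add: H_def)
  qed
  have "(LINT x|M. H (x, y)) = P s (\<lambda>x. \<bar>g x\<bar>) y" for y
    by (simp add: H_def kernel_op_def p_sym[of s y])
  then have iabs: "integrable M (P s (\<lambda>x. \<bar>g x\<bar>))"
    using integrable_snd[of "\<lambda>x y. H (x, y)"] H by simp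
  have le: "\<bar>P s g y\<bar> \<le> P s (\<lambda>x. \<bar>g x\<bar>) y" for y
    unfolding kernel_op_def using integral_abs_bound[of M "\<lambda>z. p s y z * g z"] p_nonneg by (simp add: abs_mult)
  have "integrable M (P s g)"
    using gm le by (intro Bochner_Integration.integrable_bound[OF iabs]) (auto intro!: AE_I2 order_trans[OF le])
  then have "integrable M (\<lambda>x. P s g x * P s g x)"
    by (rule integrable_mult_bounded[OF _ P_measurable[OF gm] P_bound[OF gm B]])
  then show ?thesis using P_measurable[OF gm] by (simp add: L2_fun_def power2_eq_square)
qed

text \<open>Cauchy-Schwarz in time, then Fubini. One factor of the measure of \<open>A\<close> comes
  from Cauchy-Schwarz, the other from integrating the bound \<open>D\<close> over
  \<open>A\<close>.\<close>

lemma time_average_L2: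
  assumes l: "0 < l" and A: "A \<in> sets borel"
    and meas: "(\<lambda>(s, x). G s x) \<in> borel_measurable (expo l \<Otimes>\<^sub>M M)" and B: "\<And>s x. \<bar>G s x\<bar> \<le> B"
    and L2: "\<And>s. 0 < s \<Longrightarrow> s \<in> A \<Longrightarrow> integrable M (\<lambda>x. (G s x)\<^sup>2)"
    and D: "\<And>s. 0 < s \<Longrightarrow> s \<in> A \<Longrightarrow> (LINT x|M. (G s x)\<^sup>2) \<le> D" and D0: "0 \<le> D"
  shows "(\<lambda>x. LINT s|expo l. indicator A s * G s x) \<in> L2_fun M"
    and "(LINT x|M. (LINT s|expo l. indicator A s * G s x)\<^sup>2) \<le> (measure (expo l) A)\<^sup>2 * D"
proof -
  note M_axioms = sigma_finite_measure_axioms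
  interpret T: prob_space "expo l" by (rule prob_space_expo[OF l])
  interpret pair_sigma_finite "expo l" M ..
  note [measurable] = A
  define H where "H = (\<lambda>(s, x). indicator A s * (G s x)\<^sup>2)"
  let ?R = "\<lambda>x. LINT s|expo l. indicator A s * G s x"
  have Gm: "(\<lambda>s. G s x) \<in> borel_measurable (expo l)" for x
    using measurable_compose[OF measurable_Pair2' meas, of x] by simp
  have Hm: "H \<in> borel_measurable (expo l \<Otimes>\<^sub>M M)"
    unfolding H_def using meas by (simp add: case_prod_beta')
  have H_nonneg: "0 \<le> H z" for z by (simp add: H_def case_prod_beta)
  have HD: "AE s in expo l. (LINT x|M. H (s, x)) \<le> D * indicator A s"
    using AE_expo_pos by eventually_elim (use D in \<open>auto simp: H_def indicator_def\<close>)
  have HM: "(\<lambda>s. LINT x|M. H (s, x)) \<in> borel_measurable (expo l)"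
    using sigma_finite_measure.borel_measurable_lebesgue_integral[OF M_axioms,
        of "\<lambda>s x. H (s, x)" "expo l"] Hm by simp
  have H: "integrable (expo l \<Otimes>\<^sub>M M) H"
  proof (rule Fubini_integrable[OF Hm])
    have "AE s in expo l. norm (LINT x|M. norm (H (s, x))) \<le> D"
      using HD
    proof eventually_elim
      fix s assume "(LINT x|M. H (s, x)) \<le> D * indicator A s"
      also have "\<dots> \<le> D" using D0 by (simp add: indicator_def)
      finally show "norm (LINT x|M. norm (H (s, x))) \<le> D"
        using H_nonneg by (simp add: integral_nonneg_AE)
    qed
    then show "integrable (expo l) (\<lambda>s. LINT x|M. norm (H (s, x)))"
      using HM H_nonneg by (intro T.integrable_const_bound) auto
    show "AE s in expo l. integrable M (\<lambda>x. H (s, x))"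
      using AE_expo_pos by eventually_elim (use L2 in \<open>auto simp: H_def indicator_def\<close>)
  qed
  have inner: "(LINT s|expo l. H (s, x)) = (LINT s|expo l. indicator A s * (G s x)\<^sup>2)" for x
    by (simp add: H_def)
  have cs: "(?R x)\<^sup>2 \<le> measure (expo l) A * (LINT s|expo l. H (s, x))" for x
    unfolding inner
    by (rule square_integral_le[OF _ _ Gm B]) (auto intro: T.finite_measure_axioms)
  have int: "integrable M (\<lambda>x. measure (expo l) A * (LINT s|expo l. H (s, x)))"
    using integrable_snd[of "\<lambda>s x. H (s, x)"] H by simp
  have Rm: "?R \<in> borel_measurable M"
  proof (rule T.borel_measurable_lebesgue_integral)
    have "(\<lambda>(x, s). G s x) \<in> borel_measurable (M \<Otimes>\<^sub>M expo l)"
      using measurable_compose[OF measurable_pair_swap' meas] by (simp add: case_prod_beta')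
    then show "(\<lambda>(x, s). indicator A s * G s x) \<in> borel_measurable (M \<Otimes>\<^sub>M expo l)"
      by (simp add: case_prod_beta')
  qed
  have R2: "integrable M (\<lambda>x. (?R x)\<^sup>2)"
    using Rm by (intro Bochner_Integration.integrable_bound[OF int]) (auto intro!: AE_I2 order_trans[OF cs])
  then show "?R \<in> L2_fun M" using Rm by (simp add: L2_fun_def)
  have "(LINT x|M. (?R x)\<^sup>2) \<le> (LINT x|M. measure (expo l) A * (LINT s|expo l. H (s, x)))"
    by (intro integral_mono R2 int cs)
  also have "\<dots> = measure (expo l) A * (LINT x|M. LINT s|expo l. H (s, x))" by simp
  also have "(LINT x|M. LINT s|expo l. H (s, x)) = (LINT s|expo l. LINT x|M. H (s, x))"
    by (rule Fubini_integral) (simp add: H)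
  also have "measure (expo l) A * \<dots> \<le> measure (expo l) A * (LINT s|expo l. D * indicator A s)"
  proof (intro mult_left_mono integral_mono_AE[OF _ _ HD])
    show "integrable (expo l) (\<lambda>s. LINT x|M. H (s, x))"
      using integrable_fst[of "\<lambda>s x. H (s, x)"] H by simp
    show "integrable (expo l) (\<lambda>s. D * indicator A s)"
      by (intro integrable_mult_right integrable_real_indicator) (auto simp: T.emeasure_eq_measure)
  qed simp
  also have "\<dots> = (measure (expo l) A)\<^sup>2 * D" by (simp add: power2_eq_square)
  finally show "(LINT x|M. (?R x)\<^sup>2) \<le> (measure (expo l) A)\<^sup>2 * D" .
qed

lemma V_L2:
  assumes l: "0 < l" and g: "g \<in> L2_fun M" and B: "\<And>y. \<bar>g y\<bar> \<le> B" and int: "integrable M g"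
  shows "V l g \<in> L2_fun M"
proof -
  have gm: "g \<in> borel_measurable M" using g by (simp add: L2_fun_def)
  have "(\<lambda>x. LINT s|expo l. indicator UNIV s * P s g x) \<in> L2_fun M"
  proof (rule time_average_L2(1)[OF l _ P_measurable_joint[OF l gm B] P_bound[OF gm B]])
    fix s :: real assume s: "0 < s"
    show "integrable M (\<lambda>x. (P s g x)\<^sup>2)" using P_L2[OF s g B int] by (simp add: L2_fun_def)
    show "(LINT x|M. (P s g x)\<^sup>2) \<le> (LINT x|M. (g x)\<^sup>2)" by (rule contraction[OF s g])
  qed auto
  then have "(\<lambda>x. (1 / l) * (LINT s|expo l. P s g x) + 0 * (LINT s|expo l. P s g x)) \<in> L2_fun M"
    by (intro L2_fun_add_scale(1)) auto
  then show ?thesis by (simp add: V_def[abs_def])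
qed

lemma expo_measure_below:
  assumes l: "0 < l" and t: "0 < t"
  shows "measure (expo l) {..<t} = 1 - exp (- l * t)"
proof -
  interpret T: prob_space "expo l" by (rule prob_space_expo[OF l])
  have "1 = exp (l * t) * measure (expo l) {t..}"
    using expo_memoryless[of t l "\<lambda>_. 1"] t l by (simp add: T.prob_space[simplified])
  then have "measure (expo l) {t..} = exp (- l * t)"
    by (simp add: exp_minus field_simps)
  moreover have "measure (expo l) {..<t} = 1 - measure (expo l) {t..}"
    using T.prob_compl[of "{t..}"] by (simp add: Compl_eq_Diff_UNIV[symmetric] Compl_atLeast)
  ultimately show ?thesis by simp
qed

text \<open>By \<open>P_V\<close> the shifted average misses the times below \<open>t\<close>.
  Splitting off the constant \<open>g x\<close> there leaves a scalar coefficient that vanishes as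
  \<open>t\<close> tends to 0 and an average of P_s g - g over short times.\<close>

lemma V_difference_quotient:
  assumes l: "0 < l" and t: "0 < t" and g: "g \<in> borel_measurable M" and B: "\<And>y. \<bar>g y\<bar> \<le> B"
  shows "(P t (V l g) x - V l g x) / t - (l * V l g x - g x)
    = ((exp (l * t) - 1) / (l * t) - 1) * (l * V l g x - g x)
      + (- (exp (l * t) / (l * t))) * (LINT s|expo l. indicator {..<t} s * (P s g x - g x))"
proof -
  interpret T: prob_space "expo l" by (rule prob_space_expo[OF l])
  let ?e = "exp (l * t)" and ?v = "V l g x"
  have iP: "integrable (expo l) (\<lambda>s. P s g x)" by (rule green_fubini(1)[OF l g B])
  then have iA: "integrable (expo l) (\<lambda>s. indicator A s * P s g x)" if "A \<in> sets borel" for A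
    using integrable_mult_indicator[OF _ iP, of A] that by simp
  have i1: "integrable (expo l) (\<lambda>s. g x * indicator {..<t} s)"
    by (intro integrable_mult_right integrable_real_indicator) (auto simp: T.emeasure_eq_measure)
  define I where "I = (LINT s|expo l. indicator {..<t} s * P s g x)"
  have split: "(LINT s|expo l. indicator {t..} s * P s g x) = l * ?v - I"
  proof -
    have "(LINT s|expo l. P s g x) = (LINT s|expo l. indicator {t..} s * P s g x + indicator {..<t} s * P s g x)"
      by (intro Bochner_Integration.integral_cong) (auto simp: indicator_def)
    also have "\<dots> = (LINT s|expo l. indicator {t..} s * P s g x) + I"
      using iA by (simp add: I_def)
    finally show ?thesis using l by (simp add: V_def)
  qed
  have R: "(LINT s|expo l. indicator {..<t} s * (P s g x - g x)) = I - g x * (1 - exp (- l * t))"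
  proof -
    have "(LINT s|expo l. indicator {..<t} s * (P s g x - g x)) = (LINT s|expo l. indicator {..<t} s * P s g x - g x * indicator {..<t} s)"
      by (intro Bochner_Integration.integral_cong) (auto simp: algebra_simps)
    also have "\<dots> = I - g x * measure (expo l) {..<t}"
      using iA i1 by (simp add: I_def)
    finally show ?thesis using expo_measure_below[OF l t] by simp
  qed
  have P: "P t (V l g) x = ?e / l * (l * ?v - I)"
    using P_V[OF l t g B, of x] by (simp only: split)
  have e: "?e * exp (- l * t) = 1" by (simp add: exp_minus)
  have "?e * (I - g x * (1 - exp (- l * t))) = ?e * I - g x * (?e - ?e * exp (- l * t))"
    by (simp add: algebra_simps)
  then have eR: "?e * (I - g x * (1 - exp (- l * t))) = ?e * I - g x * (?e - 1)" unfolding e .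
  have "((?e - 1) / (l * t) - 1) * (l * ?v - g x) + (- (?e / (l * t))) * (I - g x * (1 - exp (- l * t)))
    = ((?e - 1) / (l * t) - 1) * (l * ?v - g x) - (?e * (I - g x * (1 - exp (- l * t)))) / (l * t)"
    by simp
  also have "\<dots> = (?e / l * (l * ?v - I) - ?v) / t - (l * ?v - g x)"
    unfolding eR using l t by (simp add: field_simps)
  finally show ?thesis unfolding P R by simp
qed

text \<open>The window of short times has mass at most l t, whose square cancels the prefactor 1 /
  (l t)^2; only the size of P_s g - g for s < t remains.\<close>

lemma V_difference_quotient_L2:
  assumes l: "0 < l" and t: "0 < t" and g: "g \<in> L2_fun M" and B: "\<And>y. \<bar>g y\<bar> \<le> B" and int: "integrable M g"
    and D: "\<And>s. 0 < s \<Longrightarrow> s < t \<Longrightarrow> (LINT x|M. (P s g x - g x)\<^sup>2) \<le> D" and D0: "0 \<le> D"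
  shows "(LINT x|M. ((P t (V l g) x - V l g x) / t - (l * V l g x - g x))\<^sup>2)
    \<le> 2 * ((exp (l * t) - 1) / (l * t) - 1)\<^sup>2 * (LINT x|M. (l * V l g x - g x)\<^sup>2) + 2 * (exp (l * t))\<^sup>2 * D"
proof -
  have gm: "g \<in> borel_measurable M" using g by (simp add: L2_fun_def)
  let ?R = "\<lambda>x. LINT s|expo l. indicator {..<t} s * (P s g x - g x)"
  have lv: "(\<lambda>x. l * V l g x + (- 1) * g x) \<in> L2_fun M"
    by (rule L2_fun_add_scale(1)[OF V_L2[OF l g B int] g])
  then have lv: "(\<lambda>x. l * V l g x - g x) \<in> L2_fun M" by simp
  have meas: "(\<lambda>(s, x). P s g x - g x) \<in> borel_measurable (expo l \<Otimes>\<^sub>M M)"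
    using P_measurable_joint[OF l gm B] gm by (simp add: case_prod_beta')
  have bd: "\<bar>P s g x - g x\<bar> \<le> K_p * B + B" for s x
    using P_bound[OF gm B, of s x] B[of x] by linarith
  have L2: "integrable M (\<lambda>x. (P s g x - g x)\<^sup>2)" if s: "0 < s" for s
  proof -
    have "(\<lambda>x. 1 * P s g x + (- 1) * g x) \<in> L2_fun M"
      by (rule L2_fun_add_scale(1)[OF P_L2[OF s g B int] g])
    then show ?thesis by (simp add: L2_fun_def)
  qed
  have A: "{..<t} \<in> sets borel" by simp
  have R_L2: "?R \<in> L2_fun M"
    by (rule time_average_L2(1)[OF l A meas bd L2 D D0]) auto
  have "(LINT x|M. (?R x)\<^sup>2) \<le> (measure (expo l) {..<t})\<^sup>2 * D"
    by (rule time_average_L2(2)[OF l A meas bd L2 D D0]) auto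
  also have "\<dots> \<le> (l * t)\<^sup>2 * D"
  proof -
    have "1 - l * t \<le> exp (- l * t)" using exp_ge_add_one_self[of "- l * t"] by simp
    then have "(1 - exp (- l * t))\<^sup>2 \<le> (l * t)\<^sup>2" using l t by (intro power_mono) auto
    then show ?thesis using D0 by (simp only: expo_measure_below[OF l t] mult_right_mono)
  qed
  finally have R: "(LINT x|M. (?R x)\<^sup>2) \<le> (l * t)\<^sup>2 * D" .
  have "(LINT x|M. ((P t (V l g) x - V l g x) / t - (l * V l g x - g x))\<^sup>2)
      \<le> 2 * ((exp (l * t) - 1) / (l * t) - 1)\<^sup>2 * (LINT x|M. (l * V l g x - g x)\<^sup>2)
        + 2 * (- (exp (l * t) / (l * t)))\<^sup>2 * (LINT x|M. (?R x)\<^sup>2)"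
    unfolding V_difference_quotient[OF l t gm B] by (rule L2_fun_add_scale(2)[OF lv R_L2])
  also have "2 * (- (exp (l * t) / (l * t)))\<^sup>2 * (LINT x|M. (?R x)\<^sup>2) \<le> 2 * (- (exp (l * t) / (l * t)))\<^sup>2 * ((l * t)\<^sup>2 * D)"
    by (intro mult_left_mono R) auto
  also have "2 * (- (exp (l * t) / (l * t)))\<^sup>2 * ((l * t)\<^sup>2 * D) = 2 * (exp (l * t))\<^sup>2 * D"
    using l t by (simp add: power_divide)
  finally show ?thesis by simp
qed

end

text \<open>The open set where \<open>f\<close> is negative might not belong to the product
  \<sigma>-algebra; a product of two balls inside it does, and has positive measure.\<close>

lemma (in ahlfors_space) AE_nonneg_continuous_pair:
  fixes f :: "'a \<times> 'a \<Rightarrow> real"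
  assumes f: "continuous_on UNIV f" and AE: "AE z in M \<Otimes>\<^sub>M M. 0 \<le> f z"
  shows "0 \<le> f (x, y)"
proof (rule ccontr)
  assume neg: "\<not> 0 \<le> f (x, y)"
  have "open {z. f z < 0}"
    using f by (simp add: open_Collect_less)
  then obtain A B where AB: "open A" "open B" "(x, y) \<in> A \<times> B" "A \<times> B \<subseteq> {z. f z < 0}"
    using neg by (elim open_prod_elim[of _ "(x, y)"]) auto
  obtain d where d: "d > 0" "ball x d \<subseteq> A"
    using AB by (meson mem_Sigma_iff open_contains_ball)
  obtain e where e: "e > 0" "ball y e \<subseteq> B"
    using AB by (meson mem_Sigma_iff open_contains_ball)
  have "AE z in M \<Otimes>\<^sub>M M. z \<notin> ball x d \<times> ball y e"
    using AE by eventually_elim (use AB d e in force)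
  then have "emeasure (M \<Otimes>\<^sub>M M) (ball x d \<times> ball y e) = 0"
    by (simp add: AE_iff_null_sets[symmetric] null_setsD1 del: mem_ball)
  then have "emeasure M (ball x d) = 0 \<or> emeasure M (ball y e) = 0"
    by (simp add: emeasure_pair_measure_Times)
  then show False
    using measure_ball_pos[OF d(1), of x] measure_ball_pos[OF e(1), of y] by (auto simp: measure_def)
qed

section \<open>The domain of the generator and the mass of the Green kernel\<close>

locale dirichlet_heat_kernel = heat_kernel_space M dH c1 c2 p dW c3 c5 + dirichlet_form M E F
  for M :: "'a::metric_space measure" and dH c1 c2 p dW c3 c5 E F +
  fixes S :: "real \<Rightarrow> ('a \<Rightarrow> real) \<Rightarrow> 'a \<Rightarrow> real"
  assumes S_heat: "heat_semigroup M E F S"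
    and S_kernel: "0 < t \<Longrightarrow> f \<in> L2_fun M \<Longrightarrow> AE x in M. S t f x = kernel_op M p t f x"
begin

lemma S_continuous_square:
  assumes g: "g \<in> L2_fun M" and e: "0 < e"
  shows "\<exists>d>0. \<forall>s. 0 < s \<longrightarrow> s < d \<longrightarrow> (LINT x|M. (P s g x - g x)\<^sup>2) < e"
proof -
  interpret l2_contraction_semigroup M S
    using S_heat by (simp add: heat_semigroup_def)
  have "\<forall>\<^sub>F s in at_right 0. L2_norm M (\<lambda>x. S s g x - g x) < sqrt e"
    using P_continuous[OF g] e by (intro order_tendstoD) auto
  then obtain d where d: "d > 0" "\<And>s. 0 < s \<Longrightarrow> s < d \<Longrightarrow> L2_norm M (\<lambda>x. S s g x - g x) < sqrt e"
    by (auto simp: eventually_at_right_field)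
  have [measurable]: "g \<in> borel_measurable M" using g by (simp add: L2_fun_def)
  show ?thesis
  proof (intro exI[of _ d] conjI allI impI)
    fix s :: real assume s: "0 < s" "s < d"
    have [measurable]: "S s g \<in> borel_measurable M" using P_L2[OF s(1) g] by (simp add: L2_fun_def)
    have "(LINT x|M. (P s g x - g x)\<^sup>2) = (LINT x|M. (S s g x - g x)\<^sup>2)"
      using S_kernel[OF s(1) g] by (intro integral_cong_AE) (auto elim!: eventually_mono)
    also have "\<dots> < e"
      using d(2)[OF s] by (simp add: L2_norm_eq)
    finally show "(LINT x|M. (P s g x - g x)\<^sup>2) < e" .
  qed (rule d(1))
qed

text \<open>The resolvent equation L U_l g = l U_l g - g. Through the equality of the two generators
  in \<open>heat_semigroup\<close> it is the bridge from the kernel to the form.\<close>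

lemma V_generator:
  assumes l: "0 < l" and g: "g \<in> L2_fun M" and B: "\<And>y. \<bar>g y\<bar> \<le> B" and int: "integrable M g"
  shows "semigroup_generator M S (V l g) (\<lambda>x. l * V l g x - g x)"
proof -
  interpret S: l2_contraction_semigroup M S
    using S_heat by (simp add: heat_semigroup_def)
  have gm [measurable]: "g \<in> borel_measurable M" using g by (simp add: L2_fun_def)
  have V: "V l g \<in> L2_fun M" by (rule V_L2[OF l g B int])
  have Vm [measurable]: "V l g \<in> borel_measurable M" using V by (simp add: L2_fun_def)
  have "(\<lambda>x. l * V l g x + (- 1) * g x) \<in> L2_fun M" by (rule L2_fun_add_scale(1)[OF V g])
  then have f: "(\<lambda>x. l * V l g x - g x) \<in> L2_fun M" by simp
  define Q where "Q = (LINT x|M. (l * V l g x - g x)\<^sup>2)"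
  define h where "h t x = (P t (V l g) x - V l g x) / t - (l * V l g x - g x)" for t x
  have lim_coeff: "((\<lambda>t. 2 * ((exp (l * t) - 1) / (l * t) - 1)\<^sup>2 * Q) \<longlongrightarrow> 0) (at_right 0)"
  proof -
    have "((\<lambda>t. (exp (l * t) - 1) / (l * t)) \<longlongrightarrow> 1) (at_right 0)"
    proof -
      have "((\<lambda>z. (exp z - 1) / z) \<longlongrightarrow> (1::real)) (at 0)"
        using DERIV_exp[of "0::real"] by (simp add: has_field_derivative_iff)
      moreover have "filterlim (\<lambda>t. l * t) (at 0) (at_right 0)"
        using l by (auto simp: filterlim_at eventually_at_filter intro!: tendsto_eq_intros)
      ultimately show ?thesis by (rule filterlim_compose)
    qed
    then have "((\<lambda>t. 2 * ((exp (l * t) - 1) / (l * t) - 1)\<^sup>2 * Q) \<longlongrightarrow> 2 * (1 - 1)\<^sup>2 * Q) (at_right 0)"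
      by (intro tendsto_intros)
    then show ?thesis by simp
  qed
  have lim_exp: "((\<lambda>t. 2 * (exp (l * t))\<^sup>2) \<longlongrightarrow> 2) (at_right 0)"
    by (auto intro!: tendsto_eq_intros)
  have lim: "((\<lambda>t. LINT x|M. (h t x)\<^sup>2) \<longlongrightarrow> 0) (at_right 0)"
  proof (rule tendstoI)
    fix e :: real assume e: "0 < e"
    \<comment> \<open>Since 2 (exp (l t))^2 < 3 for small \<open>t\<close>, this e / 6 contributes
      at most e / 2.\<close>
    obtain d where d: "d > 0" "\<And>s. 0 < s \<Longrightarrow> s < d \<Longrightarrow> (LINT x|M. (P s g x - g x)\<^sup>2) < e / 6"
      using S_continuous_square[OF g, of "e / 6"] e by auto
    have "\<forall>\<^sub>F t in at_right 0. 2 * ((exp (l * t) - 1) / (l * t) - 1)\<^sup>2 * Q < e / 2"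
      using lim_coeff e by (intro order_tendstoD) auto
    moreover have "\<forall>\<^sub>F t in at_right 0. 2 * (exp (l * t))\<^sup>2 < 3"
      using lim_exp by (rule order_tendstoD) simp
    moreover have "\<forall>\<^sub>F t in at_right 0. 0 < t \<and> t < d"
      using d(1) by (auto simp: eventually_at_right_field)
    ultimately show "\<forall>\<^sub>F t in at_right 0. dist (LINT x|M. (h t x)\<^sup>2) 0 < e"
    proof eventually_elim
      fix t
      assume c1: "2 * ((exp (l * t) - 1) / (l * t) - 1)\<^sup>2 * Q < e / 2" and c2: "2 * (exp (l * t))\<^sup>2 < 3"
        and t: "0 < t \<and> t < d"
      have "(LINT x|M. (h t x)\<^sup>2) \<le> 2 * ((exp (l * t) - 1) / (l * t) - 1)\<^sup>2 * Q + 2 * (exp (l * t))\<^sup>2 * (e / 6)"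
        unfolding h_def Q_def
        using t e d(2) by (intro V_difference_quotient_L2[OF l _ g B int]) (auto intro: less_imp_le)
      also have "2 * (exp (l * t))\<^sup>2 * (e / 6) \<le> 3 * (e / 6)"
        using c2 e by (intro mult_right_mono) auto
      finally show "dist (LINT x|M. (h t x)\<^sup>2) 0 < e"
        using c1 by simp
    qed
  qed
  have "((\<lambda>t. L2_norm M (\<lambda>x. (S t (V l g) x - V l g x) / t - (l * V l g x - g x))) \<longlongrightarrow> 0) (at_right 0)"
  proof (rule Lim_transform_eventually)
    show "((\<lambda>t. sqrt (LINT x|M. (h t x)\<^sup>2)) \<longlongrightarrow> 0) (at_right 0)"
      using tendsto_real_sqrt[OF lim] by simp
    show "\<forall>\<^sub>F t in at_right 0. sqrt (LINT x|M. (h t x)\<^sup>2) = L2_norm M (\<lambda>x. (S t (V l g) x - V l g x) / t - (l * V l g x - g x))"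
      unfolding eventually_at_right_field
    proof (intro exI[of _ 1] conjI allI impI)
      fix t :: real assume t: "0 < t" "t < 1"
      have [measurable]: "S t (V l g) \<in> borel_measurable M" using S.P_L2[OF t(1) V] by (simp add: L2_fun_def)
      have "(LINT x|M. (h t x)\<^sup>2) = (LINT x|M. ((S t (V l g) x - V l g x) / t - (l * V l g x - g x))\<^sup>2)"
        unfolding h_def
        using S_kernel[OF t(1) V] by (intro integral_cong_AE) (auto elim!: eventually_mono)
      then show "sqrt (LINT x|M. (h t x)\<^sup>2) = L2_norm M (\<lambda>x. (S t (V l g) x - V l g x) / t - (l * V l g x - g x))"
        by (simp add: L2_norm_eq)
    qed simp
  qed
  then show ?thesis using V f by (simp add: semigroup_generator_def)
qed

text \<open>The constant 1 is not square integrable, the measure being infinite, so the Markov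
  property is applied to the indicator of a ball; continuity of \<open>V\<close> gives the
  conclusion at every \<open>x\<close>.\<close>

lemma green_ball_mass:
  assumes l: "0 < l"
  shows "l * (LINT y|M. green l x y * indicator (ball a r) y) \<le> 1"
proof -
  let ?g = "indicator (ball a r) :: 'a \<Rightarrow> real"
  have gm: "?g \<in> borel_measurable M" and B: "\<And>y. \<bar>?g y\<bar> \<le> 1"
    by (auto simp: indicator_def simp del: mem_ball)
  have int: "integrable M ?g" by (rule integrable_indicator_ball)
  have "(\<lambda>y. (?g y)\<^sup>2) = ?g" by (auto simp: indicator_def)
  then have g: "?g \<in> L2_fun M" using gm int by (simp add: L2_fun_def)
  have "form_generator M E F (V l ?g) (\<lambda>x. l * V l ?g x - ?g x)"
    using V_generator[OF l g B int] S_heat by (simp add: heat_semigroup_def)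
  then have "AE x in M. l * V l ?g x \<le> 1"
    by (rule resolvent_markov[OF l _ g]) (auto simp: indicator_def)
  then have "0 \<le> 1 - l * V l ?g x"
    by (intro AE_nonneg_continuous continuous_intros V_continuous[OF l gm B]) (auto elim: eventually_mono)
  then show ?thesis
    unfolding green_fubini(3)[OF l gm B] by (simp add: V_def)
qed

sublocale markov_heat_kernel M dH c1 c2 p dW c3 c5
proof
  fix l :: real and x :: 'a assume l: "0 < l"
  \<comment> \<open>Balls of growing radius exhaust the space, which leads from indicators to the
    constant 1.\<close>
  have "(\<lambda>n. LINT y|M. green l x y * indicator (ball x (real n)) y) \<longlonglongrightarrow> (LINT y|M. green l x y)"
  proof (rule integral_dominated_convergence)
    show "integrable M (green l x)" by (rule green_integrable[OF l])
    show "green l x \<in> borel_measurable M" by (rule green_measurable[OF l])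
    show "(\<lambda>y. green l x y * indicator (ball x (real n)) y) \<in> borel_measurable M" for n
      using green_measurable[OF l] by measurable
    show "AE y in M. norm (green l x y * indicator (ball x (real n)) y) \<le> green l x y" for n
      using green_nonneg[OF l] by (auto simp: indicator_def)
    show "AE y in M. (\<lambda>n. green l x y * indicator (ball x (real n)) y) \<longlonglongrightarrow> green l x y"
    proof (rule AE_I2)
      fix y
      obtain N where N: "dist x y < real N" using reals_Archimedean2 by blast
      have "\<forall>\<^sub>F n in sequentially. green l x y * indicator (ball x (real n)) y = green l x y"
        using eventually_ge_at_top[of N]
      proof eventually_elim
        fix n assume "N \<le> n"
        then have "dist x y < real n" using N by (meson less_le_trans of_nat_le_iff)
        then show "green l x y * indicator (ball x (real n)) y = green l x y" by simp
      qed
      then show "(\<lambda>n. green l x y * indicator (ball x (real n)) y) \<longlonglongrightarrow> green l x y"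
        by (rule tendsto_eventually)
    qed
  qed
  then have "(\<lambda>n. l * (LINT y|M. green l x y * indicator (ball x (real n)) y)) \<longlonglongrightarrow> l * (LINT y|M. green l x y)"
    by (intro tendsto_intros)
  then show "l * (LINT y|M. green l x y) \<le> 1"
    by (rule LIMSEQ_le_const2) (use green_ball_mass[OF l] in blast)
qed

end

section \<open>Sub-Gaussian Dirichlet spaces\<close>

text \<open>In the scale-free distance r / t^(1/dW) the exponent is the pure power dW / (dW - 1) > 1
  that \<open>sub_gaussian_le_polynomial\<close> expects.\<close>

lemma sub_gaussian_scaled:
  assumes t: "0 < t" and dW: "1 < dW" and r: "0 \<le> r"
  shows "sub_gaussian dH dW c k t r
    = c * t powr (- dH / dW) * exp (- k * (r / t powr (1 / dW)) powr (dW / (dW - 1)))"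
proof -
  have "r powr dW / t = (r / t powr (1 / dW)) powr dW"
    using t dW r by (simp add: powr_divide powr_powr)
  then have "(r powr dW / t) powr (1 / (dW - 1)) = (r / t powr (1 / dW)) powr (dW / (dW - 1))"
    by (simp add: powr_powr)
  then show ?thesis by (simp add: sub_gaussian_def)
qed

lemma sub_gaussian_continuous:
  fixes M :: "'a::metric_space measure"
  assumes "1 < dW" "0 < t"
  shows "continuous_on UNIV (\<lambda>z::'a \<times> 'a. sub_gaussian dH dW c k t (dist (fst z) (snd z)))"
  unfolding sub_gaussian_def using assms
  by (intro continuous_intros continuous_on_powr') (auto intro!: continuous_intros)

context sub_gaussian_dirichlet_space
begin

lemma ahlfors_space_constants:
  obtains c1 c2 where "ahlfors_space M dH c1 c2"
proof -
  obtain c1 c2 where c: "0 < dH" "0 < c1" "0 < c2" "\<And>x r. 0 \<le> r \<Longrightarrow>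
      ennreal (c1 * r powr dH) \<le> emeasure M (ball x r) \<and> emeasure M (ball x r) \<le> ennreal (c2 * r powr dH)"
    using ahlfors unfolding ahlfors_regular_def by auto
  have "ahlfors_space M dH c1 c2"
  proof
    show "sets M = sets borel" using radon by (simp add: radon_measure_def)
    show "\<exists>D::'a set. countable D \<and> (\<forall>x. \<forall>e>0. \<exists>d\<in>D. dist x d < e)"
      by (rule separable_of_proper[OF compact_balls])
  qed (use c in auto)
  then show ?thesis by (rule that)
qed

text \<open>The kernel is unconstrained at nonpositive times; cutting it off there makes it measurable in
  time on the whole line.\<close>

definition p0 :: "real \<Rightarrow> 'a \<Rightarrow> 'a \<Rightarrow> real" where
  "p0 t x y = (if 0 < t then p t x y else 0)"

lemma kernel_op_p0: "0 < t \<Longrightarrow> kernel_op M p0 t g = kernel_op M p t g"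
  by (simp add: kernel_op_def p0_def fun_eq_iff)

lemma dW_gt_1: "1 < dW"
  using dW_gt_2 by simp

lemma p_continuous: "0 < t \<Longrightarrow> continuous_on UNIV (\<lambda>(x, y). p t x y)"
  using heat_kernel by (auto simp: continuous_heat_kernel_def)

lemma P_kernel:
  assumes "0 < t" "f \<in> L2_fun M"
  shows "AE x in M. P t f x = kernel_op M p0 t f x"
  unfolding kernel_op_p0[OF assms(1)]
  using heat_kernel assms unfolding continuous_heat_kernel_def
  by (auto elim!: eventually_mono)

text \<open>The kernel and the sub-Gaussian bounds are continuous in the pair of points, so
  \<open>AE_nonneg_continuous_pair\<close> removes the exceptional sets.\<close>

lemma pointwise_estimates:
  obtains c3 c4 c5 c6 where "0 < c3" "0 < c4" "0 < c5" "0 < c6"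
    "\<And>t x y. 0 < t \<Longrightarrow> sub_gaussian dH dW c5 c6 t (dist x y) \<le> p t x y"
    "\<And>t x y. 0 < t \<Longrightarrow> p t x y \<le> sub_gaussian dH dW c3 c4 t (dist x y)"
proof -
  obtain c1 c2 where "ahlfors_space M dH c1 c2" by (rule ahlfors_space_constants)
  then interpret A: ahlfors_space M dH c1 c2 .
  obtain c3 c4 c5 c6 where c: "0 < c3" "0 < c4" "0 < c5" "0 < c6"
    "\<And>t. 0 < t \<Longrightarrow> AE (x, y) in M \<Otimes>\<^sub>M M.
        sub_gaussian dH dW c5 c6 t (dist x y) \<le> p t x y \<and> p t x y \<le> sub_gaussian dH dW c3 c4 t (dist x y)"
    using estimates unfolding sub_gaussian_estimates_def by auto
  note sg = sub_gaussian_continuous[OF dW_gt_1]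
  have lower: "sub_gaussian dH dW c5 c6 t (dist x y) \<le> p t x y" if t: "0 < t" for t x y
  proof -
    have "0 \<le> (\<lambda>z. (\<lambda>(x, y). p t x y) z - sub_gaussian dH dW c5 c6 t (dist (fst z) (snd z))) (x, y)"
      by (rule A.AE_nonneg_continuous_pair[OF continuous_on_diff[OF p_continuous[OF t] sg[OF t]]])
        (use c(5)[OF t] in \<open>auto elim!: eventually_mono\<close>)
    then show ?thesis by simp
  qed
  have upper: "p t x y \<le> sub_gaussian dH dW c3 c4 t (dist x y)" if t: "0 < t" for t x y
  proof -
    have "0 \<le> (\<lambda>z. sub_gaussian dH dW c3 c4 t (dist (fst z) (snd z)) - (\<lambda>(x, y). p t x y) z) (x, y)"
      by (rule A.AE_nonneg_continuous_pair[OF continuous_on_diff[OF sg[OF t] p_continuous[OF t]]])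
        (use c(5)[OF t] in \<open>auto elim!: eventually_mono\<close>)
    then show ?thesis by simp
  qed
  show ?thesis by (rule that[OF c(1-4) lower upper])
qed

lemma semigroup: "l2_contraction_semigroup M P"
  using heat_semigroup by (simp add: heat_semigroup_def)

text \<open>The bounds are established first, because symmetry and Chapman-Kolmogorov are then
  derived inside \<open>heat_kernel_bounds\<close> by testing the semigroup on balls.\<close>

lemma dirichlet_heat_kernel_constants:
  assumes dim: "dH < dW"
  obtains c1 c2 c3 c5 where "dirichlet_heat_kernel M dH c1 c2 p0 dW c3 c5 E F P"
proof -
  interpret S: l2_contraction_semigroup M P by (rule semigroup)
  obtain c1 c2 where A: "ahlfors_space M dH c1 c2" by (rule ahlfors_space_constants)
  then interpret A: ahlfors_space M dH c1 c2 .
  obtain c3 c4 c5 c6 where c: "0 < c3" "0 < c4" "0 < c5" "0 < c6"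
    and lower: "\<And>t x y. 0 < t \<Longrightarrow> sub_gaussian dH dW c5 c6 t (dist x y) \<le> p t x y"
    and upper: "\<And>t x y. 0 < t \<Longrightarrow> p t x y \<le> sub_gaussian dH dW c3 c4 t (dist x y)"
    using pointwise_estimates by blast
  define q where "q = dW / (dW - 1)"
  \<comment> \<open>Makes (1 + \<xi>)^(-m) the square of the weight.\<close>
  define m where "m = 2 * (dH + 1)"
  have q: "1 < q" using dW_gt_1 by (simp add: q_def)
  have m: "0 < m" using A.dH_pos by (simp add: m_def)
  define C where "C = c3 * (exp (2 * c4) * (m / c4) powr m)"
  \<comment> \<open>The lower bound at scale-free distance 4, the edge of the near-diagonal
    range.\<close>
  define D where "D = c5 * exp (- c6 * 4 powr q)"
  interpret B: heat_kernel_bounds M dH c1 c2 p0 dW C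
  proof
    show "dH < dW" by (rule dim)
    show "0 < C" using c m by (simp add: C_def)
    show "p0 s x y = 0" if "s \<le> 0" for s x y using that by (simp add: p0_def)
    show "continuous_on UNIV (\<lambda>(x, y). p0 s x y)" if "0 < s" for s
      using p_continuous[OF that] that by (simp add: p0_def)
    show "0 \<le> p0 s x y" for s x y
    proof (cases "0 < s")
      case True
      have "0 \<le> sub_gaussian dH dW c5 c6 s (dist x y)" using c by (simp add: sub_gaussian_def)
      then show ?thesis using lower[OF True, of x y] True by (simp add: p0_def)
    qed (simp add: p0_def)
    show "p0 s x y \<le> C * s powr (- dH / dW) * (A.wt (s powr (1 / dW)) x y)\<^sup>2" if s: "0 < s" for s x y
    proof -
      let ?\<xi> = "dist x y / s powr (1 / dW)"
      have \<xi>: "0 < 1 + ?\<xi>" by (simp add: add_pos_nonneg del: add_divide_distrib)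
      have "p0 s x y \<le> c3 * s powr (- dH / dW) * exp (- c4 * ?\<xi> powr q)"
        using upper[OF s, of x y] s sub_gaussian_scaled[OF s dW_gt_1 zero_le_dist, of dH c3 c4 x y]
        by (simp add: p0_def q_def)
      also have "\<dots> \<le> c3 * s powr (- dH / dW) * (exp (2 * c4) * (m / c4) powr m * (1 + ?\<xi>) powr (- m))"
        using c s by (intro mult_left_mono sub_gaussian_le_polynomial q m) auto
      also have "(1 + ?\<xi>) powr (- m) = (A.wt (s powr (1 / dW)) x y)\<^sup>2"
        unfolding A.wt_def m_def power2_eq_square powr_add[symmetric] by simp
      finally show ?thesis by (simp add: C_def mult_ac)
    qed
  qed
  have ind: "indicator (ball a r) \<in> L2_fun M" for a r
  proof -
    have "(\<lambda>y. (indicator (ball a r) y)\<^sup>2) = (indicator (ball a r) :: 'a \<Rightarrow> real)" by (auto simp: indicator_def)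
    then show ?thesis using A.integrable_indicator_ball by (auto simp: L2_fun_def)
  qed
  have P_meas: "P t f \<in> borel_measurable M" if "0 < t" "f \<in> L2_fun M" for t f
    using S.P_L2[OF that] by (simp add: L2_fun_def)
  have f_meas: "f \<in> borel_measurable M" if "f \<in> L2_fun M" for f
    using that by (simp add: L2_fun_def)
  note B_meas = B.P_measurable[OF f_meas]
  have sym: "p0 t x y = p0 t y x" for t x y
  proof (cases "0 < t")
    case t: True
    show ?thesis
    proof (rule B.p_sym_of_balls[OF t])
      fix a b :: 'a and r q :: real
      let ?A = "indicator (ball a r) :: 'a \<Rightarrow> real" and ?B = "indicator (ball b q) :: 'a \<Rightarrow> real"
      have "(LINT x|M. kernel_op M p0 t ?A x * ?B x) = L2_inner M (P t ?A) ?B"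
        unfolding L2_inner_def using P_kernel[OF t ind, of a r]
        by (intro integral_cong_AE borel_measurable_times B_meas P_meas t ind f_meas)
          (auto elim!: eventually_mono)
      also have "\<dots> = L2_inner M ?A (P t ?B)"
        by (rule S.P_sym[OF t ind ind])
      also have "\<dots> = (LINT x|M. ?A x * kernel_op M p0 t ?B x)"
        unfolding L2_inner_def using P_kernel[OF t ind, of b q]
        by (intro integral_cong_AE borel_measurable_times B_meas P_meas t ind f_meas)
          (auto elim!: eventually_mono)
      finally show "(LINT x|M. kernel_op M p0 t ?A x * ?B x) = (LINT x|M. ?A x * kernel_op M p0 t ?B x)" .
    qed
  qed (simp add: p0_def)
  have "dirichlet_heat_kernel M dH c1 c2 p0 dW C D E F P"
  proof
    show "0 < D" using c by (simp add: D_def)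
    show "p0 s x y = p0 s y x" for s x y by (rule sym)
    show "D * s powr (- dH / dW) \<le> p0 s x y" if s: "0 < s" and d: "dist x y \<le> 4 * s powr (1 / dW)" for s x y
    proof -
      let ?\<xi> = "dist x y / s powr (1 / dW)"
      have "?\<xi> \<le> 4" using s d by (simp add: field_simps)
      then have "?\<xi> powr q \<le> 4 powr q" using q by (intro powr_mono2) auto
      then have "exp (- c6 * 4 powr q) \<le> exp (- c6 * ?\<xi> powr q)" using c by simp
      then have "c5 * s powr (- dH / dW) * exp (- c6 * 4 powr q) \<le> c5 * s powr (- dH / dW) * exp (- c6 * ?\<xi> powr q)"
        using c by (intro mult_left_mono) auto
      then have "D * s powr (- dH / dW) \<le> c5 * s powr (- dH / dW) * exp (- c6 * ?\<xi> powr q)"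
        by (simp only: D_def mult_ac)
      also have "\<dots> \<le> p0 s x y"
        using lower[OF s, of x y] s sub_gaussian_scaled[OF s dW_gt_1 zero_le_dist, of dH c5 c6 x y]
        by (simp add: p0_def q_def)
      finally show ?thesis .
    qed
    show "(LINT z|M. p0 s x z * p0 t z y) = p0 (s + t) x y" if s: "0 < s" and t: "0 < t" for s t x y
    proof (rule B.chapman_kolmogorov_of_balls[OF s t sym])
      fix a :: 'a and r :: real
      let ?A = "indicator (ball a r) :: 'a \<Rightarrow> real"
      have PA: "P t ?A \<in> L2_fun M" by (rule S.P_L2[OF t ind])
      have eq: "kernel_op M p0 s (P t ?A) x = kernel_op M p0 s (kernel_op M p0 t ?A) x" for x
        unfolding kernel_op_def[of M p0 s] using P_kernel[OF t ind, of a r]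
        by (intro integral_cong_AE borel_measurable_times B.p_measurable f_meas[OF PA] B_meas ind)
          (auto elim!: eventually_mono)
      show "AE x in M. kernel_op M p0 (s + t) ?A x = kernel_op M p0 s (kernel_op M p0 t ?A) x"
        using P_kernel[OF add_pos_pos[OF s t] ind, of a r] P_kernel[OF s PA] S.P_semigroup[OF s t ind, of a r]
        by eventually_elim (simp add: eq)
    qed
    show "(LINT x|M. (kernel_op M p0 s f x)\<^sup>2) \<le> (LINT x|M. (f x)\<^sup>2)" if s: "0 < s" and f: "f \<in> L2_fun M" for s f
    proof -
      have "(LINT x|M. (kernel_op M p0 s f x)\<^sup>2) = (LINT x|M. (P s f x)\<^sup>2)"
        using P_kernel[OF s f]
        by (intro integral_cong_AE borel_measurable_power B_meas P_meas s f) (auto elim!: eventually_mono)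
      also have "\<dots> \<le> (LINT x|M. (f x)\<^sup>2)"
        using S.P_contraction[OF s f] by (simp add: L2_norm_eq)
      finally show ?thesis .
    qed
  qed (use heat_semigroup P_kernel in auto)
  then show ?thesis by (rule that)
qed

end

text \<open>\<open>real_of_ereal\<close> sends infinite values to 0, so finiteness of the essential
  supremum is what makes the norm a bound. Nonnegativity holds because \<open>M\<close> is not null,
  through \<open>AE_nonneg_continuous\<close> for a constant.\<close>

lemma (in ahlfors_space) Linf_AE_bound:
  assumes "g \<in> Linf_fun M"
  shows "AE x in M. \<bar>g x\<bar> \<le> Linf_norm M g" and "0 \<le> Linf_norm M g"
proof -
  let ?e = "esssup M (\<lambda>x. ereal \<bar>g x\<bar>)"
  have AE: "AE x in M. ereal \<bar>g x\<bar> \<le> ?e" by (rule esssup_AE)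
  have fin: "?e < \<infinity>" using assms by (simp add: Linf_fun_def)
  show bound: "AE x in M. \<bar>g x\<bar> \<le> Linf_norm M g"
    using AE fin unfolding Linf_norm_def by (cases ?e) (auto elim!: eventually_mono)
  show "0 \<le> Linf_norm M g"
  proof (rule AE_nonneg_continuous)
    show "AE x in M. 0 \<le> Linf_norm M g"
      using bound by eventually_elim (rule order_trans[OF abs_ge_zero])
  qed simp
qed

theorem theorem3p7:
  fixes M :: "'a::metric_space measure"
    and E :: "('a \<Rightarrow> real) \<Rightarrow> ('a \<Rightarrow> real) \<Rightarrow> real"
    and F :: "('a \<Rightarrow> real) set"
    and P :: "real \<Rightarrow> ('a \<Rightarrow> real) \<Rightarrow> 'a \<Rightarrow> real"
    and p :: "real \<Rightarrow> 'a \<Rightarrow> 'a \<Rightarrow> real"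
    and dH dW :: real
  assumes "sub_gaussian_dirichlet_space M E F P p dH dW"
    and "fractional_metric_space M dH"
    and "1 \<le> dH" and "dH < dW"
  shows "weak_bakry_emery M p dW (dW - dH)"
proof -
  interpret S: sub_gaussian_dirichlet_space M E F P p dH dW by fact
  obtain c1 c2 c3 c5 where "dirichlet_heat_kernel M dH c1 c2 S.p0 dW c3 c5 E F P"
    using S.dirichlet_heat_kernel_constants[OF assms(4)] .
  then interpret K: dirichlet_heat_kernel M dH c1 c2 S.p0 dW c3 c5 E F P .
  obtain C where C: "C > 0" "\<And>t g B x y. 0 < t \<Longrightarrow> g \<in> borel_measurable M \<Longrightarrow> (\<And>y. \<bar>g y\<bar> \<le> B) \<Longrightarrow>
      \<bar>kernel_op M S.p0 t g x - kernel_op M S.p0 t g y\<bar> \<le> C * (dist x y powr (dW - dH) / t powr ((dW - dH) / dW)) * B"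
    using K.P_hoelder by blast
  have "\<bar>kernel_op M p t g x - kernel_op M p t g y\<bar> \<le> C * (dist x y powr (dW - dH) / t powr ((dW - dH) / dW)) * Linf_norm M g"
    if t: "0 < t" and g: "g \<in> Linf_fun M" for t g x y
  proof -
    let ?N = "Linf_norm M g"
    \<comment> \<open>\<open>P_hoelder\<close> asks for a bound at every point; truncation at the
      norm changes \<open>g\<close> only on a null set, which the kernel operator does not
      see.\<close>
    define h where "h z = max (- ?N) (min (g z) ?N)" for z
    have N: "AE x in M. \<bar>g x\<bar> \<le> ?N" "0 \<le> ?N" by (rule K.Linf_AE_bound[OF g])+
    have [measurable]: "g \<in> borel_measurable M" using g by (simp add: Linf_fun_def)
    have hm [measurable]: "h \<in> borel_measurable M" unfolding h_def[abs_def] by measurable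
    have hN: "\<bar>h z\<bar> \<le> ?N" for z using N(2) by (auto simp: h_def)
    have "AE z in M. h z = g z"
      using N(1) by eventually_elim (auto simp: h_def)
    then have "kernel_op M S.p0 t g z = kernel_op M S.p0 t h z" for z
      unfolding kernel_op_def
      by (intro integral_cong_AE borel_measurable_times K.p_measurable) (auto elim!: eventually_mono)
    then show ?thesis
      using C(2)[OF t hm hN, of x y] by (simp add: S.kernel_op_p0[OF t, symmetric])
  qed
  then show ?thesis
    unfolding weak_bakry_emery_def using C(1) assms(4) K.dH_pos by auto
qed

end
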